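(* Let $X$ be a linear diffusion on $\mathcal I=(\alpha,\beta)$ as described in the context, and fix $x\in\mathcal I$. Assume (Case (II)): $\beta<\infty$, $\beta$ is attractive and $\alpha$ is not (that is, $S(\alpha)=-\infty$ and $S(\beta)<\infty$), and $\lim_{a\to\alpha}\mathbb P_x(\tau_a<\infty)\,a^2=0$. Then $V(x)<\infty$. Furthermore: (A) There exist $a^*,y^*\in(\alpha,x]$, $b^*\in[x,\beta]$ and $p^*\in[0,1]$ such that $\tau^*=\xi_{p^*}\tau_{(y^*,\beta)}+(1-\xi_{p^*})\tau_{(a^*,b^* )}$ is an optimal stopping time for the variance problem, i.e. $V(x)=\mathrm{Var}_x\{X_{\tau^*}\}$. (B) Assume in addition the following: for each $c\in\mathcal I$ let $Y(c)$ denote the set of $y$ maximizing $\frac{y^2-\beta^2-2c(y-\beta)}{S(\beta)-S(y)}$; for each $c\in\mathcal I$ for which $Y(c)$ has more than one element one has $\mathbb E_{\hat y_s}\{X_{\tau_{(\hat y_i,\beta)}}\}<c$, where $\hat y_i=\inf Y(c)$ and $\hat y_s=\sup Y(c)$. Then there exist $y_1^*,y_2^*\in(\alpha,x]$ and $p^*\in[0,1]$ such that $\tau^*=\xi_{p^*}\tau_{(y_1^*,\beta)}+(1-\xi_{p^*})\tau_{(y_2^*,\beta)}$ is an optimal stopping time. (C) Assume in addition (to Case (II)) that $S$ is differentiable and that $y\mapsto\frac{S'(y)}{S(\beta)-S(y)}(\beta-y)$ is non-increasing. Then $\tau_{(y^*,\beta)}$ is an optimal stopping time, where $y^*=y^*(x)$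 is the unique solution on $(\alpha,x)$ of $$\frac{S(x)-S(y)}{S(x)-\frac12S(y)-\frac12S(\beta)}=\frac{S'(y)}{S(\beta)-S(y)}(\beta-y),$$ and $V(x)=(\beta-y^* )^2\,\frac{S(\beta)-S(x)}{S(\beta)-S(y^* )}\left(\frac{S(x)-S(y^* )}{S(\beta)-S(y^* )}\right)$.
   Context: Setting. $X=(X_t)_{t\ge 0}$ is a regular linear diffusion on a filtered probability space $(\Omega,\mathcal F,\mathbb F,\mathbb P)$, where $\mathbb F$ is the filtration generated by $X$; it evolves on an interval $\mathcal I=(\alpha,\beta)\subseteq\mathbb R$, and $\mathbb P_x,\mathbb E_x,\mathrm{Var}_x$ refer to $X_0=x$. The boundaries may be natural, exit, entrance or killing (killing end points belong to $\mathcal I$); absorbing boundaries are also allowed. On the interior of $\mathcal I$ the diffusion is regular (from any interior point it hits any other interior point with positive probability), it does not die inside the state space, and its scale function $S$ and speed measure $m$ are continuous. $S$ is increasing and continuous and $\mathbb P_x(\tau_b<\tau_a)=\frac{S(x)-S(a)}{S(b)-S(a)}$ for $\alpha<a<x<b<\beta$. Boundary values of $S$ are limits; $S$ is normalized so that $S(\alpha)=0$ or $S(\alpha)=-\infty$. The boundary $\alpha$ (resp. $\beta$) is attractive if $X$ converges to it with positive probability, equivalently $S(\alpha)>-\infty$ (resp. $S(\beta)<\infty$). Stopping times may take the value $\infty$; with $\zeta=\inf\{t\ge0: X_t=\alpha\text{ or }\beta\}$ one sets $X_\infty:=\limsup_{t\to\zeta}X_t$, and for evaluating $X_\tau$ the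 process is regarded as staying at an end point after reaching it. Notation: $\tau_z=\inf\{t\ge0:X_t=z\}$, $\tau_{(z,y)}=\inf\{t\ge0:X_t\notin(z,y)\}$, $\tau_{(\alpha,z)}=\lim_{a\to\alpha}\tau_{(a,z)}$, $\tau_{(z,\beta)}=\lim_{b\to\beta}\tau_{(z,b)}$. Randomized stopping times: let $U$ be uniform on $[0,1]$ and independent of $X$ (enlarging the probability space if necessary); $\mathcal T$ is the class of all stopping times of the filtration $\hat{\mathbb F}_t=\sigma\{U,(X_s)_{0\le s\le t}\}$. $\xi_p$ denotes a Bernoulli variable independent of $X$ with $\mathbb P(\xi_p=1)=p=1-\mathbb P(\xi_p=0)$ (e.g. $\xi_p=\mathbf 1_{\{U<p\}}$), so $\xi_p\tau_1+(1-\xi_p)\tau_2$ equals $\tau_1$ if $\xi_p=1$ and $\tau_2$ if $\xi_p=0$. Variance problem: $V(x)=\sup_{\tau\in\mathcal T}\mathrm{Var}_x\{X_\tau\}$; $\tau^*\in\mathcal T$ is optimal if $V(x)=\mathrm{Var}_x\{X_{\tau^*}\}$. *)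

theory Defs
  imports "HOL-Probability.Probability"
begin

section \<open>Natural and randomized filtrations\<close>

text \<open>The time index runs through \<open>[0,\<infinity>]\<close>, so that stopping times may take the value \<open>\<infinity>\<close>.
  Processes have values in the extended reals because an end point of the state space may be
  infinite.\<close>

definition natural_filt :: "'a set \<Rightarrow> (real \<Rightarrow> 'a \<Rightarrow> ereal) \<Rightarrow> ennreal \<Rightarrow> 'a measure" where
  "natural_filt \<Omega> X t = sigma \<Omega> {X s -` A \<inter> \<Omega> | s A. 0 \<le> s \<and> ennreal s \<le> t \<and> A \<in> sets borel}"

definition randomized_filt ::
    "'a set \<Rightarrow> ('a \<Rightarrow> real) \<Rightarrow> (real \<Rightarrow> 'a \<Rightarrow> ereal) \<Rightarrow> ennreal \<Rightarrow> 'a measure" where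
  "randomized_filt \<Omega> U X t = sigma \<Omega>
     ({U -` A \<inter> \<Omega> | A. A \<in> sets borel} \<union>
      {X s -` A \<inter> \<Omega> | s A. 0 \<le> s \<and> ennreal s \<le> t \<and> A \<in> sets borel})"

section \<open>Hitting times, exit times, stopped process\<close>

definition hit_time :: "(real \<Rightarrow> 'a \<Rightarrow> ereal) \<Rightarrow> real \<Rightarrow> 'a \<Rightarrow> ennreal" where
  "hit_time X z \<omega> = (INF t\<in>{t. 0 \<le> t \<and> X t \<omega> = ereal z}. ennreal t)"

definition interior_exit_time ::
    "(real \<Rightarrow> 'a \<Rightarrow> ereal) \<Rightarrow> real \<Rightarrow> ereal \<Rightarrow> 'a \<Rightarrow> ennreal" where
  "interior_exit_time X z y \<omega> = (INF t\<in>{t. 0 \<le> t \<and> X t \<omega> \<notin> {ereal z<..<y}}. ennreal t)"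

text \<open>Exit time from \<open>(z,y)\<close>, where \<open>\<beta>\<close> is the upper end point of the state space; for
  \<open>y = \<beta>\<close> it is the limit of the exit times from \<open>(z,b)\<close> as \<open>b\<close> increases to \<open>\<beta>\<close>.\<close>

definition exit_time ::
    "(real \<Rightarrow> 'a \<Rightarrow> ereal) \<Rightarrow> ereal \<Rightarrow> real \<Rightarrow> ereal \<Rightarrow> 'a \<Rightarrow> ennreal" where
  "exit_time X \<beta> z y \<omega> =
     (if y < \<beta> then interior_exit_time X z y \<omega>
      else Lim (at_left \<beta>) (\<lambda>b. interior_exit_time X z b \<omega>))"

text \<open>The processes considered below stay at an end point once they have reached it, at time
  \<open>\<zeta>\<close> say. Hence the limit superior at infinity agrees with the one for \<open>t \<rightarrow> \<zeta>\<close>, also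
  when \<open>\<zeta>\<close> is finite.\<close>

definition stopped_at :: "(real \<Rightarrow> 'a \<Rightarrow> ereal) \<Rightarrow> ('a \<Rightarrow> ennreal) \<Rightarrow> 'a \<Rightarrow> ereal" where
  "stopped_at X \<tau> \<omega> =
     (if \<tau> \<omega> = \<infinity> then Limsup at_top (\<lambda>t. X t \<omega>) else X (enn2real (\<tau> \<omega>)) \<omega>)"

definition path_from :: "(real \<Rightarrow> 'a \<Rightarrow> ereal) \<Rightarrow> real \<Rightarrow> 'a \<Rightarrow> real \<Rightarrow> ereal" where
  "path_from X s \<omega> = (\<lambda>t\<in>{0..}. X (s + t) \<omega>)"

abbreviation path_space :: "(real \<Rightarrow> ereal) measure" where
  "path_space \<equiv> PiM {0..} (\<lambda>_. borel)"

section \<open>Regular linear diffusions\<close>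

text \<open>Boundary values of the scale function.\<close>

definition scale_left :: "ereal \<Rightarrow> (real \<Rightarrow> real) \<Rightarrow> ereal" where
  "scale_left \<alpha> S = Lim (at_right \<alpha>) (\<lambda>z. ereal (S (real_of_ereal z)))"

definition scale_right :: "ereal \<Rightarrow> (real \<Rightarrow> real) \<Rightarrow> ereal" where
  "scale_right \<beta> S = Lim (at_left \<beta>) (\<lambda>z. ereal (S (real_of_ereal z)))"

text \<open>Green kernel of the diffusion killed on leaving \<open>(a,b)\<close>; the speed measure \<open>m\<close> is the
  measure that represents the mean exit times through it.\<close>

definition green_kernel :: "(real \<Rightarrow> real) \<Rightarrow> real \<Rightarrow> real \<Rightarrow> real \<Rightarrow> real \<Rightarrow> real" where
  "green_kernel S a b x y = (S (min x y) - S a) * (S b - S (max x y)) / (S b - S a)"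

text \<open>\<open>P x\<close> is the law for the starting point \<open>x\<close> in the open interval \<open>(\<alpha>,\<beta>)\<close>. The process lives
  in \<open>[\<alpha>,\<beta>]\<close>: it never dies in the interior, and at an end point, whatever its type, it is
  frozen from the first visit on. The filtration is not completed, so path properties are required
  for every \<open>\<omega>\<close>. The strong Markov property is needed only while the process is in the
  interior; it compares the law of the future path after \<open>T\<close> with the path law under \<open>P (X\<^sub>T)\<close>, so
  that no shift operators on \<open>\<Omega>\<close> have to be assumed.\<close>

locale linear_diffusion =
  fixes M :: "'a measure"
    and P :: "real \<Rightarrow> 'a measure"
    and X :: "real \<Rightarrow> 'a \<Rightarrow> ereal"
    and \<alpha> \<beta> :: ereal
    and S :: "real \<Rightarrow> real"
    and m :: "real measure"
  assumes endpoints: "\<alpha> < \<beta>"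
    and prob: "\<And>x. x \<in> einterval \<alpha> \<beta> \<Longrightarrow> prob_space (P x)"
    and sets_P: "\<And>x. x \<in> einterval \<alpha> \<beta> \<Longrightarrow> sets (P x) = sets M"
    and X_measurable: "\<And>t. 0 \<le> t \<Longrightarrow> X t \<in> borel_measurable M"
    and X_range: "\<And>t \<omega>. 0 \<le> t \<Longrightarrow> \<omega> \<in> space M \<Longrightarrow> X t \<omega> \<in> {\<alpha>..\<beta>}"
    and X_continuous: "\<And>\<omega>. \<omega> \<in> space M \<Longrightarrow> continuous_on {0..} (\<lambda>t. X t \<omega>)"
    and X_absorbed: "\<And>s t \<omega>. 0 \<le> s \<Longrightarrow> s \<le> t \<Longrightarrow> \<omega> \<in> space M \<Longrightarrow> X s \<omega> \<in> {\<alpha>, \<beta>} \<Longrightarrow> X t \<omega> = X s \<omega>"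
    and X_start: "\<And>x. x \<in> einterval \<alpha> \<beta> \<Longrightarrow> AE \<omega> in P x. X 0 \<omega> = ereal x"
    and P_kernel: "\<And>B. B \<in> sets path_space \<Longrightarrow>
      (\<lambda>x. emeasure (P x) {\<omega> \<in> space M. path_from X 0 \<omega> \<in> B})
        \<in> borel_measurable (restrict_space borel (einterval \<alpha> \<beta>))"
    and strong_Markov: "\<And>x T A B. x \<in> einterval \<alpha> \<beta> \<Longrightarrow>
      stopping_time (natural_filt (space M) X) T \<Longrightarrow>
      A \<in> sets (filtration.pre_sigma (space M) (natural_filt (space M) X) T) \<Longrightarrow>
      B \<in> sets path_space \<Longrightarrow>
      emeasure (P x) {\<omega> \<in> A. T \<omega> < \<infinity> \<and> stopped_at X T \<omega> \<in> {\<alpha><..<\<beta>} \<and>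
                             path_from X (enn2real (T \<omega>)) \<omega> \<in> B} =
      (\<integral>\<^sup>+\<omega>. emeasure (P (real_of_ereal (stopped_at X T \<omega>))) {\<omega>' \<in> space M. path_from X 0 \<omega>' \<in> B} *
             indicator {\<omega> \<in> A. T \<omega> < \<infinity> \<and> stopped_at X T \<omega> \<in> {\<alpha><..<\<beta>}} \<omega> \<partial>P x)"
    and regular: "\<And>x y. x \<in> einterval \<alpha> \<beta> \<Longrightarrow> y \<in> einterval \<alpha> \<beta> \<Longrightarrow>
      measure (P x) {\<omega> \<in> space M. hit_time X y \<omega> < \<infinity>} > 0"
    and scale_increasing: "strict_mono_on (einterval \<alpha> \<beta>) S"
    and scale_continuous: "continuous_on (einterval \<alpha> \<beta>) S"
    and scale_hitting: "\<And>a x b. \<alpha> < ereal a \<Longrightarrow> a < x \<Longrightarrow> x < b \<Longrightarrow> ereal b < \<beta> \<Longrightarrow>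
      measure (P x) {\<omega> \<in> space M. hit_time X b \<omega> < hit_time X a \<omega>} = (S x - S a) / (S b - S a)"
    and scale_normalized: "scale_left \<alpha> S = 0 \<or> scale_left \<alpha> S = -\<infinity>"
    and speed_sets: "sets m = sets borel"
    and speed_locally_finite: "\<And>a b. \<alpha> < ereal a \<Longrightarrow> a < b \<Longrightarrow> ereal b < \<beta> \<Longrightarrow>
      0 < emeasure m {a<..<b} \<and> emeasure m {a<..<b} < \<infinity>"
    and speed_continuous: "\<And>y. y \<in> einterval \<alpha> \<beta> \<Longrightarrow> emeasure m {y} = 0"
    and speed_exit: "\<And>a x b. \<alpha> < ereal a \<Longrightarrow> a < x \<Longrightarrow> x < b \<Longrightarrow> ereal b < \<beta> \<Longrightarrow>
      (\<integral>\<^sup>+\<omega>. interior_exit_time X a (ereal b) \<omega> \<partial>P x) =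
      (\<integral>\<^sup>+y\<in>{a<..<b}. ennreal (green_kernel S a b x y) \<partial>m)"

section \<open>Randomized stopping and the variance problem\<close>

text \<open>The underlying space is assumed to be rich enough to carry the randomizing variable \<open>U\<close>.\<close>

locale randomized_diffusion = linear_diffusion +
  fixes U :: "'a \<Rightarrow> real"
  assumes U_measurable: "U \<in> borel_measurable M"
    and U_uniform: "\<And>x. x \<in> einterval \<alpha> \<beta> \<Longrightarrow>
      distr (P x) borel U = uniform_measure lborel {0..1}"
    and U_indep: "\<And>x. x \<in> einterval \<alpha> \<beta> \<Longrightarrow>
      prob_space.indep_set (P x) {U -` A \<inter> space M | A. A \<in> sets borel}
        (sets (natural_filt (space M) X \<infinity>))"

definition stopping_times ::
    "'a measure \<Rightarrow> ('a \<Rightarrow> real) \<Rightarrow> (real \<Rightarrow> 'a \<Rightarrow> ereal) \<Rightarrow> ('a \<Rightarrow> ennreal) set" where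
  "stopping_times M U X = {\<tau>. stopping_time (randomized_filt (space M) U X) \<tau>}"

text \<open>\<open>\<xi>\<^sub>p \<tau>\<^sub>1 + (1 - \<xi>\<^sub>p) \<tau>\<^sub>2\<close> with \<open>\<xi>\<^sub>p\<close> the indicator of \<open>U < p\<close>.\<close>

definition mix_times ::
    "('a \<Rightarrow> real) \<Rightarrow> real \<Rightarrow> ('a \<Rightarrow> ennreal) \<Rightarrow> ('a \<Rightarrow> ennreal) \<Rightarrow> 'a \<Rightarrow> ennreal" where
  "mix_times U p \<tau>1 \<tau>2 \<omega> = (if U \<omega> < p then \<tau>1 \<omega> else \<tau>2 \<omega>)"

definition mean_at :: "'a measure \<Rightarrow> (real \<Rightarrow> 'a \<Rightarrow> ereal) \<Rightarrow> ('a \<Rightarrow> ennreal) \<Rightarrow> real" where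
  "mean_at N X \<tau> = (\<integral>\<omega>. real_of_ereal (stopped_at X \<tau> \<omega>) \<partial>N)"

text \<open>The variance is \<open>\<infinity>\<close> whenever the stopped value is not square integrable: the integral
  below is infinite for any real centring constant, in particular for the default value \<open>0\<close> of a
  mean that does not exist.\<close>

definition variance_at :: "'a measure \<Rightarrow> (real \<Rightarrow> 'a \<Rightarrow> ereal) \<Rightarrow> ('a \<Rightarrow> ennreal) \<Rightarrow> ennreal" where
  "variance_at N X \<tau> = (\<integral>\<^sup>+\<omega>. e2ennreal ((stopped_at X \<tau> \<omega> - ereal (mean_at N X \<tau>))\<^sup>2) \<partial>N)"

definition variance_value ::
    "'a measure \<Rightarrow> (real \<Rightarrow> 'a measure) \<Rightarrow> (real \<Rightarrow> 'a \<Rightarrow> ereal) \<Rightarrow> ('a \<Rightarrow> real) \<Rightarrow> real \<Rightarrow> ennreal" where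
  "variance_value M P X U x = (SUP \<tau>\<in>stopping_times M U X. variance_at (P x) X \<tau>)"

definition optimal_time ::
    "'a measure \<Rightarrow> (real \<Rightarrow> 'a measure) \<Rightarrow> (real \<Rightarrow> 'a \<Rightarrow> ereal) \<Rightarrow> ('a \<Rightarrow> real) \<Rightarrow> real
      \<Rightarrow> ('a \<Rightarrow> ennreal) \<Rightarrow> bool" where
  "optimal_time M P X U x \<tau> \<longleftrightarrow>
     \<tau> \<in> stopping_times M U X \<and> variance_value M P X U x = variance_at (P x) X \<tau>"

text \<open>\<open>S\<beta>\<close> stands for the boundary value \<open>S(\<beta>)\<close>.\<close>

definition maximizers ::
    "ereal \<Rightarrow> real \<Rightarrow> (real \<Rightarrow> real) \<Rightarrow> real \<Rightarrow> real \<Rightarrow> real set" where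
  "maximizers \<alpha> \<beta> S S\<beta> c =
     {y. is_arg_max (\<lambda>y. (y\<^sup>2 - \<beta>\<^sup>2 - 2 * c * (y - \<beta>)) / (S\<beta> - S y)) (\<lambda>y. y \<in> einterval \<alpha> \<beta>) y}"

end

theory Submission
  imports Defs
begin

text \<open>Let \<open>h = S(\<beta>) - S\<close>. From \<open>y\<close> the diffusion falls to \<open>a < y\<close> with probability \<open>h(y) / h(a)\<close>, and
  a path falling to \<open>a\<close> after a stopping time \<open>\<tau>\<close> falls to \<open>a\<close>; by the Markov property and
  \<open>a \<rightarrow> \<alpha>\<close> this gives \<open>E h(X\<^sub>\<tau>) \<le> h(x)\<close>. If \<open>B\<close> is the maximum over \<open>y\<close> of
  \<open>((y - c)\<^sup>2 - (\<beta> - c)\<^sup>2) / h(y)\<close>, then \<open>Var X\<^sub>\<tau> \<le> E (X\<^sub>\<tau> - c)\<^sup>2 \<le> (\<beta> - c)\<^sup>2 + B h(x)\<close> for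
  every \<open>c\<close>. Equality holds if \<open>X\<^sub>\<tau>\<close> lives on maximizers and \<open>\<beta>\<close>, with \<open>E h(X\<^sub>\<tau>) = h(x)\<close> and
  mean \<open>c\<close>. For a suitable \<open>c\<close> there are maximizers \<open>y\<^sub>1\<close>, \<open>y\<^sub>2\<close> such that waiting for \<open>y\<^sub>1\<close> or \<open>\<beta>\<close>
  (for \<open>y\<^sub>2\<close> or \<open>y\<^sub>1\<close>, if \<open>x < y\<^sub>1\<close>) has mean at most \<open>c\<close>, and waiting for \<open>y\<^sub>2\<close> or \<open>\<beta>\<close> mean at
  least \<open>c\<close>; a mixture has mean \<open>c\<close>. In case (C) the maximizer is unique because the critical
  point equation has a strictly increasing and a non-increasing side.\<close>

section \<open>The dual problem in one real variable\<close>

text \<open>The variance is not linear in the law of the stopped value, but it is the minimum over c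
  of the second moment about c, which is. So the problem is a minimax: B is the multiplier of the
  constraint \<open>E h(X_\<tau>) \<le> h(x)\<close>, and c must be a saddle value. Maximizers may
  jump as c varies, so no continuous selection is at hand; connectedness replaces it, and
  randomization bridges the jump. The right c is found without probability: waiting for y or \<beta>
  from x has mean \<open>\<beta> - (\<beta> - y) * h x / h y\<close>, so comparing this mean with c
  is comparing \<open>(\<beta> - y) / h y\<close> with \<open>(\<beta> - c) / h x\<close>. As a is
  hit from x with probability \<open>h x / h a\<close>, the decay hypothesis says that
  \<open>a^2 / h a\<close> tends to 0, which makes the maxima exist although the interval is open.
  The constraint is proved without martingale theory, from hitting probabilities and the Markov
  property. Since h is unbounded, the functions \<open>min 1 (h y / h a)\<close>, which are
  probabilities of falling, come first; Fatou's lemma supplies both limits, along time grids and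
  then as a tends to \<alpha>.\<close>

locale decaying_scale =
  fixes \<alpha> :: ereal and \<beta> :: real and h :: "real \<Rightarrow> real"
  assumes h_pos: "y \<in> einterval \<alpha> \<beta> \<Longrightarrow> 0 < h y"
    and h_cont: "continuous_on (einterval \<alpha> \<beta>) h"
    and h_decay: "0 < e \<Longrightarrow> \<exists>a\<in>einterval \<alpha> \<beta>. \<forall>y\<in>einterval \<alpha> \<beta>. y \<le> a \<longrightarrow> 1 + y\<^sup>2 \<le> e * h y"
begin

text \<open>The numerator is \<open>(y - c)^2 - (\<beta> - c)^2\<close> with \<open>c^2\<close>
  cancelled, in the shape used by \<open>maximizers\<close>.\<close>

definition ratio :: "real \<Rightarrow> real \<Rightarrow> real" where
  "ratio c y = (y\<^sup>2 - \<beta>\<^sup>2 - 2 * c * (y - \<beta>)) / h y"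

lemma ratio_factored: "ratio c y = (\<beta> - y) * (2 * c - \<beta> - y) / h y"
  unfolding ratio_def by (simp add: power2_eq_square algebra_simps)

lemma less_beta: "y \<in> einterval \<alpha> \<beta> \<Longrightarrow> y < \<beta>"
  by (simp add: einterval_iff)

lemma interval_downward: "a \<in> einterval \<alpha> \<beta> \<Longrightarrow> a \<le> y \<Longrightarrow> y < \<beta> \<Longrightarrow> y \<in> einterval \<alpha> \<beta>"
  by (simp add: einterval_iff order_less_le_trans[of \<alpha> "ereal a"])

text \<open>The point \<open>2 * c - \<beta>\<close> is the reflection of \<beta> in c: the ratio is
  positive exactly at points farther from c than \<beta>.\<close>

lemma ratio_pos_iff: "y \<in> einterval \<alpha> \<beta> \<Longrightarrow> 0 < ratio c y \<longleftrightarrow> y < 2 * c - \<beta>"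
  using h_pos[of y] less_beta[of y]
  by (auto simp: ratio_factored zero_less_divide_iff zero_less_mult_iff)

lemma ratio_mono:
  assumes "y \<in> einterval \<alpha> \<beta>" "c \<le> c'" shows "ratio c y \<le> ratio c' y"
  unfolding ratio_factored using h_pos[of y] less_beta[of y] assms
  by (intro divide_right_mono mult_left_mono) auto

text \<open>Uniformity over bounded c is what allows compactness to be used jointly in c and y. The
  numerator is O(1 + y^2), while \<open>1 + y^2\<close> is negligible against h at the left
  end.\<close>

lemma ratio_level_bounded_below:
  assumes "0 < \<delta>"
  shows "\<exists>a\<in>einterval \<alpha> \<beta>. \<forall>c y. \<bar>c\<bar> \<le> C \<longrightarrow> y \<in> einterval \<alpha> \<beta> \<longrightarrow> \<delta> \<le> ratio c y \<longrightarrow> a \<le> y"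
proof -
  \<comment> \<open>The terms bound the contributions of \<open>y^2\<close>, of
    \<open>- 2 * c * y\<close> (via \<open>2 * \<bar>y\<bar> \<le> 1 + y^2\<close>) and of
    \<open>2 * c * \<beta>\<close> by multiples of \<open>1 + y^2\<close>. The 2 in
    \<open>\<delta> / (2 * K)\<close> then leaves a ratio of at most
    \<open>\<delta> / 2\<close>.\<close>
  define K where "K = 1 + \<bar>C\<bar> + 2 * \<bar>C\<bar> * \<bar>\<beta>\<bar>"
  have K: "0 < K" unfolding K_def by (intro add_pos_nonneg) auto
  obtain a where a: "a \<in> einterval \<alpha> \<beta>"
      "\<And>y. y \<in> einterval \<alpha> \<beta> \<Longrightarrow> y \<le> a \<Longrightarrow> 1 + y\<^sup>2 \<le> \<delta> / (2 * K) * h y"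
    using h_decay[of "\<delta> / (2 * K)"] assms K by auto
  have "a \<le> y" if "\<bar>c\<bar> \<le> C" "y \<in> einterval \<alpha> \<beta>" "\<delta> \<le> ratio c y" for c y
  proof (rule ccontr)
    assume "\<not> a \<le> y"
    then have b: "1 + y\<^sup>2 \<le> \<delta> / (2 * K) * h y" using a that by auto
    have y1: "2 * \<bar>y\<bar> \<le> 1 + y\<^sup>2"
      using zero_le_power2[of "\<bar>y\<bar> - 1"] by (simp add: power2_diff)
    have "- 2 * c * y \<le> \<bar>C\<bar> * (2 * \<bar>y\<bar>)"
    proof -
      have "- 2 * c * y \<le> \<bar>c\<bar> * (2 * \<bar>y\<bar>)"
        using abs_ge_minus_self[of "c*y"] by (simp add: abs_mult)
      also have "\<dots> \<le> \<bar>C\<bar> * (2 * \<bar>y\<bar>)" using that by (intro mult_right_mono) auto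
      finally show ?thesis .
    qed
    also have "\<dots> \<le> \<bar>C\<bar> * (1 + y\<^sup>2)" by (intro mult_left_mono y1) auto
    finally have p1: "- 2 * c * y \<le> \<bar>C\<bar> * (1 + y\<^sup>2)" .
    have "2 * c * \<beta> \<le> 2 * \<bar>C\<bar> * \<bar>\<beta>\<bar>"
    proof -
      have "c * \<beta> \<le> \<bar>c\<bar> * \<bar>\<beta>\<bar>" using abs_ge_self[of "c*\<beta>"] by (simp add: abs_mult)
      also have "\<dots> \<le> \<bar>C\<bar> * \<bar>\<beta>\<bar>" using that by (intro mult_right_mono) auto
      finally show ?thesis by simp
    qed
    also have "\<dots> \<le> 2 * \<bar>C\<bar> * \<bar>\<beta>\<bar> * (1 + y\<^sup>2)"
      using mult_left_mono[of 1 "1 + y\<^sup>2" "2 * \<bar>C\<bar> * \<bar>\<beta>\<bar>"] by simp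
    finally have p2: "2 * c * \<beta> \<le> 2 * \<bar>C\<bar> * \<bar>\<beta>\<bar> * (1 + y\<^sup>2)" .
    have "y\<^sup>2 - \<beta>\<^sup>2 - 2 * c * (y - \<beta>) \<le> K * (1 + y\<^sup>2)"
    proof -
      have "K * (1 + y\<^sup>2) = (1 + y\<^sup>2) + \<bar>C\<bar> * (1 + y\<^sup>2) + 2 * \<bar>C\<bar> * \<bar>\<beta>\<bar> * (1 + y\<^sup>2)"
        unfolding K_def by (simp add: algebra_simps)
      moreover have "2 * c * (y - \<beta>) = 2 * c * y - 2 * c * \<beta>" by (simp add: algebra_simps)
      ultimately show ?thesis using p1 p2 zero_le_power2[of \<beta>] by linarith
    qed
    also have "\<dots> \<le> K * (\<delta> / (2 * K) * h y)" using b K by (intro mult_left_mono) auto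
    also have "\<dots> = \<delta> / 2 * h y" using K by simp
    also have "\<dots> < \<delta> * h y" using assms h_pos[OF that(2)] by simp
    finally have "ratio c y < \<delta>" unfolding ratio_def
      using h_pos[OF that(2)] by (simp add: divide_less_eq)
    then show False using that by simp
  qed
  then show ?thesis using a(1) by blast
qed

text \<open>The values of \<open>c\<close> having a maximizer \<open>y\<close> with \<open>(\<beta> - y) / h y\<close> above, respectively
  below, \<open>(\<beta> - c) / h x\<close> form two closed sets covering an interval; they meet by connectedness.\<close>

lemma saddle_point:
  assumes x: "x \<in> einterval \<alpha> \<beta>"
  obtains c y1 y2 where "c < \<beta>" "y1 \<in> einterval \<alpha> \<beta>" "y2 \<in> einterval \<alpha> \<beta>"
    "0 < ratio c y1" "\<And>z. z \<in> einterval \<alpha> \<beta> \<Longrightarrow> ratio c z \<le> ratio c y1" "ratio c y2 = ratio c y1"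
    "(\<beta> - c) / h x \<le> (\<beta> - y1) / h y1" "(\<beta> - y2) / h y2 \<le> (\<beta> - c) / h x"
proof -
  define I where "I = einterval \<alpha> \<beta>"
  have xb: "x < \<beta>" and hx: "0 < h x" using x less_beta h_pos by auto
  define K where "K = 1 + \<bar>\<beta>\<bar>"
  have K: "0 < K" by (simp add: K_def)
  \<comment> \<open>Since \<open>\<beta> - y \<le> K * (1 + y^2)\<close>, below a0 the quotient
    \<open>(\<beta> - y) / h y\<close> is at most half of
    \<open>(\<beta> - x) / h x\<close>.\<close>
  obtain a0 where a0: "a0 \<in> I" "\<And>y. y \<in> I \<Longrightarrow> y \<le> a0 \<Longrightarrow> 1 + y\<^sup>2 \<le> (\<beta> - x) / (2 * K * h x) * h y"
    using h_decay[of "(\<beta> - x) / (2 * K * h x)"] xb hx K unfolding I_def by auto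
  define a1 where "a1 = min a0 x"
  have a1: "a1 \<in> I" "a1 \<le> x" "a1 < \<beta>" using a0 x xb unfolding I_def a1_def by (auto simp: min_def)
  \<comment> \<open>Chosen so that \<open>2 * cl - \<beta> = a1\<close>: at cl all maximizers lie
    below a1, hence below a0, while \<open>\<beta> - cl\<close> is at least
    \<open>(\<beta> - x) / 2\<close>. This puts cl into the second closed set.\<close>
  define cl where "cl = (a1 + \<beta>) / 2"
  have clb: "cl < \<beta>" using a1 by (simp add: cl_def)
  obtain y0 where y0: "y0 \<in> I" "y0 < a1"
  proof -
    have "\<alpha> < ereal a1" using a1 by (simp add: I_def einterval_iff)
    then obtain y where "\<alpha> < ereal y" "y < a1" using ereal_dense2[of \<alpha> "ereal a1"] by auto
    then show ?thesis using that[of y] a1 by (auto simp: I_def einterval_iff)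
  qed
  \<comment> \<open>The ratio grows with c, so this value at \<open>cl\<close> bounds the maximum
    from below for every larger c.\<close>
  define \<delta> where "\<delta> = ratio cl y0"
  have \<delta>: "0 < \<delta>" unfolding \<delta>_def using y0 by (subst ratio_pos_iff) (auto simp: I_def cl_def field_simps)
  obtain a where a: "a \<in> I" "\<And>c y. \<bar>c\<bar> \<le> \<bar>cl\<bar> + \<bar>\<beta>\<bar> \<Longrightarrow> y \<in> I \<Longrightarrow> \<delta> \<le> ratio c y \<Longrightarrow> a \<le> y"
    using ratio_level_bounded_below[OF \<delta>, of "\<bar>cl\<bar> + \<bar>\<beta>\<bar>"] unfolding I_def by auto
  have ab: "a < \<beta>" using a less_beta by (auto simp: I_def)
  \<comment> \<open>A maximizer y at ch has
    \<open>\<delta> * h y \<le> (\<beta> - y) * (\<beta> - a)\<close>, so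
    \<open>(\<beta> - y) / h y \<ge> \<delta> / (\<beta> - a)\<close>. The choice keeps
    \<open>(\<beta> - ch) / h x\<close> below this, which puts ch into the first closed set.\<close>
  define ch where "ch = max cl (\<beta> - h x * (\<delta> / (\<beta> - a)))"
  have ch: "cl \<le> ch" "ch < \<beta>" using clb hx \<delta> ab by (auto simp: ch_def)
  have "\<beta> - ch \<le> h x * (\<delta> / (\<beta> - a))" unfolding ch_def by simp
  then have ch2: "(\<beta> - ch) / h x \<le> \<delta> / (\<beta> - a)" using hx by (simp add: divide_le_eq mult.commute)
  \<comment> \<open>Compact and independent of c, yet it contains every point of ratio at least
    \<delta>; maximizing over Y is therefore maximizing over I.\<close>
  define Y where "Y = {a..2 * ch - \<beta>}"
  have YI: "Y \<subseteq> I" using interval_downward[of a] a ch unfolding Y_def I_def by auto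
  have abs_c: "\<bar>c\<bar> \<le> \<bar>cl\<bar> + \<bar>\<beta>\<bar>" if "c \<in> {cl..ch}" for c using that ch by auto
  have outside: "ratio c z < \<delta>" if "c \<in> {cl..ch}" "z \<in> I" "z \<notin> Y" for c z
  proof (rule ccontr)
    assume *: "\<not> ratio c z < \<delta>"
    then have "a \<le> z" using a(2)[OF abs_c[OF that(1)] that(2)] by auto
    moreover have "z < 2 * c - \<beta>" using * \<delta> ratio_pos_iff[of z c] that by (auto simp: I_def)
    ultimately show False using that by (auto simp: Y_def)
  qed
  have y0_level: "\<delta> \<le> ratio c y0" if "c \<in> {cl..ch}" for c
    unfolding \<delta>_def using that y0 by (intro ratio_mono) (auto simp: I_def)
  have y0Y: "y0 \<in> Y"
    using outside[of cl y0] y0_level[of cl] y0 ch by fastforce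
  have ratio_cont: "continuous_on ({cl..ch} \<times> Y) (\<lambda>p. ratio (fst p) (f p))"
    if "continuous_on ({cl..ch} \<times> Y) f" "f ` ({cl..ch} \<times> Y) \<subseteq> Y" for f :: "real \<times> real \<Rightarrow> real"
  proof -
    have *: "continuous_on ({cl..ch} \<times> Y) (\<lambda>p. h (f p))"
      by (rule continuous_on_compose2[OF h_cont[folded I_def] that(1)]) (use that YI in auto)
    have **: "\<forall>p\<in>{cl..ch} \<times> Y. h (f p) \<noteq> 0"
    proof
      fix p assume "p \<in> {cl..ch} \<times> Y"
      then have "f p \<in> I" using that YI by blast
      then show "h (f p) \<noteq> 0" using h_pos[of "f p"] by (simp add: I_def)
    qed
    show ?thesis unfolding ratio_def
      by (intro continuous_intros continuous_on_divide that(1) * **)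
  qed
  define G where "G = {p \<in> {cl..ch} \<times> Y. \<forall>z\<in>Y. ratio (fst p) z \<le> ratio (fst p) (snd p)}"
  define G1 where "G1 = {p \<in> {cl..ch} \<times> Y. (\<beta> - fst p) / h x \<le> (\<beta> - snd p) / h (snd p)}"
  define G2 where "G2 = {p \<in> {cl..ch} \<times> Y. (\<beta> - snd p) / h (snd p) \<le> (\<beta> - fst p) / h x}"
  have cpt: "compact ({cl..ch} \<times> Y)" unfolding Y_def by (intro compact_Times compact_Icc)
  have cl0: "closed ({cl..ch} \<times> Y)" using cpt compact_imp_closed by blast
  have "G = ({cl..ch} \<times> Y) \<inter> (\<Inter>z\<in>Y. {p \<in> {cl..ch} \<times> Y. ratio (fst p) z \<le> ratio (fst p) (snd p)})"
    unfolding G_def by auto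
  moreover have "closed {p \<in> {cl..ch} \<times> Y. ratio (fst p) z \<le> ratio (fst p) (snd p)}" if "z \<in> Y" for z
    by (intro continuous_on_closed_Collect_le ratio_cont cl0) (use that in \<open>auto intro!: continuous_intros\<close>)
  ultimately have Gc: "closed G" using cl0 by auto
  have hc: "continuous_on ({cl..ch} \<times> Y) (\<lambda>p. h (snd p))"
    by (rule continuous_on_compose2[OF h_cont[folded I_def]]) (use YI in \<open>auto intro!: continuous_intros\<close>)
  have hn: "\<forall>p\<in>{cl..ch} \<times> Y. h (snd p) \<noteq> 0" using h_pos YI unfolding I_def by fastforce
  have G1c: "closed G1" and G2c: "closed G2" unfolding G1_def G2_def using hc hn cl0 hx
    by (auto intro!: continuous_on_closed_Collect_le continuous_intros)
  \<comment> \<open>G is the closed graph of the set of maximizers in a compact rectangle, so its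
    closed subsets are compact and have closed projections to the c-axis.\<close>
  have cc: "closed (fst ` (G \<inter> G'))" if "closed G'" for G'
  proof -
    have "compact (G \<inter> G')"
    proof -
      have "G \<inter> G' \<inter> ({cl..ch} \<times> Y) = G \<inter> G'" by (auto simp: G_def)
      then show ?thesis using closed_Int_compact[OF closed_Int[OF Gc that] cpt] by simp
    qed
    then show ?thesis by (intro compact_imp_closed compact_continuous_image continuous_intros)
  qed
  have max_ex: "\<exists>y. (c, y) \<in> G" if "c \<in> {cl..ch}" for c
  proof -
    have "continuous_on Y (\<lambda>z. ratio c z)"
      by (rule continuous_on_compose2[OF ratio_cont[of snd], of Y "\<lambda>z. (c, z)", simplified])
        (use that in \<open>auto intro!: continuous_intros\<close>)
    moreover have "compact Y" "Y \<noteq> {}" using y0Y by (auto simp: Y_def)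
    ultimately obtain y where "y \<in> Y" "\<forall>z\<in>Y. ratio c z \<le> ratio c y"
      using continuous_attains_sup[of Y "ratio c"] by auto
    then show ?thesis using that unfolding G_def by auto
  qed
  have max_level: "\<delta> \<le> ratio c y" if "(c, y) \<in> G" for c y
    using that y0_level[of c] y0Y unfolding G_def by force
  have max_I: "ratio c z \<le> ratio c y" if "(c, y) \<in> G" "z \<in> I" for c y z
    using that outside[of c z] max_level[OF that(1)] unfolding G_def by (cases "z \<in> Y") force+
  have split: "{cl..ch} \<subseteq> fst ` (G \<inter> G1) \<union> fst ` (G \<inter> G2)"
  proof
    fix c assume c: "c \<in> {cl..ch}"
    then obtain y where y: "(c, y) \<in> G" using max_ex by auto
    then have "(c, y) \<in> G1 \<or> (c, y) \<in> G2" unfolding G_def G1_def G2_def by auto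
    then show "c \<in> fst ` (G \<inter> G1) \<union> fst ` (G \<inter> G2)" using y by force
  qed
  have ne1: "ch \<in> fst ` (G \<inter> G1)"
  proof -
    obtain y where y: "(ch, y) \<in> G" using max_ex[of ch] ch by auto
    then have yY: "y \<in> Y" "y \<in> I" "a \<le> y" using YI by (auto simp: G_def Y_def)
    have hy: "0 < h y" using yY h_pos by (simp add: I_def)
    have yb: "y < \<beta>" using yY less_beta by (simp add: I_def)
    have "\<delta> * h y \<le> (\<beta> - y) * (2 * ch - \<beta> - y)"
      using max_level[OF y] hy by (simp add: ratio_factored le_divide_eq)
    also have "\<dots> \<le> (\<beta> - y) * (\<beta> - a)" using yY ch yb by (intro mult_left_mono) auto
    finally have "\<delta> / (\<beta> - a) \<le> (\<beta> - y) / h y" using hy ab by (simp add: field_simps)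
    then have "(ch, y) \<in> G1" using ch2 ch yY by (auto simp: G1_def)
    then show ?thesis using y by force
  qed
  have ne2: "cl \<in> fst ` (G \<inter> G2)"
  proof -
    obtain y where y: "(cl, y) \<in> G" using max_ex[of cl] ch by auto
    then have yI: "y \<in> I" "y \<in> Y" using YI by (auto simp: G_def)
    have hy: "0 < h y" using yI h_pos by (simp add: I_def)
    have "0 < ratio cl y" using max_level[OF y] \<delta> by simp
    then have ya: "y < a1" using ratio_pos_iff[of y cl] yI by (simp add: I_def cl_def field_simps)
    have "\<beta> - y \<le> K * (1 + y\<^sup>2)"
    proof -
      have "\<bar>y\<bar> \<le> 1 + y\<^sup>2" using zero_le_power2[of "\<bar>y\<bar> - 1"] by (simp add: power2_diff)
      moreover have "\<bar>\<beta>\<bar> \<le> \<bar>\<beta>\<bar> * (1 + y\<^sup>2)" using mult_left_mono[of 1 "1 + y\<^sup>2" "\<bar>\<beta>\<bar>"] by simp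
      moreover have "K * (1 + y\<^sup>2) = (1 + y\<^sup>2) + \<bar>\<beta>\<bar> * (1 + y\<^sup>2)" by (simp add: K_def algebra_simps)
      ultimately show ?thesis by linarith
    qed
    also have "\<dots> \<le> K * ((\<beta> - x) / (2 * K * h x) * h y)"
      using a0(2)[OF yI(1)] ya K by (intro mult_left_mono) (auto simp: a1_def)
    also have "\<dots> = K * (((\<beta> - x) / (2 * h x)) / K * h y)" by (simp add: ac_simps)
    also have "\<dots> = (\<beta> - x) / (2 * h x) * h y" using K by simp
    finally have "(\<beta> - y) / h y \<le> (\<beta> - x) / (2 * h x)" using hy by (simp add: divide_le_eq)
    also have "\<dots> = (\<beta> - x) / 2 / h x" by simp
    also have "\<dots> \<le> (\<beta> - cl) / h x" using hx a1 by (intro divide_right_mono) (auto simp: cl_def field_simps)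
    finally have "(cl, y) \<in> G2" using yI ch by (auto simp: G2_def)
    then show ?thesis using y by force
  qed
  have "fst ` (G \<inter> G1) \<inter> fst ` (G \<inter> G2) \<inter> {cl..ch} \<noteq> {}"
  proof (rule ccontr)
    assume *: "\<not> ?thesis"
    show False
      using connected_closedD[OF connected_Icc[of cl ch] _ split cc[OF G1c] cc[OF G2c]] * ne1 ne2 ch by auto
  qed
  then obtain c where "c \<in> fst ` (G \<inter> G1)" "c \<in> fst ` (G \<inter> G2)" and c: "c \<in> {cl..ch}" by blast
  then obtain y1 y2 where y: "(c, y1) \<in> G" "(c, y1) \<in> G1" "(c, y2) \<in> G" "(c, y2) \<in> G2" by auto
  have yI: "y1 \<in> I" "y2 \<in> I" using y YI by (auto simp: G_def)
  show ?thesis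
  proof (rule that[of c y1 y2])
    show "c < \<beta>" using c ch by auto
    show "0 < ratio c y1" using max_level[OF y(1)] \<delta> by simp
    show "ratio c y2 = ratio c y1" using max_I[OF y(1) yI(2)] max_I[OF y(3) yI(1)] by simp
  qed (use y yI max_I[OF y(1)] in \<open>auto simp: I_def G1_def G2_def\<close>)
qed

text \<open>A positive level confines the maximizers to the compact interval
  \<open>{a..2 * c - \<beta>}\<close>, where they form a closed set.\<close>

lemma max_set_extrema:
  assumes "c < \<beta>" "y1 \<in> einterval \<alpha> \<beta>" "0 < ratio c y1"
    "\<And>z. z \<in> einterval \<alpha> \<beta> \<Longrightarrow> ratio c z \<le> ratio c y1"
  defines "Y \<equiv> {y \<in> einterval \<alpha> \<beta>. ratio c y = ratio c y1}"
  shows "Inf Y \<in> Y" "Sup Y \<in> Y" "\<And>y. y \<in> Y \<Longrightarrow> Inf Y \<le> y \<and> y \<le> Sup Y"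
proof -
  obtain a where a: "a \<in> einterval \<alpha> \<beta>" "\<And>y. y \<in> einterval \<alpha> \<beta> \<Longrightarrow> ratio c y1 \<le> ratio c y \<Longrightarrow> a \<le> y"
    using ratio_level_bounded_below[OF assms(3), of "\<bar>c\<bar>"] by auto
  have sub: "{a..2 * c - \<beta>} \<subseteq> einterval \<alpha> \<beta>"
    using interval_downward[of a] a(1) assms(1) by auto
  have ub: "y \<le> 2 * c - \<beta>" if "y \<in> Y" for y
    using ratio_pos_iff[of y c] that assms(3) by (auto simp: Y_def)
  have Y: "Y = {y \<in> {a..2 * c - \<beta>}. ratio c y = ratio c y1}"
    using ub sub a(2) by (auto simp: Y_def)
  have "continuous_on {a..2 * c - \<beta>} (ratio c)"
    unfolding ratio_def using continuous_on_subset[OF h_cont sub] h_pos sub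
    by (intro continuous_intros) force+
  then have cY: "closed Y" unfolding Y by (intro continuous_closed_preimage_constant) auto
  have ne: "Y \<noteq> {}" using assms(2) by (auto simp: Y_def)
  have bd: "bdd_below Y" "bdd_above Y" unfolding Y by (auto simp: bdd_below_def bdd_above_def)
  show "Inf Y \<in> Y" using closed_contains_Inf[OF ne bd(1) cY] .
  show "Sup Y \<in> Y" using closed_contains_Sup[OF ne bd(2) cY] .
  show "\<And>y. y \<in> Y \<Longrightarrow> Inf Y \<le> y \<and> y \<le> Sup Y" using cInf_lower cSup_upper bd by blast
qed

end

section \<open>Entry times of continuous paths\<close>

text \<open>Hitting times and exit times from open intervals are both entry times into closed sets,
  so each path lemma is proved only once.\<close>

definition entry_time :: "ereal set \<Rightarrow> (real \<Rightarrow> ereal) \<Rightarrow> ennreal" where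
  "entry_time C w = (INF t\<in>{t. 0 \<le> t \<and> w t \<in> C}. ennreal t)"

lemma hit_time_eq: "hit_time X z \<omega> = entry_time {ereal z} (\<lambda>t. X t \<omega>)"
  by (simp add: hit_time_def entry_time_def)

lemma interior_exit_time_eq:
  "interior_exit_time X z y \<omega> = entry_time (- {ereal z<..<y}) (\<lambda>t. X t \<omega>)"
  by (simp add: interior_exit_time_def entry_time_def)

lemma closed_Compl_greaterThanLessThan: "closed (- {l<..<u :: ereal})"
  by (simp add: closed_Compl)

lemma entry_time_empty: "(\<And>t. 0 \<le> t \<Longrightarrow> w t \<notin> C) \<Longrightarrow> entry_time C w = \<infinity>"
proof -
  assume "\<And>t. 0 \<le> t \<Longrightarrow> w t \<notin> C"
  then have "{t. 0 \<le> t \<and> w t \<in> C} = {}" by auto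
  then show ?thesis unfolding entry_time_def by simp
qed

lemma entry_time_attained:
  assumes w: "continuous_on {0..} w" and C: "closed C" and t0: "0 \<le> t0" "w t0 \<in> C"
  obtains T where "0 \<le> T" "T \<le> t0" "w T \<in> C" "entry_time C w = ennreal T"
    "\<And>s. 0 \<le> s \<Longrightarrow> s < T \<Longrightarrow> w s \<notin> C"
proof -
  define D where "D = {t. 0 \<le> t \<and> w t \<in> C}"
  have "D = {0..} \<inter> w -` C" by (auto simp: D_def)
  then have "closed D" using continuous_closed_preimage[OF w _ C] by simp
  moreover have ne: "D \<noteq> {}" and bd: "bdd_below D" using t0 by (auto simp: D_def bdd_below_def)
  ultimately have "Inf D \<in> D" by (intro closed_contains_Inf)
  moreover have low: "Inf D \<le> s" if "s \<in> D" for s using cInf_lower[OF that bd] .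
  moreover have "entry_time C w = ennreal (Inf D)"
    unfolding entry_time_def D_def[symmetric] using \<open>Inf D \<in> D\<close> low
    by (intro antisym INF_lower INF_greatest ennreal_leI) auto
  ultimately show ?thesis using t0 by (intro that[of "Inf D"]) (force simp: D_def)+
qed

text \<open>The infimum is attained because the path is continuous and C is closed. The event thus
  depends on the path up to t only, which yields stopping times of a filtration that is neither
  completed nor made right-continuous.\<close>

lemma entry_time_le_iff:
  assumes w: "continuous_on {0..} w" and C: "closed C" and t: "0 \<le> t"
  shows "entry_time C w \<le> ennreal t \<longleftrightarrow> (\<exists>s\<in>{0..t}. w s \<in> C)"
proof
  assume *: "entry_time C w \<le> ennreal t"
  have "\<exists>t0\<ge>0. w t0 \<in> C"
  proof (rule ccontr)
    assume "\<not> ?thesis"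
    then have "entry_time C w = \<infinity>" by (intro entry_time_empty) auto
    then show False using * by (simp add: top_unique)
  qed
  then obtain T where "0 \<le> T" "w T \<in> C" "entry_time C w = ennreal T"
    using entry_time_attained[OF w C] by metis
  then show "\<exists>s\<in>{0..t}. w s \<in> C" using * t by auto
next
  assume "\<exists>s\<in>{0..t}. w s \<in> C"
  then obtain s where "s \<in> {0..t}" "w s \<in> C" by auto
  then show "entry_time C w \<le> ennreal t" unfolding entry_time_def
    by (intro INF_lower2[of s] ennreal_leI) auto
qed

lemma entry_time_finite_iff:
  assumes w: "continuous_on {0..} w" and C: "closed C"
  shows "entry_time C w < \<infinity> \<longleftrightarrow> (\<exists>s\<ge>0. w s \<in> C)"
proof
  assume "entry_time C w < \<infinity>"
  then show "\<exists>s\<ge>0. w s \<in> C" using entry_time_empty[of w C] by (metis less_irrefl)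
next
  assume "\<exists>s\<ge>0. w s \<in> C"
  then obtain T where "entry_time C w = ennreal T"
    using entry_time_attained[OF w C] by metis
  then show "entry_time C w < \<infinity>" by simp
qed

lemma entry_time_mono: "C \<subseteq> D \<Longrightarrow> entry_time D w \<le> entry_time C w"
  unfolding entry_time_def by (intro INF_superset_mono) auto

section \<open>Path events described by countably many times\<close>

lemma continuous_in_closed_of_rationals:
  fixes w :: "real \<Rightarrow> ereal"
  assumes w: "continuous_on {0..} w" and C: "closed C" and ab: "0 \<le> a" "a < b"
    and q: "\<And>q. q \<in> \<rat> \<Longrightarrow> a < q \<Longrightarrow> q < b \<Longrightarrow> w q \<in> C" and s: "a \<le> s" "s \<le> b"
  shows "w s \<in> C"
proof (rule ccontr)
  assume "w s \<notin> C"
  have "openin (top_of_set {0..}) ({0..} \<inter> w -` (- C))"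
    by (rule continuous_openin_preimage_gen[OF w open_Compl[OF C]])
  then obtain V where V: "open V" "{0..} \<inter> w -` (- C) = {0..} \<inter> V"
    unfolding openin_open by metis
  moreover have "s \<in> {0..} \<inter> w -` (- C)" using \<open>w s \<notin> C\<close> s ab by simp
  ultimately have "s \<in> V" by blast
  then obtain e where e: "0 < e" "\<And>u. dist u s < e \<Longrightarrow> u \<in> V"
    using V(1) unfolding open_dist by blast
  have "max a (s - e) < min b (s + e)" using e(1) ab s by auto
  then obtain q' where q': "q' \<in> \<rat>" "max a (s - e) < q'" "q' < min b (s + e)"
    using Rats_dense_in_real by blast
  then have "dist q' s < e" "0 \<le> q'" using ab by (simp_all add: dist_real_def abs_less_iff)
  then have "q' \<in> {0..} \<inter> V" using e(2) by blast
  then have "w q' \<in> - C" using V(2) by blast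
  moreover have "w q' \<in> C" using q' by (intro q) auto
  ultimately show False by simp
qed

text \<open>The path attains its minimum on \<open>{0..t}\<close>, so a rational r fits between z
  and that minimum. The strict inequality becomes a weak one with a uniform r, which rational times
  can test.\<close>

lemma all_greater_iff_rational:
  fixes w :: "real \<Rightarrow> ereal"
  assumes w: "continuous_on {0..} w" and t: "0 \<le> t"
  shows "(\<forall>s\<in>{0..t}. z < w s) \<longleftrightarrow>
    (\<exists>r\<in>{r\<in>\<rat>. z < ereal r}. \<forall>q\<in>{0..t} \<inter> \<rat>. ereal r \<le> w q)"
    (is "?L \<longleftrightarrow> ?R")
proof
  assume L: ?L
  have "continuous_on {0..t} w" using w by (rule continuous_on_subset) auto
  then obtain s0 where s0: "s0 \<in> {0..t}" "\<forall>s\<in>{0..t}. w s0 \<le> w s"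
    using continuous_attains_inf[of "{0..t}" w] t by auto
  then obtain r where "z < ereal (real_of_rat r)" "ereal (real_of_rat r) < w s0"
    using ereal_dense3[of z "w s0"] L by auto
  then show ?R using s0 t by (intro bexI[of _ "real_of_rat r"]) (auto intro: order.trans less_imp_le)
next
  assume ?R
  then obtain r where r: "z < ereal r" "\<forall>q\<in>{0..t} \<inter> \<rat>. ereal r \<le> w q" by auto
  have "ereal r \<le> w s" if "s \<in> {0..t}" for s
  proof (cases "t = 0")
    case True
    then show ?thesis using r that by auto
  next
    case False
    have "w s \<in> {ereal r..}"
      by (rule continuous_in_closed_of_rationals[OF w, of _ 0 t]) (use False t r that in auto)
    then show ?thesis by simp
  qed
  then show ?L using r by (metis less_le_trans)
qed

text \<open>Only coordinates up to t have to be measurable, so N may be the member of a filtration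
  at time t.\<close>

lemma pred_path_above:
  fixes X :: "real \<Rightarrow> 'a \<Rightarrow> ereal"
  assumes X: "\<And>s. 0 \<le> s \<Longrightarrow> s \<le> t \<Longrightarrow> X s \<in> borel_measurable N"
    and cont: "\<And>\<omega>. \<omega> \<in> space N \<Longrightarrow> continuous_on {0..} (\<lambda>t. X t \<omega>)" and t: "0 \<le> t"
  shows "Measurable.pred N (\<lambda>\<omega>. \<forall>s\<in>{0..t}. z < X s \<omega>)"
proof -
  have [measurable]: "Measurable.pred N (\<lambda>\<omega>. ereal r \<le> X s \<omega>)" if "s \<in> {0..t}" for r s
    using X[of s] that by simp
  have "Measurable.pred N (\<lambda>\<omega>. \<exists>r\<in>{r\<in>\<rat>. z < ereal r}. \<forall>q\<in>{0..t} \<inter> \<rat>.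
      ereal r \<le> X q \<omega>)"
    using t by (intro measurable_pred_countable pred_intros_logic countable_Collect countable_rat countable_Int2)
      (auto intro!: X)
  then show ?thesis
    by (rule measurable_cong[THEN iffD2, rotated]) (rule all_greater_iff_rational[OF cont t])
qed

lemma pred_path_below:
  fixes X :: "real \<Rightarrow> 'a \<Rightarrow> ereal"
  assumes X: "\<And>s. 0 \<le> s \<Longrightarrow> s \<le> t \<Longrightarrow> X s \<in> borel_measurable N"
    and cont: "\<And>\<omega>. \<omega> \<in> space N \<Longrightarrow> continuous_on {0..} (\<lambda>t. X t \<omega>)" and t: "0 \<le> t"
  shows "Measurable.pred N (\<lambda>\<omega>. \<forall>s\<in>{0..t}. X s \<omega> < z)"
proof -
  have "Measurable.pred N (\<lambda>\<omega>. \<forall>s\<in>{0..t}. - z < - X s \<omega>)"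
    using X by (intro pred_path_above t continuous_on_compose2[OF continuous_uminus_ereal[of UNIV] cont]) auto
  then show ?thesis by simp
qed

lemma path_between_attained:
  fixes w :: "real \<Rightarrow> ereal"
  assumes w: "continuous_on {0..} w" and "0 \<le> s" "s \<le> t" and "z \<in> {min (w s) (w t)..max (w s) (w t)}"
  shows "\<exists>r\<in>{s..t}. w r = z"
proof -
  have "continuous_on {s..t} w" using w by (rule continuous_on_subset) (use assms in auto)
  then show ?thesis using IVT'[of w s z t] IVT2'[of w t z s] assms
    by (cases "w s \<le> w t") (auto simp: min_def max_def)
qed

lemma exit_interval_value:
  assumes w: "continuous_on {0..} w" and w0: "w 0 \<in> {a<..<b}" and T: "entry_time (- {a<..<b}) w = ennreal T" "0 \<le> T"
  shows "w T \<in> {a, b}" "\<And>s. 0 \<le> s \<Longrightarrow> s < T \<Longrightarrow> w s \<in> {a<..<b}"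
proof -
  have "entry_time (- {a<..<b}) w < \<infinity>" using T by simp
  then obtain t0 where t0: "0 \<le> t0" "w t0 \<in> - {a<..<b}"
    using entry_time_finite_iff[OF w closed_Compl_greaterThanLessThan] by auto
  obtain T' where T': "0 \<le> T'" "w T' \<in> - {a<..<b}" "entry_time (- {a<..<b}) w = ennreal T'"
      "\<And>s. 0 \<le> s \<Longrightarrow> s < T' \<Longrightarrow> w s \<notin> - {a<..<b}"
    using entry_time_attained[OF w closed_Compl_greaterThanLessThan t0] by metis
  then have TT: "T' = T" using T(1) ennreal_inj[OF T'(1) T(2)] by simp
  then show before: "\<And>s. 0 \<le> s \<Longrightarrow> s < T \<Longrightarrow> w s \<in> {a<..<b}" using T'(4) by blast
  \<comment> \<open>Overshooting is excluded: a value outside \<open>{a<..<b}\<close> between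
    \<open>w 0\<close> and \<open>w T\<close> is taken by time T, and not before T, where the path
    is still inside. This is used with c an end point.\<close>
  have "w T = c" if c: "c \<in> {min (w 0) (w T)..max (w 0) (w T)}" "c \<notin> {a<..<b}" for c
  proof -
    obtain r where r: "r \<in> {0..T}" "w r = c"
      using path_between_attained[OF w order_refl T(2) c(1)] by blast
    then have "\<not> r < T" using before[of r] c(2) by fastforce
    then show ?thesis using r by simp
  qed
  from this[of a] this[of b] have "w T \<le> a \<Longrightarrow> w T = a" "b \<le> w T \<Longrightarrow> w T = b"
    using w0 by (auto simp: min_le_iff_disj le_max_iff_disj less_imp_le)
  moreover have "w T \<le> a \<or> b \<le> w T" using T'(2) TT by auto
  ultimately show "w T \<in> {a, b}" by auto
qed

text \<open>Before T the path is strictly between the end points, so one of them is hit at T and the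
  other later or never. The comparison of hitting times is the form in which
  \<open>scale_hitting\<close> is stated.\<close>

lemma exit_interval_value_iff:
  assumes w: "continuous_on {0..} w" and w0: "w 0 \<in> {a<..<b}" and T: "entry_time (- {a<..<b}) w = ennreal T" "0 \<le> T"
  shows "w T = (if entry_time {b} w < entry_time {a} w then b else a)"
proof -
  have ab: "a < b" using w0 by auto
  have le: "entry_time {c} w \<le> ennreal T \<longleftrightarrow> (\<exists>s\<in>{0..T}. w s = c)" for c
    using entry_time_le_iff[OF w closed_singleton T(2)] by auto
  have **: "entry_time {c} w \<le> ennreal T \<longleftrightarrow> w T = c" if "c \<in> {a, b}" for c
  proof
    assume "entry_time {c} w \<le> ennreal T"
    then obtain s where s: "s \<in> {0..T}" "w s = c" using le by auto
    then show "w T = c" using exit_interval_value(2)[OF assms, of s] that by (cases "s < T") auto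
  next
    assume "w T = c"
    then show "entry_time {c} w \<le> ennreal T" using le T(2) by auto
  qed
  show ?thesis
  proof (cases "w T = b")
    case True
    then have "entry_time {b} w \<le> ennreal T" "\<not> entry_time {a} w \<le> ennreal T"
      using ** ab by auto
    then show ?thesis using True by auto
  next
    case False
    then have "w T = a" using exit_interval_value(1)[OF assms] by auto
    then have "\<not> entry_time {b} w \<le> ennreal T" "entry_time {a} w \<le> ennreal T"
      using ** ab by auto
    then show ?thesis using \<open>w T = a\<close> by auto
  qed
qed

lemma stopping_time_interior_exit:
  fixes X :: "real \<Rightarrow> 'a \<Rightarrow> ereal"
  assumes X: "\<And>s t. 0 \<le> s \<Longrightarrow> ennreal s \<le> t \<Longrightarrow> X s \<in> borel_measurable (F t)"
    and cont: "\<And>\<omega> t. \<omega> \<in> space (F t) \<Longrightarrow> continuous_on {0..} (\<lambda>t. X t \<omega>)"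
  shows "stopping_time F (interior_exit_time X z y)"
proof
  fix t :: ennreal
  show "Measurable.pred (F t) (\<lambda>\<omega>. interior_exit_time X z y \<omega> \<le> t)"
  proof (cases t)
    case (real r)
    have "Measurable.pred (F t) (\<lambda>\<omega>. \<not> ((\<forall>s\<in>{0..r}. ereal z < X s \<omega>) \<and> (\<forall>s\<in>{0..r}. X s \<omega> < y)))"
      using real X cont by (intro pred_intros_logic pred_path_above pred_path_below) (auto intro!: ennreal_leI)
    then show ?thesis
      by (rule measurable_cong[THEN iffD2, rotated])
        (use real cont entry_time_le_iff[OF _ closed_Compl_greaterThanLessThan, of _ r] in
          \<open>auto simp: interior_exit_time_eq not_less\<close>)
  qed simp
qed

lemma at_left_ereal_neq_bot: "\<not> trivial_limit (at_left (ereal \<beta>))"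
proof
  assume "trivial_limit (at_left (ereal \<beta>))"
  then have "eventually (\<lambda>_. False) (at_left (ereal \<beta>))" by simp
  then obtain b where "b < ereal \<beta>" "\<forall>y>b. \<not> y < ereal \<beta>"
    using eventually_at_left[of "-\<infinity>" "ereal \<beta>"] by auto
  then show False using dense by blast
qed

text \<open>Up to a time s before the exit, the path has a maximum below \<beta>; for b beyond this
  maximum the exit from \<open>(z,b)\<close> happens after s. This removes the limit in
  \<open>exit_time\<close>.\<close>

lemma exit_time_right_end:
  fixes X :: "real \<Rightarrow> 'a \<Rightarrow> ereal"
  assumes w: "continuous_on {0..} (\<lambda>t. X t \<omega>)"
  shows "exit_time X (ereal \<beta>) z (ereal \<beta>) \<omega> = interior_exit_time X z (ereal \<beta>) \<omega>"
proof -
  define E where "E b = entry_time (- {ereal z<..<b}) (\<lambda>t. X t \<omega>)" for b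
  have "(E \<longlongrightarrow> E (ereal \<beta>)) (at_left (ereal \<beta>))"
  proof (rule order_tendstoI)
    fix l assume l: "l < E (ereal \<beta>)"
    then obtain s' where s': "l < s'" "s' < E (ereal \<beta>)" using dense by blast
    then obtain s where s: "0 \<le> s" "s' = ennreal s" by (cases s') auto
    have in1: "\<forall>u\<in>{0..s}. X u \<omega> \<in> {ereal z<..<ereal \<beta>}"
      using s' s entry_time_le_iff[OF w closed_Compl_greaterThanLessThan, of s]
      by (auto simp: E_def not_le[symmetric])
    have "continuous_on {0..s} (\<lambda>t. X t \<omega>)" using w by (rule continuous_on_subset) auto
    then obtain s0 where s0: "s0 \<in> {0..s}" "\<forall>u\<in>{0..s}. X u \<omega> \<le> X s0 \<omega>"
      using continuous_attains_sup[of "{0..s}" "\<lambda>t. X t \<omega>"] s by auto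
    have "l < E b" if b: "X s0 \<omega> < b" "b < ereal \<beta>" for b
    proof -
      have "\<forall>u\<in>{0..s}. X u \<omega> \<in> {ereal z<..<b}" using in1 s0 b by (auto intro: le_less_trans)
      then have "\<not> E b \<le> ennreal s" unfolding E_def
        by (subst entry_time_le_iff[OF w closed_Compl_greaterThanLessThan s(1)]) auto
      then show ?thesis using s' s by auto
    qed
    moreover have "X s0 \<omega> < ereal \<beta>" using in1 s0 by auto
    ultimately show "eventually (\<lambda>b. l < E b) (at_left (ereal \<beta>))"
      by (auto simp: eventually_at_left[of "-\<infinity>"])
  next
    fix u assume u: "E (ereal \<beta>) < u"
    have "E b < u" if "b < ereal \<beta>" for b
    proof -
      have "- {ereal z<..<ereal \<beta>} \<subseteq> - {ereal z<..<b}" using that by auto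
      then have "E b \<le> E (ereal \<beta>)" unfolding E_def by (rule entry_time_mono)
      then show ?thesis using u by simp
    qed
    then show "eventually (\<lambda>b. E b < u) (at_left (ereal \<beta>))"
      by (auto simp: eventually_at_left[of "-\<infinity>"] intro: exI[of _ "-\<infinity>"])
  qed
  then have "Lim (at_left (ereal \<beta>)) E = E (ereal \<beta>)"
    by (intro tendsto_Lim at_left_ereal_neq_bot)
  then show ?thesis by (simp add: exit_time_def interior_exit_time_eq E_def[symmetric, abs_def])
qed

text \<open>By continuity rational levels and times suffice, which makes a limit superior over
  uncountably many times measurable.\<close>

lemma Limsup_path_le_iff:
  fixes w :: "real \<Rightarrow> ereal"
  assumes w: "continuous_on {0..} w"
  shows "Limsup at_top w \<le> c \<longleftrightarrow>
    (\<forall>r\<in>{r\<in>\<rat>. c < ereal r}. \<exists>n::nat. \<forall>q\<in>{real n..} \<inter> \<rat>. w q \<le> ereal r)" (is "?L \<longleftrightarrow> ?R")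
proof
  assume ?L
  show ?R
  proof (intro ballI)
    fix r assume "r \<in> {r\<in>\<rat>. c < ereal r}"
    then have "eventually (\<lambda>t. w t < ereal r) at_top" using \<open>?L\<close> by (auto simp: Limsup_le_iff)
    then obtain N where N: "\<forall>t\<ge>N. w t < ereal r" by (auto simp: eventually_at_top_linorder)
    obtain n :: nat where "N \<le> real n" using real_arch_simple by blast
    then show "\<exists>n::nat. \<forall>q\<in>{real n..} \<inter> \<rat>. w q \<le> ereal r" using N by (intro exI[of _ n]) (auto intro: less_imp_le)
  qed
next
  assume R: ?R
  show ?L unfolding Limsup_le_iff
  proof (intro allI impI)
    fix y assume "c < y"
    then obtain r where r: "c < ereal (real_of_rat r)" "ereal (real_of_rat r) < y"
      using ereal_dense3 by blast
    then obtain n :: nat where n: "\<forall>q\<in>{real n..} \<inter> \<rat>. w q \<le> ereal (real_of_rat r)"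
      using R by (metis (mono_tags, lifting) Rats_of_rat mem_Collect_eq)
    have "w t \<in> {..ereal (real_of_rat r)}" if "real n \<le> t" for t
      by (rule continuous_in_closed_of_rationals[OF w, of _ "real n" "t + 1"]) (use n that in auto)
    then show "eventually (\<lambda>t. w t < y) at_top"
      using r(2) by (auto simp: eventually_at_top_linorder intro!: exI[of _ "real n"] intro: le_less_trans)
  qed
qed

text \<open>Beware of the junk value \<open>grid_index n \<infinity> = 0\<close>.\<close>

definition grid_index :: "nat \<Rightarrow> ennreal \<Rightarrow> nat" where
  "grid_index n t = nat \<lceil>enn2real t * real (Suc n)\<rceil>"

lemma measurable_grid_index[measurable]: "grid_index n \<in> borel \<rightarrow>\<^sub>M count_space UNIV"
  unfolding grid_index_def by measurable

text \<open>Rounding up puts the grid point at or after t, so for a stopping time the event that the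
  index is at most k is known at time \<open>k / (n + 1)\<close>.\<close>

lemma grid_index_le_iff:
  "t < \<infinity> \<Longrightarrow> grid_index n t \<le> k \<longleftrightarrow> t \<le> ennreal (real k / real (Suc n))"
  by (cases t) (auto simp: grid_index_def nat_le_iff ceiling_le_iff field_simps)

lemma grid_tendsto: "(\<lambda>n. real (grid_index n t) / real (Suc n)) \<longlonglongrightarrow> enn2real t"
proof (rule tendsto_sandwich[OF always_eventually always_eventually tendsto_const])
  have b: "enn2real t * real (Suc n) \<le> real (grid_index n t)"
    "real (grid_index n t) \<le> enn2real t * real (Suc n) + 1" for n
  proof -
    have "0 \<le> enn2real t * real (Suc n)" by simp
    then have "0 \<le> \<lceil>enn2real t * real (Suc n)\<rceil>" by linarith
    then have "real (grid_index n t) = of_int \<lceil>enn2real t * real (Suc n)\<rceil>"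
      by (simp add: grid_index_def)
    then show "enn2real t * real (Suc n) \<le> real (grid_index n t)"
      "real (grid_index n t) \<le> enn2real t * real (Suc n) + 1" by linarith+
  qed
  show "\<forall>n. enn2real t \<le> real (grid_index n t) / real (Suc n)"
    using b(1) by (simp add: le_divide_eq)
  show "\<forall>n. real (grid_index n t) / real (Suc n) \<le> enn2real t + inverse (real (Suc n))"
  proof
    fix n
    show "real (grid_index n t) / real (Suc n) \<le> enn2real t + inverse (real (Suc n))"
    proof -
      have "real (grid_index n t) / real (Suc n) \<le> (enn2real t * real (Suc n) + 1) / real (Suc n)"
        using b(2)[of n] by (intro divide_right_mono) auto
      also have "\<dots> = enn2real t + inverse (real (Suc n))"
        by (simp add: add_divide_distrib inverse_eq_divide del: of_nat_Suc)
      finally show ?thesis .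
    qed
  qed
  show "(\<lambda>n. enn2real t + inverse (real (Suc n))) \<longlonglongrightarrow> enn2real t"
    using tendsto_add[OF tendsto_const LIMSEQ_inverse_real_of_nat, of "enn2real t"] by simp
qed

lemma path_grid_tendsto:
  fixes w :: "real \<Rightarrow> ereal"
  assumes "continuous_on {0..} w"
  shows "(\<lambda>n. w (real (grid_index n t) / real (Suc n))) \<longlonglongrightarrow> w (enn2real t)"
  by (rule continuous_on_tendsto_compose[OF assms grid_tendsto]) auto

text \<open>The value at a finite random time is the limit of the values at grid times, which are
  pieced together from countably many coordinates.\<close>

lemma measurable_stopped_at:
  fixes X :: "real \<Rightarrow> 'a \<Rightarrow> ereal"
  assumes X: "\<And>s. 0 \<le> s \<Longrightarrow> X s \<in> borel_measurable N"
    and cont: "\<And>\<omega>. \<omega> \<in> space N \<Longrightarrow> continuous_on {0..} (\<lambda>t. X t \<omega>)"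
    and T[measurable]: "T \<in> borel_measurable N"
  shows "stopped_at X T \<in> borel_measurable N"
proof -
  have [measurable]: "(\<lambda>\<omega>. Limsup at_top (\<lambda>t. X t \<omega>)) \<in> borel_measurable N"
  proof (rule borel_measurableI_le)
    fix c
    have m: "Measurable.pred N (\<lambda>\<omega>. X s \<omega> \<le> ereal r)" if "0 \<le> s" for r s
      using X[OF that] by simp
    have "Measurable.pred N (\<lambda>\<omega>. \<forall>r\<in>{r\<in>\<rat>. c < ereal r}. \<exists>n::nat. \<forall>q\<in>{real n..} \<inter> \<rat>. X q \<omega> \<le> ereal r)"
      by (intro measurable_pred_countable pred_intros_countable countable_Collect countable_rat countable_Int2 m)
        auto
    then have "Measurable.pred N (\<lambda>\<omega>. Limsup at_top (\<lambda>t. X t \<omega>) \<le> c)"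
      by (rule measurable_cong[THEN iffD2, rotated]) (rule Limsup_path_le_iff[OF cont])
    then show "{\<omega> \<in> space N. Limsup at_top (\<lambda>t. X t \<omega>) \<le> c} \<in> sets N" by simp
  qed
  have [measurable]: "(\<lambda>\<omega>. X (enn2real (T \<omega>)) \<omega>) \<in> borel_measurable N"
  proof (rule borel_measurable_LIMSEQ_order)
    show "(\<lambda>n. X (real (grid_index n (T \<omega>)) / real (Suc n)) \<omega>) \<longlonglongrightarrow> X (enn2real (T \<omega>)) \<omega>"
      if "\<omega> \<in> space N" for \<omega>
      by (rule path_grid_tendsto[OF cont[OF that]])
    show "(\<lambda>\<omega>. X (real (grid_index n (T \<omega>)) / real (Suc n)) \<omega>) \<in> borel_measurable N" for n
      by (rule measurable_compose_countable[where f="\<lambda>k \<omega>. X (real k / real (Suc n)) \<omega>"])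
        (auto intro: X)
  qed
  show ?thesis unfolding stopped_at_def[abs_def] by measurable
qed

section \<open>The scale function and the filtrations\<close>

text \<open>\<open>Lim\<close> is a definite description; monotonicity shows that the limit exists
  and makes the boundary value of S accessible as a supremum.\<close>

lemma Lim_at_left_strict_mono:
  fixes S :: "real \<Rightarrow> real"
  assumes ab: "\<alpha> < ereal \<beta>" and S: "strict_mono_on (einterval \<alpha> (ereal \<beta>)) S"
  shows "Lim (at_left (ereal \<beta>)) (\<lambda>z. ereal (S (real_of_ereal z))) = (SUP y\<in>einterval \<alpha> (ereal \<beta>). ereal (S y))"
proof (intro tendsto_Lim at_left_ereal_neq_bot order_tendstoI)
  define I where "I = einterval \<alpha> (ereal \<beta>)"
  have I: "real_of_ereal z \<in> I \<and> z = ereal (real_of_ereal z)" if "\<alpha> < z" "z < ereal \<beta>" for z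
    using that by (cases z) (auto simp: I_def einterval_iff)
  {
    fix l assume "l < (SUP y\<in>einterval \<alpha> (ereal \<beta>). ereal (S y))"
    then obtain y where y: "y \<in> I" "l < ereal (S y)" by (auto simp: less_SUP_iff I_def)
    have "l < ereal (S (real_of_ereal z))" if "ereal y < z" "z < ereal \<beta>" for z
    proof -
      have "\<alpha> < z" using y that by (auto simp: I_def einterval_iff)
      then have "y < real_of_ereal z" "real_of_ereal z \<in> I" using I[of z] that by (auto, metis ereal_less_eq(3) linorder_not_less)
      then have "S y < S (real_of_ereal z)" using S y by (auto simp: I_def strict_mono_on_def)
      then show ?thesis using y by (metis ereal_less(1) less_ereal.simps(1) order_less_trans)
    qed
    then show "eventually (\<lambda>z. l < ereal (S (real_of_ereal z))) (at_left (ereal \<beta>))"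
      using y by (auto simp: eventually_at_left[of "-\<infinity>"] I_def einterval_iff intro!: exI[of _ "ereal y"])
  next
    fix u assume u: "(SUP y\<in>einterval \<alpha> (ereal \<beta>). ereal (S y)) < u"
    have "ereal (S (real_of_ereal z)) < u" if "\<alpha> < z" "z < ereal \<beta>" for z
      using I[OF that] u by (auto simp: I_def intro: le_less_trans SUP_upper)
    then show "eventually (\<lambda>z. ereal (S (real_of_ereal z)) < u) (at_left (ereal \<beta>))"
      using ab by (auto simp: eventually_at_left[of \<alpha>])
  }
qed

lemma at_right_ereal_neq_bot: "\<alpha> < (\<beta>::ereal) \<Longrightarrow> \<not> trivial_limit (at_right \<alpha>)"
proof
  assume "\<alpha> < \<beta>" "trivial_limit (at_right \<alpha>)"
  then have "eventually (\<lambda>_. False) (at_right \<alpha>)" by simp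
  then obtain b where "\<alpha> < b" "\<forall>y>\<alpha>. \<not> y < b"
    using eventually_at_right[OF \<open>\<alpha> < \<beta>\<close>] by auto
  then show False using dense by blast
qed

lemma Lim_at_right_strict_mono:
  fixes S :: "real \<Rightarrow> real"
  assumes ab: "\<alpha> < ereal \<beta>" and S: "strict_mono_on (einterval \<alpha> (ereal \<beta>)) S"
  shows "Lim (at_right \<alpha>) (\<lambda>z. ereal (S (real_of_ereal z))) = (INF y\<in>einterval \<alpha> (ereal \<beta>). ereal (S y))"
proof (intro tendsto_Lim at_right_ereal_neq_bot[OF ab] order_tendstoI)
  define I where "I = einterval \<alpha> (ereal \<beta>)"
  have I: "real_of_ereal z \<in> I \<and> z = ereal (real_of_ereal z)" if "\<alpha> < z" "z < ereal \<beta>" for z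
    using that by (cases z) (auto simp: I_def einterval_iff)
  {
    fix l assume "(INF y\<in>einterval \<alpha> (ereal \<beta>). ereal (S y)) < l"
    then obtain y where y: "y \<in> I" "ereal (S y) < l" by (auto simp: INF_less_iff I_def)
    have "ereal (S (real_of_ereal z)) < l" if "\<alpha> < z" "z < ereal y" for z
    proof -
      have "z < ereal \<beta>" using y that by (auto simp: I_def einterval_iff intro: less_trans)
      then have "real_of_ereal z < y" "real_of_ereal z \<in> I" using I[of z] that by (auto, metis ereal_less_eq(3) linorder_not_less)
      then have "S (real_of_ereal z) < S y" using S y by (auto simp: I_def strict_mono_on_def)
      then show ?thesis using y by (metis less_ereal.simps(1) order_less_trans)
    qed
    then show "eventually (\<lambda>z. ereal (S (real_of_ereal z)) < l) (at_right \<alpha>)"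
      using y by (auto simp: eventually_at_right[OF ab] I_def einterval_iff intro!: exI[of _ "ereal y"])
  next
    fix u assume u: "u < (INF y\<in>einterval \<alpha> (ereal \<beta>). ereal (S y))"
    have "u < ereal (S (real_of_ereal z))" if "\<alpha> < z" "z < ereal \<beta>" for z
      using I[OF that] u by (auto simp: I_def intro: less_le_trans INF_lower)
    then show "eventually (\<lambda>z. u < ereal (S (real_of_ereal z))) (at_right \<alpha>)"
      using ab by (auto simp: eventually_at_right[OF ab])
  }
qed

lemma sets_natural_filt:
  "sets (natural_filt \<Omega> X t) =
    sigma_sets \<Omega> {X s -` A \<inter> \<Omega> | s A. 0 \<le> s \<and> ennreal s \<le> t \<and> A \<in> sets borel}"
  and space_natural_filt: "space (natural_filt \<Omega> X t) = \<Omega>"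
  unfolding natural_filt_def by (auto intro!: sets_measure_of space_measure_of)

lemma sets_randomized_filt:
  "sets (randomized_filt \<Omega> U X t) = sigma_sets \<Omega> ({U -` A \<inter> \<Omega> | A. A \<in> sets borel} \<union>
      {X s -` A \<inter> \<Omega> | s A. 0 \<le> s \<and> ennreal s \<le> t \<and> A \<in> sets borel})"
  and space_randomized_filt: "space (randomized_filt \<Omega> U X t) = \<Omega>"
  unfolding randomized_filt_def by (auto intro!: sets_measure_of space_measure_of)

lemma filtration_natural_filt: "filtration \<Omega> (natural_filt \<Omega> X)"
proof
  show "sets (natural_filt \<Omega> X i) \<subseteq> sets (natural_filt \<Omega> X j)" if "i \<le> j" for i j
    unfolding sets_natural_filt by (rule sigma_sets_mono') (use that in \<open>blast intro: order.trans\<close>)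
qed (rule space_natural_filt)

lemma filtration_randomized_filt: "filtration \<Omega> (randomized_filt \<Omega> U X)"
proof
  show "sets (randomized_filt \<Omega> U X i) \<subseteq> sets (randomized_filt \<Omega> U X j)" if "i \<le> j" for i j
    unfolding sets_randomized_filt by (rule sigma_sets_mono') (use that in \<open>blast intro: order.trans\<close>)
qed (rule space_randomized_filt)

lemma measurable_natural_filt: "0 \<le> s \<Longrightarrow> ennreal s \<le> t \<Longrightarrow> X s \<in> borel_measurable (natural_filt \<Omega> X t)"
  by (rule measurableI) (auto simp: sets_natural_filt space_natural_filt)

lemma sets_natural_le_randomized: "sets (natural_filt \<Omega> X t) \<subseteq> sets (randomized_filt \<Omega> U X t)"
  unfolding sets_natural_filt sets_randomized_filt by (rule sigma_sets_mono') blast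

locale attractive_right_end = randomized_diffusion M P X \<alpha> "ereal \<beta>" S m U
  for M :: "'a measure" and P :: "real \<Rightarrow> 'a measure" and X :: "real \<Rightarrow> 'a \<Rightarrow> ereal"
    and \<alpha> :: ereal and \<beta> :: real and S :: "real \<Rightarrow> real" and m :: "real measure" and U :: "'a \<Rightarrow> real" +
  fixes S\<beta> :: real
  assumes right_attractive: "scale_right (ereal \<beta>) S = ereal S\<beta>"
    and left_not_attractive: "scale_left \<alpha> S = -\<infinity>"
begin

abbreviation "I \<equiv> einterval \<alpha> (ereal \<beta>)"

text \<open>Takes the role of \<open>h\<close> in the dual problem.\<close>

definition gap :: "real \<Rightarrow> real" where "gap y = S\<beta> - S y"

lemma SUP_scale: "(SUP y\<in>I. ereal (S y)) = ereal S\<beta>"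
  using right_attractive Lim_at_left_strict_mono[OF endpoints scale_increasing] by (simp add: scale_right_def)

lemma scale_less: "y \<in> I \<Longrightarrow> z \<in> I \<Longrightarrow> y < z \<Longrightarrow> S y < S z"
  using scale_increasing by (auto simp: strict_mono_on_def)

lemma between_in_I: "a \<in> I \<Longrightarrow> a \<le> y \<Longrightarrow> y < \<beta> \<Longrightarrow> y \<in> I"
  by (simp add: einterval_iff order_less_le_trans[of \<alpha> "ereal a"])

lemma I_less: "y \<in> I \<Longrightarrow> y < \<beta>" and I_greater: "y \<in> I \<Longrightarrow> \<alpha> < ereal y"
  by (auto simp: einterval_iff)

lemma gap_pos: "y \<in> I \<Longrightarrow> 0 < gap y"
proof -
  assume y: "y \<in> I"
  have "(y + \<beta>) / 2 \<in> I" using I_less[OF y] by (intro between_in_I[OF y]) auto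
  then have "S y < S ((y + \<beta>) / 2)" "ereal (S ((y + \<beta>) / 2)) \<le> ereal S\<beta>"
    using y I_less[OF y] by (auto intro!: scale_less SUP_upper simp flip: SUP_scale)
  then show ?thesis by (simp add: gap_def)
qed

lemma gap_less: "y \<in> I \<Longrightarrow> z \<in> I \<Longrightarrow> y < z \<Longrightarrow> gap z < gap y"
  using scale_less by (simp add: gap_def)

lemma gap_le: "y \<in> I \<Longrightarrow> z \<in> I \<Longrightarrow> y \<le> z \<Longrightarrow> gap z \<le> gap y"
  using gap_less[of y z] by (cases "y = z") auto

lemma gap_continuous: "continuous_on I gap"
  unfolding gap_def by (intro continuous_intros scale_continuous)

lemma gap_unbounded: "\<exists>a\<in>I. c < gap a"
proof -
  have "(INF y\<in>I. ereal (S y)) < ereal (S\<beta> - c)"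
    using left_not_attractive Lim_at_right_strict_mono[OF endpoints scale_increasing] by (simp add: scale_left_def)
  then obtain y where "y \<in> I" "S y < S\<beta> - c" by (auto simp: INF_less_iff)
  then show ?thesis by (intro bexI[of _ y]) (auto simp: gap_def)
qed

lemma gap_small: "0 < e \<Longrightarrow> \<exists>b\<in>I. gap b < e"
proof -
  assume "0 < e"
  then have "ereal (S\<beta> - e) < (SUP y\<in>I. ereal (S y))" by (simp add: SUP_scale)
  then obtain y where "y \<in> I" "S\<beta> - e < S y" by (auto simp: less_SUP_iff)
  then show ?thesis by (intro bexI[of _ y]) (auto simp: gap_def)
qed

lemma prob_space_P: "x \<in> I \<Longrightarrow> prob_space (P x)" and space_P: "x \<in> I \<Longrightarrow> space (P x) = space M"
  using prob sets_P[THEN sets_eq_imp_space_eq] by auto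

lemma sets_natural_le: "sets (natural_filt (space M) X t) \<subseteq> sets M"
  unfolding sets_natural_filt by (rule sets.sigma_sets_subset) (auto intro!: measurable_sets[OF X_measurable])

lemma sets_randomized_le: "sets (randomized_filt (space M) U X t) \<subseteq> sets M"
  unfolding sets_randomized_filt
  by (rule sets.sigma_sets_subset)
    (auto intro!: measurable_sets[OF X_measurable] measurable_sets[OF U_measurable])

lemma measurable_natural_M: "f \<in> borel_measurable (natural_filt (space M) X t) \<Longrightarrow> f \<in> borel_measurable M"
  using measurable_mono[OF order_refl refl sets_natural_le] by (auto simp: space_natural_filt)

text \<open>Being at or below a, instead of at a, gives an event that shrinks as s grows and that,
  for s = 0, is almost sure from every starting point at or below a.\<close>

definition fall :: "real \<Rightarrow> real \<Rightarrow> 'a set" where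
  "fall a s = {\<omega> \<in> space M. \<exists>t\<ge>s. X t \<omega> \<le> ereal a}"

lemma continuous_shift: "\<omega> \<in> space M \<Longrightarrow> 0 \<le> s \<Longrightarrow> continuous_on {0..} (\<lambda>t. X (s + t) \<omega>)"
  by (rule continuous_on_compose2[OF X_continuous]) (auto intro!: continuous_intros)

lemma fall_eq: "0 \<le> s \<Longrightarrow> fall a s = {\<omega> \<in> space M. \<exists>K::nat. \<not> (\<forall>t\<in>{0..real K}. ereal a < X (s + t) \<omega>)}"
proof (intro set_eqI iffI)
  fix \<omega> assume "0 \<le> s" "\<omega> \<in> fall a s"
  then obtain t where t: "\<omega> \<in> space M" "s \<le> t" "X t \<omega> \<le> ereal a" by (auto simp: fall_def)
  obtain K :: nat where "t - s \<le> real K" using real_arch_simple by blast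
  then have "\<not> (\<forall>t\<in>{0..real K}. ereal a < X (s + t) \<omega>)" using t by (auto intro!: bexI[of _ "t - s"] simp: not_less)
  then show "\<omega> \<in> {\<omega> \<in> space M. \<exists>K::nat. \<not> (\<forall>t\<in>{0..real K}. ereal a < X (s + t) \<omega>)}" using t by auto
next
  fix \<omega> assume "0 \<le> s" "\<omega> \<in> {\<omega> \<in> space M. \<exists>K::nat. \<not> (\<forall>t\<in>{0..real K}. ereal a < X (s + t) \<omega>)}"
  then obtain t where "\<omega> \<in> space M" "0 \<le> t" "X (s + t) \<omega> \<le> ereal a" by (auto simp: not_less)
  then show "\<omega> \<in> fall a s" by (auto simp: fall_def intro!: exI[of _ "s + t"])
qed

lemma fall_measurable: "0 \<le> s \<Longrightarrow> fall a s \<in> sets (natural_filt (space M) X \<infinity>)"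
proof -
  assume s: "0 \<le> s"
  have "Measurable.pred (natural_filt (space M) X \<infinity>) (\<lambda>\<omega>. \<exists>K::nat. \<not> (\<forall>t\<in>{0..real K}. ereal a < X (s + t) \<omega>))"
    using s by (intro pred_intros_countable pred_intros_logic pred_path_above continuous_shift)
      (auto simp: space_natural_filt intro!: measurable_natural_filt)
  then show ?thesis unfolding fall_eq[OF s] by (simp add: pred_def space_natural_filt)
qed

lemma fall_in_M: "0 \<le> s \<Longrightarrow> fall a s \<in> sets M"
  using fall_measurable sets_natural_le by blast

text \<open>Measurability is read off from \<open>scale_hitting\<close>: \<open>measure\<close> has
  the default value 0 on non-measurable sets, but here it is positive.\<close>

lemma hit_less_measurable:
  assumes "\<alpha> < ereal a" "a < x" "x < b" "b < \<beta>"
  shows "{\<omega> \<in> space M. hit_time X b \<omega> < hit_time X a \<omega>} \<in> sets M"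
proof -
  have I: "a \<in> I" "x \<in> I" "b \<in> I" using assms by (auto simp: einterval_iff intro: less_trans)
  have "0 < (S x - S a) / (S b - S a)" using scale_less I assms by (intro divide_pos_pos) auto
  then have "measure (P x) {\<omega> \<in> space M. hit_time X b \<omega> < hit_time X a \<omega>} \<noteq> 0"
    using scale_hitting[OF assms(1-3)] assms(4) by (simp only: ereal_less_eq less_ereal.simps)
  then show ?thesis using measure_notin_sets sets_P[OF I(2)] by metis
qed

lemma stopping_time_interior: "stopping_time (natural_filt (space M) X) (interior_exit_time X a b)"
  by (rule stopping_time_interior_exit) (auto intro: measurable_natural_filt X_continuous simp: space_natural_filt)

text \<open>The speed measure enters here: the Green kernel is at most \<open>S b - S a\<close> and
  the interval has finite speed measure, so the mean exit time is finite.\<close>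

lemma AE_exit_finite:
  assumes "\<alpha> < ereal a" "a < x" "x < b" "b < \<beta>"
  shows "AE \<omega> in P x. interior_exit_time X a (ereal b) \<omega> < \<infinity>"
proof -
  have I: "a \<in> I" "x \<in> I" "b \<in> I" using assms by (auto simp: einterval_iff intro: less_trans)
  have Sab: "S a < S b" using scale_less I assms by auto
  have meas: "interior_exit_time X a (ereal b) \<in> borel_measurable (P x)"
    using measurable_stopping_time[OF stopping_time_interior, of M] sets_natural_le
    by (simp add: space_natural_filt measurable_cong_sets[OF sets_P[OF I(2)] refl])
  have "(\<integral>\<^sup>+y\<in>{a<..<b}. ennreal (green_kernel S a b x y) \<partial>m) \<le> (\<integral>\<^sup>+y. ennreal (S b - S a) * indicator {a<..<b} y \<partial>m)"
  proof (intro nn_integral_mono)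
    fix y
    show "ennreal (green_kernel S a b x y) * indicator {a<..<b} y \<le> ennreal (S b - S a) * indicator {a<..<b} y"
    proof (cases "y \<in> {a<..<b}")
      case True
      then have y: "min x y \<in> I" "max x y \<in> I" "a < min x y" "max x y < b" "min x y \<le> max x y"
        using I assms by (auto simp: einterval_iff min_def max_def intro: less_trans)
      have 1: "S a < S (min x y)" "S (max x y) < S b" using y I by (auto intro!: scale_less)
      have 2: "S (min x y) < S b" using y I by (intro scale_less) auto
      have 3: "S a < S (max x y)" using y I by (intro scale_less) auto
      have "(S (min x y) - S a) * (S b - S (max x y)) \<le> (S b - S a) * (S b - S a)"
        using 1 2 3 by (intro mult_mono) auto
      then have "green_kernel S a b x y \<le> S b - S a" unfolding green_kernel_def using Sab
        by (simp add: divide_le_eq)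
      then show ?thesis by (intro mult_right_mono ennreal_leI) auto
    qed simp
  qed
  also have "\<dots> = ennreal (S b - S a) * emeasure m {a<..<b}"
    by (subst nn_integral_cmult_indicator) (auto simp: speed_sets)
  also have "\<dots> < \<infinity>" using speed_locally_finite[of a b] assms by (auto simp: ennreal_mult_less_top)
  finally have "(\<integral>\<^sup>+\<omega>. interior_exit_time X a (ereal b) \<omega> \<partial>P x) < \<infinity>"
    using speed_exit[of a x b] assms by simp
  then have "AE \<omega> in P x. interior_exit_time X a (ereal b) \<omega> \<noteq> \<infinity>"
    by (intro nn_integral_PInf_AE meas) auto
  then show ?thesis by (simp add: less_top)
qed

lemma AE_start: "x \<in> I \<Longrightarrow> AE \<omega> in P x. \<omega> \<in> space M \<and> X 0 \<omega> = ereal x"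
  using X_start AE_space[of "P x"] by (auto simp: space_P)

text \<open>If b is not hit before a, the comparison alone does not tell that a is hit, as both
  times could be infinite; the second conjunct records that the exit value is taken at a finite
  time.\<close>

lemma AE_exit_value:
  assumes "\<alpha> < ereal a" "a < x" "x < b" "b < \<beta>"
  shows "AE \<omega> in P x. stopped_at X (interior_exit_time X a (ereal b)) \<omega> =
    ereal (if hit_time X b \<omega> < hit_time X a \<omega> then b else a) \<and>
    (\<exists>t\<ge>0. X t \<omega> = stopped_at X (interior_exit_time X a (ereal b)) \<omega>)"
proof -
  have x: "x \<in> I" using assms by (auto simp: einterval_iff intro: less_trans)
  show ?thesis using AE_start[OF x] AE_exit_finite[OF assms]
  proof eventually_elim
    case (elim \<omega>)
    then obtain T where T: "0 \<le> T" "interior_exit_time X a (ereal b) \<omega> = ennreal T"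
      by (cases "interior_exit_time X a (ereal b) \<omega>") auto
    then have e: "stopped_at X (interior_exit_time X a (ereal b)) \<omega> = X T \<omega>" by (simp add: stopped_at_def)
    have "X T \<omega> = ereal (if hit_time X b \<omega> < hit_time X a \<omega> then b else a)"
      using exit_interval_value_iff[OF X_continuous, of \<omega> "ereal a" "ereal b" T] elim T assms
      by (auto simp: interior_exit_time_eq hit_time_eq)
    then show ?case using e T by auto
  qed
qed

subsection \<open>Falling to a level\<close>

text \<open>The offset 2 keeps already the first level strictly above x; the levels increase to
  \<beta>.\<close>

definition level :: "real \<Rightarrow> nat \<Rightarrow> real" where
  "level x n = \<beta> - (\<beta> - x) / real (n + 2)"

lemma level_bounds: "x \<in> I \<Longrightarrow> x < level x n" "x \<in> I \<Longrightarrow> level x n < \<beta>"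
proof -
  assume "x \<in> I"
  then have "0 < \<beta> - x" using I_less by simp
  then show "level x n < \<beta>" by (simp add: level_def)
  have "(\<beta> - x) / real (n + 2) < (\<beta> - x) / 1"
    using \<open>0 < \<beta> - x\<close> by (intro divide_strict_left_mono) auto
  then show "x < level x n" by (simp add: level_def)
qed

lemma level_in_I: "x \<in> I \<Longrightarrow> level x n \<in> I"
  by (rule between_in_I[OF _ less_imp_le[OF level_bounds(1)] level_bounds(2)])

lemma level_tendsto: "level x \<longlonglongrightarrow> \<beta>"
  unfolding level_def
  using tendsto_diff[OF tendsto_const LIMSEQ_ignore_initial_segment[OF lim_const_over_n, of "\<beta> - x" 2], of \<beta>]
  by simp

lemma level_mono: "x \<in> I \<Longrightarrow> i \<le> n \<Longrightarrow> level x i \<le> level x n"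
  using I_less[of x] by (auto simp: level_def intro!: divide_left_mono)

lemma gap_level: "x \<in> I \<Longrightarrow> (\<lambda>n. gap (level x n)) \<longlonglongrightarrow> 0"
proof (rule order_tendstoI)
  assume x: "x \<in> I"
  show "eventually (\<lambda>n. l < gap (level x n)) sequentially" if "l < 0" for l
    by (intro always_eventually allI less_trans[OF that gap_pos[OF level_in_I[OF x]]])
  show "eventually (\<lambda>n. gap (level x n) < u) sequentially" if u: "0 < u" for u
  proof -
    obtain b where b: "b \<in> I" "gap b < u" using gap_small[OF u] by auto
    have "eventually (\<lambda>n. b < level x n) sequentially"
      using order_tendstoD(1)[OF level_tendsto I_less[OF b(1)]] .
    then show ?thesis
      by eventually_elim (rule less_trans[OF gap_less[OF b(1) level_in_I[OF x]] b(2)])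
  qed
qed

text \<open>The maximum of the path on \<open>{0..T}\<close> is at least every late level, hence
  equals \<beta>, and at \<beta> the path is frozen.\<close>

lemma exceeds_level:
  assumes "\<omega> \<in> space M" "x \<in> I" "\<And>n. k \<le> n \<Longrightarrow> \<exists>s\<in>{0..T}. X s \<omega> = ereal (level x n)" "0 \<le> T"
  shows "X T \<omega> = ereal \<beta>"
proof -
  have "continuous_on {0..T} (\<lambda>t. X t \<omega>)"
    using X_continuous[OF assms(1)] by (rule continuous_on_subset) auto
  then obtain s where s: "s \<in> {0..T}" "\<forall>u\<in>{0..T}. X u \<omega> \<le> X s \<omega>"
    using continuous_attains_sup[of "{0..T}" "\<lambda>t. X t \<omega>"] assms by auto
  have "ereal (level x n) \<le> X s \<omega>" if "k \<le> n" for n using assms(3)[OF that] s(2) by fastforce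
  moreover have "(\<lambda>n. ereal (level x n)) \<longlonglongrightarrow> ereal \<beta>" using level_tendsto by simp
  ultimately have "ereal \<beta> \<le> X s \<omega>" by (intro LIMSEQ_le_const2[of _ _ "X s \<omega>"]) blast+
  moreover have "X s \<omega> \<le> ereal \<beta>" using X_range[of s \<omega>] s assms by auto
  ultimately show ?thesis using X_absorbed[of s T \<omega>] s assms by auto
qed

text \<open>If the path stayed below some level from a time on, all higher levels would have been
  hit by then, and the path would already be frozen at \<beta>. The argument covers reaching \<beta>
  as well as merely approaching it.\<close>

lemma Limsup_right_end:
  assumes w: "\<omega> \<in> space M" and x: "x \<in> I" and hit: "\<And>n. \<exists>s\<ge>0. X s \<omega> = ereal (level x n)"
  shows "Limsup at_top (\<lambda>t. X t \<omega>) = ereal \<beta>"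
proof (rule antisym)
  show "Limsup at_top (\<lambda>t. X t \<omega>) \<le> ereal \<beta>"
    using X_range[OF _ w] by (intro Limsup_bounded) (auto simp: eventually_at_top_linorder intro!: exI[of _ 0])
  have "ereal (level x n) \<le> Limsup at_top (\<lambda>t. X t \<omega>)" for n
  proof (rule ccontr)
    assume "\<not> ereal (level x n) \<le> Limsup at_top (\<lambda>t. X t \<omega>)"
    then have "eventually (\<lambda>t. X t \<omega> < ereal (level x n)) at_top" by (intro Limsup_lessD) simp
    then obtain K where K: "\<And>t. K \<le> t \<Longrightarrow> X t \<omega> < ereal (level x n)"
      by (auto simp: eventually_at_top_linorder)
    define T where "T = max 0 K"
    have "\<exists>s\<in>{0..T}. X s \<omega> = ereal (level x m)" if "n \<le> m" for m
    proof -
      obtain s where s: "s \<ge> 0" "X s \<omega> = ereal (level x m)" using hit by blast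
      then have "\<not> K \<le> s" using K[of s] level_mono[OF x that] by auto
      then show ?thesis using s by (auto simp: T_def)
    qed
    then have "X T \<omega> = ereal \<beta>" by (intro exceeds_level[OF w x, of n]) (auto simp: T_def)
    then show False using K[of T] level_bounds(2)[OF x, of n] by (simp add: T_def)
  qed
  moreover have "(\<lambda>n. ereal (level x n)) \<longlonglongrightarrow> ereal \<beta>" using level_tendsto by simp
  ultimately show "ereal \<beta> \<le> Limsup at_top (\<lambda>t. X t \<omega>)" by (intro LIMSEQ_le_const2[of _ _ "Limsup at_top (\<lambda>t. X t \<omega>)"]) blast+
qed

text \<open>The exits from the intervals between a and the levels decide: either a precedes some
  level, or all levels precede a. In the second case a visit to a at time r would force all levels
  to be hit by r, hence the value \<beta> at r.\<close>

lemma AE_fall_dichotomy: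
  assumes a: "a \<in> I" and x: "x \<in> I" and ax: "a < x"
  defines "\<tau> \<equiv> interior_exit_time X a (ereal \<beta>)"
  shows "AE \<omega> in P x. (\<omega> \<in> fall a 0 \<longleftrightarrow> (\<exists>n. \<not> hit_time X (level x n) \<omega> < hit_time X a \<omega>)) \<and>
    (if \<omega> \<in> fall a 0 then stopped_at X \<tau> \<omega> = ereal a
     else stopped_at X \<tau> \<omega> = ereal \<beta> \<and> Limsup at_top (\<lambda>t. X t \<omega>) = ereal \<beta>)"
proof -
  have "AE \<omega> in P x. \<forall>n. stopped_at X (interior_exit_time X a (ereal (level x n))) \<omega> =
      ereal (if hit_time X (level x n) \<omega> < hit_time X a \<omega> then level x n else a) \<and>
      (\<exists>t\<ge>0. X t \<omega> = stopped_at X (interior_exit_time X a (ereal (level x n))) \<omega>)"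
    unfolding AE_all_countable
    using AE_exit_value[OF I_greater[OF a] ax level_bounds[OF x]] by blast
  with AE_start[OF x] show ?thesis
  proof eventually_elim
    case (elim \<omega>)
    then have w: "\<omega> \<in> space M" and start: "X 0 \<omega> \<in> {ereal a<..<ereal \<beta>}" using ax I_less[OF x] by auto
    note cont = X_continuous[OF w]
    have val: "stopped_at X \<tau> \<omega> = X T \<omega>" "X T \<omega> \<in> {ereal a, ereal \<beta>}"
      if "\<tau> \<omega> = ennreal T" "0 \<le> T" for T
      using that exit_interval_value(1)[OF cont start _ that(2)]
      by (auto simp: stopped_at_def \<tau>_def interior_exit_time_eq)
    show ?case
    proof (cases "\<exists>n. \<not> hit_time X (level x n) \<omega> < hit_time X a \<omega>")
      case True
      then obtain n t where n: "\<not> hit_time X (level x n) \<omega> < hit_time X a \<omega>" "0 \<le> t" "X t \<omega> = ereal a"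
        using elim by metis
      then have fall: "\<omega> \<in> fall a 0" using w by (auto simp: fall_def intro!: exI[of _ t])
      have "\<tau> \<omega> \<le> ennreal t" unfolding \<tau>_def interior_exit_time_eq
        using n entry_time_le_iff[OF cont closed_Compl_greaterThanLessThan n(2)] by force
      then obtain T where T: "\<tau> \<omega> = ennreal T" "0 \<le> T" "T \<le> t" using n(2) by (cases "\<tau> \<omega>") (auto simp: top_unique)
      have "X T \<omega> \<noteq> ereal \<beta>" using X_absorbed[OF T(2,3) w] n I_less[OF a] by auto
      then show ?thesis using val[OF T(1,2)] fall True by auto
    next
      case False
      have hit: "\<exists>s\<ge>0. X s \<omega> = ereal (level x n)" for n
      proof -
        have "hit_time X (level x n) \<omega> < hit_time X a \<omega>" using False by auto
        then have "hit_time X (level x n) \<omega> < \<infinity>" by (rule less_le_trans) simp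
        then show ?thesis unfolding hit_time_eq entry_time_finite_iff[OF cont closed_singleton] by simp
      qed
      have nofall: "\<omega> \<notin> fall a 0"
      proof
        assume "\<omega> \<in> fall a 0"
        then obtain t where t: "0 \<le> t" "X t \<omega> \<le> ereal a" by (auto simp: fall_def)
        then obtain r where r: "r \<in> {0..t}" "X r \<omega> = ereal a"
          using path_between_attained[OF cont order_refl t(1), of "ereal a"] start
          by (auto simp: min_le_iff_disj le_max_iff_disj less_imp_le)
        then have r0: "0 \<le> r" by simp
        have ha: "hit_time X a \<omega> \<le> ennreal r"
          unfolding hit_time_eq entry_time_le_iff[OF cont closed_singleton r0] using r by auto
        have "\<exists>s\<in>{0..r}. X s \<omega> = ereal (level x n)" for n
        proof -
          have "hit_time X (level x n) \<omega> \<le> ennreal r" using False ha by (meson less_imp_le less_le_trans)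
          then show ?thesis unfolding hit_time_eq entry_time_le_iff[OF cont closed_singleton r0] by simp
        qed
        then have "X r \<omega> = ereal \<beta>" using r by (intro exceeds_level[OF w x]) auto
        then show False using r I_less[OF a] by simp
      qed
      have L: "Limsup at_top (\<lambda>t. X t \<omega>) = ereal \<beta>" by (rule Limsup_right_end[OF w x hit])
      have "stopped_at X \<tau> \<omega> = ereal \<beta>"
      proof (cases "\<tau> \<omega>")
        case (real T)
        then have "X T \<omega> \<noteq> ereal a" using nofall w by (auto simp: fall_def)
        then show ?thesis using val[of T] real by auto
      qed (simp add: stopped_at_def L)
      then show ?thesis using nofall L False by auto
    qed
  qed
qed

text \<open>Up to a null set the complement says that every level precedes a.
  \<open>scale_hitting\<close> gives the probability for each level, and the gaps of the levels tend
  to 0.\<close>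

lemma prob_fall:
  assumes a: "a \<in> I" and x: "x \<in> I" and ax: "a < x"
  shows "measure (P x) (fall a 0) = gap x / gap a"
proof -
  interpret prob_space "P x" by (rule prob_space_P[OF x])
  define H where "H n = {\<omega> \<in> space M. hit_time X (level x n) \<omega> < hit_time X a \<omega>}" for n
  have Hm: "H n \<in> events" for n
    using hit_less_measurable[OF I_greater[OF a] ax level_bounds[OF x]] by (simp add: H_def sets_P[OF x])
  \<comment> \<open>\<open>H\<close> decreases in n only for paths started at x, that is almost
    surely; the partial intersections decrease for every path.\<close>
  define H' where "H' n = (\<Inter>i\<le>n. H i)" for n
  have H'm: "H' n \<in> events" for n using Hm by (auto simp: H'_def)
  have "measure (P x) (H' n) = measure (P x) (H n)" for n
  proof (rule measure_eq_AE[OF _ H'm Hm])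
    show "AE \<omega> in P x. \<omega> \<in> H' n \<longleftrightarrow> \<omega> \<in> H n" using AE_start[OF x]
    proof eventually_elim
      case (elim \<omega>)
      have "\<omega> \<in> H i" if n: "\<omega> \<in> H n" and "i \<le> n" for i
      proof -
        note cont = X_continuous[OF conjunct1[OF elim]]
        have "hit_time X (level x n) \<omega> < hit_time X a \<omega>" using n by (simp add: H_def)
        then have "hit_time X (level x n) \<omega> < \<infinity>" by (rule less_le_trans) simp
        then obtain t where t: "0 \<le> t" "X t \<omega> = ereal (level x n)" "hit_time X (level x n) \<omega> = ennreal t"
          unfolding hit_time_eq using entry_time_finite_iff[OF cont closed_singleton]
            entry_time_attained[OF cont closed_singleton] by (metis singletonD)
        have "\<exists>r\<in>{0..t}. X r \<omega> = ereal (level x i)"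
          using path_between_attained[OF cont order_refl t(1), of "ereal (level x i)"] elim t
            level_bounds[OF x, of i] level_mono[OF x that(2)]
          by (auto simp: min_le_iff_disj le_max_iff_disj less_imp_le)
        then have "hit_time X (level x i) \<omega> \<le> ennreal t"
          unfolding hit_time_eq entry_time_le_iff[OF cont closed_singleton t(1)] by auto
        then show ?thesis using n t by (auto simp: H_def)
      qed
      then show ?case by (auto simp: H'_def)
    qed
  qed
  moreover have "measure (P x) (H n) = (gap a - gap x) / (gap a - gap (level x n))" for n
    using scale_hitting[OF I_greater[OF a] ax level_bounds(1)[OF x]] level_bounds(2)[OF x, of n]
    by (simp add: H_def gap_def)
  moreover have "(\<lambda>n. (gap a - gap x) / (gap a - gap (level x n))) \<longlonglongrightarrow> (gap a - gap x) / (gap a - 0)"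
    using gap_pos[OF a] by (intro tendsto_intros gap_level[OF x]) auto
  moreover have "(\<lambda>n. measure (P x) (H' n)) \<longlonglongrightarrow> measure (P x) (\<Inter>n. H' n)"
    using H'm by (intro finite_Lim_measure_decseq) (auto simp: decseq_def H'_def)
  ultimately have lim: "measure (P x) (\<Inter>n. H' n) = (gap a - gap x) / gap a"
    using LIMSEQ_unique by auto
  have m: "(\<Inter>n. H' n) \<in> events" using H'm by auto
  have "measure (P x) (fall a 0) = measure (P x) (space (P x) - (\<Inter>n. H' n))"
  proof (rule measure_eq_AE)
    show "AE \<omega> in P x. \<omega> \<in> fall a 0 \<longleftrightarrow> \<omega> \<in> space (P x) - (\<Inter>n. H' n)"
      using AE_fall_dichotomy[OF a x ax] AE_start[OF x]
      by eventually_elim (auto simp: H'_def H_def space_P[OF x])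
  next
    show "fall a 0 \<in> events" using fall_in_M by (simp add: sets_P[OF x])
    show "space (P x) - (\<Inter>n. H' n) \<in> events" using m by (rule sets.compl_sets)
  qed
  also have "\<dots> = 1 - (gap a - gap x) / gap a" using prob_compl[OF m] lim by simp
  also have "\<dots> = gap x / gap a" using gap_pos[OF a] by (simp add: field_simps)
  finally show ?thesis .
qed

text \<open>The probability of falling to a from y; the truncation covers y at or below a, where the
  quotient is at least 1.\<close>

definition reach :: "real \<Rightarrow> real \<Rightarrow> real" where
  "reach a y = min 1 (gap y / gap a)"

lemma emeasure_fall: "a \<in> I \<Longrightarrow> y \<in> I \<Longrightarrow> emeasure (P y) (fall a 0) = ennreal (reach a y)"
proof -
  assume a: "a \<in> I" and y: "y \<in> I"
  interpret prob_space "P y" by (rule prob_space_P[OF y])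
  have pos: "0 < gap a" "0 < gap y" using gap_pos a y by auto
  show ?thesis
  proof (cases "a < y")
    case True
    then have "gap y \<le> gap a" using gap_le[OF a y] by simp
    then show ?thesis using prob_fall[OF a y True] pos by (simp add: emeasure_eq_measure reach_def)
  next
    case False
    then have "gap a \<le> gap y" using gap_le[OF y a] by simp
    have "AE \<omega> in P y. \<omega> \<in> fall a 0" using AE_start[OF y]
      by eventually_elim (use False in \<open>auto simp: fall_def intro!: exI[of _ 0]\<close>)
    then have "emeasure (P y) (fall a 0) = 1" using fall_in_M
      by (intro emeasure_eq_1_AE) (auto simp: sets_P[OF y])
    then show ?thesis using \<open>gap a \<le> gap y\<close> pos by (simp add: reach_def)
  qed
qed

subsection \<open>Gaps of stopped values\<close>

lemma real_in_I: "z \<in> {\<alpha><..<ereal \<beta>} \<Longrightarrow> real_of_ereal z \<in> I \<and> ereal (real_of_ereal z) = z"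
  by (cases z) (auto simp: einterval_iff)

lemma interior_tendsto:
  assumes f: "continuous_on I f" and lim: "g \<longlonglongrightarrow> z" and z: "z \<in> {\<alpha><..<ereal \<beta>}"
  shows "(\<lambda>n. ennreal (f (real_of_ereal (g n)))) \<longlonglongrightarrow> ennreal (f (real_of_ereal z))"
proof -
  have zI: "real_of_ereal z \<in> I" and ze: "ereal (real_of_ereal z) = z" using real_in_I[OF z] by auto
  have "(\<lambda>n. real_of_ereal (g n)) \<longlonglongrightarrow> real_of_ereal z"
    using lim by (intro lim_real_of_ereal) (simp add: ze)
  moreover have "isCont f (real_of_ereal z)"
    using f zI by (simp add: continuous_on_eq_continuous_at)
  ultimately show ?thesis by (intro tendsto_ennrealI) (rule isCont_tendsto_compose)
qed

lemma interior_measurable: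
  assumes "continuous_on I f"
  shows "(\<lambda>z. if z \<in> {\<alpha><..<ereal \<beta>} then ennreal (f (real_of_ereal z)) else 0) \<in> borel_measurable borel"
proof (rule borel_measurable_continuous_on_if)
  show "continuous_on {\<alpha><..<ereal \<beta>} (\<lambda>z. ennreal (f (real_of_ereal z)))"
    unfolding continuous_on_sequentially using interior_tendsto[OF assms] by (auto simp: comp_def)
qed auto

text \<open>Extending \<open>reach a\<close> by \<open>0\<close> to both end points keeps it lower semicontinuous, as needed for
  Fatou's lemma; the left end point is never reached.\<close>

definition reach_ext :: "real \<Rightarrow> ereal \<Rightarrow> ennreal" where
  "reach_ext a z = (if z \<in> {\<alpha><..<ereal \<beta>} then ennreal (reach a (real_of_ereal z)) else 0)"

lemma reach_continuous: "a \<in> I \<Longrightarrow> continuous_on I (reach a)"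
  unfolding reach_def using gap_pos[of a] by (intro continuous_intros gap_continuous) auto

lemma reach_ext_tendsto:
  assumes a: "a \<in> I" and lim: "f \<longlonglongrightarrow> z" and z: "z \<in> {\<alpha><..<ereal \<beta>}"
  shows "(\<lambda>n. reach_ext a (f n)) \<longlonglongrightarrow> reach_ext a z"
proof -
  have "eventually (\<lambda>n. f n \<in> {\<alpha><..<ereal \<beta>}) sequentially"
    by (rule topological_tendstoD[OF lim _ z]) auto
  then have "eventually (\<lambda>n. reach_ext a (f n) = ennreal (reach a (real_of_ereal (f n)))) sequentially"
    by eventually_elim (simp add: reach_ext_def)
  then show ?thesis using interior_tendsto[OF reach_continuous[OF a] lim z] z
    by (simp add: reach_ext_def tendsto_cong)
qed

lemma reach_ext_measurable: "a \<in> I \<Longrightarrow> reach_ext a \<in> borel_measurable borel"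
  unfolding reach_ext_def[abs_def] by (rule interior_measurable[OF reach_continuous])

text \<open>Rational times suffice for continuous paths, and the product \<open>\<sigma>\<close>-algebra sees only countably
  many coordinates.\<close>

definition fall_paths :: "real \<Rightarrow> (real \<Rightarrow> ereal) set" where
  "fall_paths a = {w \<in> space path_space.
     \<exists>K::nat. \<not> (\<exists>r\<in>{r\<in>\<rat>. ereal a < ereal r}. \<forall>q\<in>{0..real K} \<inter> \<rat>. ereal r \<le> w q)}"

lemma fall_paths_measurable: "fall_paths a \<in> sets path_space"
proof -
  have "Measurable.pred path_space (\<lambda>w. ereal r \<le> w q)" if "0 \<le> q" for r q
  proof -
    have [measurable]: "(\<lambda>w. w q) \<in> borel_measurable path_space"
      using that by (intro measurable_component_singleton) auto
    show ?thesis by simp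
  qed
  then have "Measurable.pred path_space (\<lambda>w. \<exists>K::nat. \<not> (\<exists>r\<in>{r\<in>\<rat>. ereal a < ereal r}. \<forall>q\<in>{0..real K} \<inter> \<rat>. ereal r \<le> w q))"
    by (intro pred_intros_countable pred_intros_logic measurable_pred_countable countable_Collect countable_rat
        countable_Int2) auto
  then show ?thesis unfolding fall_paths_def by (simp add: pred_def)
qed

lemma path_from_fall_paths: "\<omega> \<in> space M \<Longrightarrow> 0 \<le> s \<Longrightarrow> path_from X s \<omega> \<in> fall_paths a \<longleftrightarrow> \<omega> \<in> fall a s"
proof -
  assume w: "\<omega> \<in> space M" and s: "0 \<le> s"
  have "path_from X s \<omega> \<in> space path_space" by (auto simp: path_from_def space_PiM)
  moreover have eq: "(\<forall>t\<in>{0..real K}. ereal a < X (s + t) \<omega>) \<longleftrightarrow>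
      (\<exists>r\<in>{r\<in>\<rat>. ereal a < ereal r}. \<forall>q\<in>{0..real K} \<inter> \<rat>. ereal r \<le> path_from X s \<omega> q)" for K :: nat
    using all_greater_iff_rational[OF continuous_shift[OF w s], of "real K" "ereal a"]
    by (simp add: path_from_def)
  ultimately show ?thesis unfolding fall_eq[OF s] fall_paths_def mem_Collect_eq eq using w by blast
qed

lemma fall_antimono: "s \<le> t \<Longrightarrow> fall a t \<subseteq> fall a s"
  by (auto simp: fall_def intro: order_trans)

text \<open>Given the past, a fall after s has probability \<open>reach a (X s)\<close> while the
  path is in the interior. The constant time s suffices, because general stopping times are
  discretized later.\<close>

lemma Markov_fall:
  assumes x: "x \<in> I" and a: "a \<in> I" and s: "0 \<le> s" and A: "A \<in> sets (natural_filt (space M) X (ennreal s))"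
  shows "(\<integral>\<^sup>+\<omega>. reach_ext a (X s \<omega>) * indicator A \<omega> \<partial>P x) =
    emeasure (P x) (A \<inter> {\<omega> \<in> fall a s. X s \<omega> \<in> {\<alpha><..<ereal \<beta>}})"
proof -
  interpret F: filtration "space M" "natural_filt (space M) X" by (rule filtration_natural_filt)
  have T: "stopping_time (natural_filt (space M) X) (\<lambda>_. ennreal s)" by (rule stopping_time_const)
  have AM: "A \<subseteq> space M" using sets.sets_into_space[OF A] by (simp add: space_natural_filt)
  have "A \<in> sets (F.pre_sigma (\<lambda>_. ennreal s))"
  proof (rule F.sets_pre_sigmaI[OF T])
    fix t show "{\<omega> \<in> A. ennreal s \<le> t} \<in> sets (natural_filt (space M) X t)"
      using A F.sets_F_mono[of "ennreal s" t] by (cases "ennreal s \<le> t") auto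
  qed
  note M = strong_Markov[OF x T this fall_paths_measurable[of a]]
  have st: "stopped_at X (\<lambda>_. ennreal s) \<omega> = X s \<omega>" for \<omega> using s by (simp add: stopped_at_def)
  have "(\<integral>\<^sup>+\<omega>. reach_ext a (X s \<omega>) * indicator A \<omega> \<partial>P x) =
    (\<integral>\<^sup>+\<omega>. emeasure (P (real_of_ereal (stopped_at X (\<lambda>_. ennreal s) \<omega>))) {\<omega>' \<in> space M. path_from X 0 \<omega>' \<in> fall_paths a} *
             indicator {\<omega> \<in> A. ennreal s < \<infinity> \<and> stopped_at X (\<lambda>_. ennreal s) \<omega> \<in> {\<alpha><..<ereal \<beta>}} \<omega> \<partial>P x)"
  proof (intro nn_integral_cong)
    fix \<omega>
    have eq: "{\<omega>' \<in> space M. path_from X 0 \<omega>' \<in> fall_paths a} = fall a 0"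
      using path_from_fall_paths[of _ 0 a] by (auto simp: fall_def)
    show "reach_ext a (X s \<omega>) * indicator A \<omega> = emeasure (P (real_of_ereal (stopped_at X (\<lambda>_. ennreal s) \<omega>))) {\<omega>' \<in> space M. path_from X 0 \<omega>' \<in> fall_paths a} *
             indicator {\<omega> \<in> A. ennreal s < \<infinity> \<and> stopped_at X (\<lambda>_. ennreal s) \<omega> \<in> {\<alpha><..<ereal \<beta>}} \<omega>"
      unfolding eq st using real_in_I[of "X s \<omega>"] emeasure_fall[OF a, of "real_of_ereal (X s \<omega>)"]
      by (cases "X s \<omega> \<in> {\<alpha><..<ereal \<beta>}") (auto simp: reach_ext_def indicator_def)
  qed
  also have "\<dots> = emeasure (P x) {\<omega> \<in> A. ennreal s < \<infinity> \<and> stopped_at X (\<lambda>_. ennreal s) \<omega> \<in> {\<alpha><..<ereal \<beta>} \<and>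
                             path_from X (enn2real (ennreal s)) \<omega> \<in> fall_paths a}"
    by (rule M[symmetric])
  also have "{\<omega> \<in> A. ennreal s < \<infinity> \<and> stopped_at X (\<lambda>_. ennreal s) \<omega> \<in> {\<alpha><..<ereal \<beta>} \<and>
                             path_from X (enn2real (ennreal s)) \<omega> \<in> fall_paths a} =
     A \<inter> {\<omega> \<in> fall a s. X s \<omega> \<in> {\<alpha><..<ereal \<beta>}}"
    unfolding st using s AM path_from_fall_paths[OF _ s, of _ a] by (auto simp: fall_def)
  finally show ?thesis .
qed

section \<open>From the natural to the randomized filtration\<close>

text \<open>\<open>U_indep\<close> speaks of events; the product formula extends to nonnegative
  functions by linearity and monotone limits.\<close>

lemma nn_integral_indep:
  assumes x: "x \<in> I" and C: "C \<in> sets borel" and f: "f \<in> borel_measurable (natural_filt (space M) X \<infinity>)"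
  shows "(\<integral>\<^sup>+\<omega>. f \<omega> * indicator (U -` C \<inter> space M) \<omega> \<partial>P x) =
    emeasure (P x) (U -` C \<inter> space M) * (\<integral>\<^sup>+\<omega>. f \<omega> \<partial>P x)"
proof -
  interpret prob_space "P x" by (rule prob_space_P[OF x])
  define A where "A = U -` C \<inter> space M"
  define N where "N = natural_filt (space M) X \<infinity>"
  have A: "A \<in> events" unfolding A_def sets_P[OF x] by (rule measurable_sets[OF U_measurable C])
  have NP: "g \<in> borel_measurable (P x)" if "g \<in> borel_measurable N" for g :: "'a \<Rightarrow> ennreal"
    unfolding measurable_cong_sets[OF sets_P[OF x] refl]
    by (rule measurable_natural_M[OF that[unfolded N_def]])
  show ?thesis unfolding A_def[symmetric] using f unfolding N_def[symmetric]
  proof (induction rule: borel_measurable_induct)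
    case (cong f g)
    then have eq: "f \<omega> = g \<omega>" if "\<omega> \<in> space (P x)" for \<omega>
      using that by (simp add: N_def space_natural_filt space_P[OF x])
    have "(\<integral>\<^sup>+\<omega>. f \<omega> * indicator A \<omega> \<partial>P x) = (\<integral>\<^sup>+\<omega>. g \<omega> * indicator A \<omega> \<partial>P x)"
      "(\<integral>\<^sup>+\<omega>. f \<omega> \<partial>P x) = (\<integral>\<^sup>+\<omega>. g \<omega> \<partial>P x)"
      by (rule nn_integral_cong; simp add: eq)+
    then show ?case using cong(4) by simp
  next
    case (set B)
    then have B: "B \<in> events" using sets_natural_le by (auto simp: sets_P[OF x] N_def)
    have "prob (A \<inter> B) = prob A * prob B"
      using indep_setD[OF U_indep[OF x], of A B] set C by (auto simp: A_def N_def)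
    then have "emeasure (P x) (A \<inter> B) = emeasure (P x) A * emeasure (P x) B"
      by (simp add: emeasure_eq_measure ennreal_mult)
    then show ?case using A B
      by (simp add: indicator_inter_arith[symmetric] Int_commute)
  next
    case (mult u c)
    then show ?case using A NP[OF mult(2)]
      by (simp add: mult.assoc nn_integral_cmult mult.left_commute)
  next
    case (add u v)
    then show ?case using A NP[OF add(1)] NP[OF add(3)]
      by (simp add: distrib_right nn_integral_add distrib_left)
  next
    case (seq V)
    have *: "(\<lambda>\<omega>. (SUP i. V i) \<omega> * indicator A \<omega>) = (\<lambda>\<omega>. SUP i. V i \<omega> * indicator A \<omega>)"
      by (simp add: SUP_mult_right_ennreal image_comp)
    have inc: "incseq (\<lambda>i \<omega>. V i \<omega> * indicator A \<omega>)" using \<open>incseq V\<close>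
      by (auto simp: incseq_def le_fun_def intro!: mult_right_mono)
    have "(\<integral>\<^sup>+\<omega>. (SUP i. V i) \<omega> * indicator A \<omega> \<partial>P x) = (SUP i. \<integral>\<^sup>+\<omega>. V i \<omega> * indicator A \<omega> \<partial>P x)"
      unfolding * using A NP[OF seq(1)] by (intro nn_integral_monotone_convergence_SUP inc) auto
    also have "\<dots> = (SUP i. emeasure (P x) A * (\<integral>\<^sup>+\<omega>. V i \<omega> \<partial>P x))" using seq by simp
    also have "\<dots> = emeasure (P x) A * (SUP i. \<integral>\<^sup>+\<omega>. V i \<omega> \<partial>P x)" by (simp add: SUP_mult_left_ennreal)
    also have "(SUP i. \<integral>\<^sup>+\<omega>. V i \<omega> \<partial>P x) = (\<integral>\<^sup>+\<omega>. (SUP i. V i) \<omega> \<partial>P x)"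
      using NP[OF seq(1)] \<open>incseq V\<close> by (simp add: nn_integral_monotone_convergence_SUP image_comp)
    finally show ?case .
  qed
qed

text \<open>\<open>strong_Markov\<close> covers only events of X. Both sides are measures in A that
  agree, by independence, on intersections of an event of U with an event of the past of X. These
  are stable under intersection and generate the randomized filtration.\<close>

lemma randomized_Markov_fall:
  assumes x: "x \<in> I" and a: "a \<in> I" and s: "0 \<le> s" and A: "A \<in> sets (randomized_filt (space M) U X (ennreal s))"
  shows "(\<integral>\<^sup>+\<omega>. reach_ext a (X s \<omega>) * indicator A \<omega> \<partial>P x) =
    emeasure (P x) (A \<inter> {\<omega> \<in> fall a s. X s \<omega> \<in> {\<alpha><..<ereal \<beta>}})"
proof -
  interpret prob_space "P x" by (rule prob_space_P[OF x])
  define D where "D = {\<omega> \<in> fall a s. X s \<omega> \<in> {\<alpha><..<ereal \<beta>}}"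
  have XN: "X s \<in> borel_measurable (natural_filt (space M) X \<infinity>)" by (rule measurable_natural_filt[OF s]) simp
  have "D = fall a s \<inter> (X s -` {\<alpha><..<ereal \<beta>} \<inter> space (natural_filt (space M) X \<infinity>))"
    by (auto simp: D_def fall_def space_natural_filt)
  then have DN: "D \<in> sets (natural_filt (space M) X \<infinity>)"
    using fall_measurable[OF s] measurable_sets[OF XN] by auto
  have D: "D \<in> events" using DN sets_natural_le by (auto simp: sets_P[OF x])
  have XP: "X s \<in> borel_measurable (P x)"
    using X_measurable[OF s] by (simp add: measurable_cong_sets[OF sets_P[OF x] refl])
  define m1 where "m1 = density (P x) (\<lambda>\<omega>. reach_ext a (X s \<omega>))"
  define m2 where "m2 = density (P x) (indicator D)"
  have rm: "(\<lambda>\<omega>. reach_ext a (X s \<omega>)) \<in> borel_measurable (P x)"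
    using measurable_compose[OF XP reach_ext_measurable[OF a]] .
  have m1: "emeasure m1 B = (\<integral>\<^sup>+\<omega>. reach_ext a (X s \<omega>) * indicator B \<omega> \<partial>P x)" if "B \<in> events" for B
    unfolding m1_def using rm that by (rule emeasure_density)
  have m2: "emeasure m2 B = emeasure (P x) (B \<inter> D)" if "B \<in> events" for B
    unfolding m2_def using D that by (subst emeasure_density) (auto simp: indicator_inter_arith[symmetric] Int_commute)
  define E where "E = {(U -` C \<inter> space M) \<inter> B | C B. C \<in> sets borel \<and> B \<in> sets (natural_filt (space M) X (ennreal s))}"
  have NM: "sets (natural_filt (space M) X (ennreal s)) \<subseteq> events" using sets_natural_le by (simp add: sets_P[OF x])
  have Ev: "E \<subseteq> events" unfolding E_def using NM measurable_sets[OF U_measurable] by (auto simp: sets_P[OF x])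
  have spN: "space M \<in> sets (natural_filt (space M) X t)" for t
    using sets.top[of "natural_filt (space M) X t"] by (simp add: space_natural_filt)
  have sub: "sets (randomized_filt (space M) U X (ennreal s)) \<subseteq> sigma_sets (space M) E"
    unfolding sets_randomized_filt
  proof (rule sigma_sets_mono', rule Un_least)
    show "{U -` A \<inter> space M |A. A \<in> sets borel} \<subseteq> E"
    proof
      fix B assume "B \<in> {U -` A \<inter> space M |A. A \<in> sets borel}"
      then obtain C where "C \<in> sets borel" "B = (U -` C \<inter> space M) \<inter> space M" by auto
      then show "B \<in> E" unfolding E_def using spN[of "ennreal s"] by blast
    qed
    show "{X s' -` A \<inter> space M |s' A. 0 \<le> s' \<and> ennreal s' \<le> ennreal s \<and> A \<in> sets borel} \<subseteq> E"
    proof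
      fix B assume "B \<in> {X s' -` A \<inter> space M |s' A. 0 \<le> s' \<and> ennreal s' \<le> ennreal s \<and> A \<in> sets borel}"
      then have B: "B \<in> sets (natural_filt (space M) X (ennreal s))"
        unfolding sets_natural_filt by (rule sigma_sets.Basic)
      have "B \<subseteq> space M" using sets.sets_into_space[OF B] unfolding space_natural_filt .
      then have "B = (U -` UNIV \<inter> space M) \<inter> B" by blast
      moreover have "UNIV \<in> sets (borel :: real measure)" by simp
      ultimately show "B \<in> E" unfolding E_def using B by blast
    qed
  qed
  have istable: "Int_stable E"
  proof (rule Int_stableI)
    fix B B' assume "B \<in> E" "B' \<in> E"
    then obtain C1 B1 C2 B2 where *: "B = (U -` C1 \<inter> space M) \<inter> B1" "B' = (U -` C2 \<inter> space M) \<inter> B2"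
      "C1 \<in> sets borel" "C2 \<in> sets borel" "B1 \<in> sets (natural_filt (space M) X (ennreal s))"
      "B2 \<in> sets (natural_filt (space M) X (ennreal s))" unfolding E_def by blast
    then have "B \<inter> B' = (U -` (C1 \<inter> C2) \<inter> space M) \<inter> (B1 \<inter> B2)" by auto
    then show "B \<inter> B' \<in> E" unfolding E_def using * by blast
  qed
  have base: "emeasure m1 B = emeasure m2 B" if BE: "B \<in> E" for B
  proof -
    obtain C B' where B: "B = (U -` C \<inter> space M) \<inter> B'" and C: "C \<in> sets borel"
      and B': "B' \<in> sets (natural_filt (space M) X (ennreal s))" using BE unfolding E_def mem_Collect_eq by (elim exE conjE)
    have Bi: "B' \<in> sets (natural_filt (space M) X \<infinity>)"
      by (rule subsetD[OF filtration.sets_F_mono[OF filtration_natural_filt] B']) simp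
    have "emeasure m1 B = (\<integral>\<^sup>+\<omega>. (reach_ext a (X s \<omega>) * indicator B' \<omega>) * indicator (U -` C \<inter> space M) \<omega> \<partial>P x)"
      unfolding m1[OF subsetD[OF Ev BE]] by (rule nn_integral_cong) (auto simp: B indicator_def)
    also have "\<dots> = emeasure (P x) (U -` C \<inter> space M) * (\<integral>\<^sup>+\<omega>. reach_ext a (X s \<omega>) * indicator B' \<omega> \<partial>P x)"
      using Bi measurable_compose[OF XN reach_ext_measurable[OF a]] by (intro nn_integral_indep[OF x C]) auto
    also have "(\<integral>\<^sup>+\<omega>. reach_ext a (X s \<omega>) * indicator B' \<omega> \<partial>P x) = (\<integral>\<^sup>+\<omega>. indicator (B' \<inter> D) \<omega> \<partial>P x)"
      unfolding Markov_fall[OF x a s B', folded D_def] using D B' NM by (subst nn_integral_indicator) auto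
    also have "emeasure (P x) (U -` C \<inter> space M) * \<dots> =
        (\<integral>\<^sup>+\<omega>. indicator (B' \<inter> D) \<omega> * indicator (U -` C \<inter> space M) \<omega> \<partial>P x)"
      using Bi DN by (intro nn_integral_indep[OF x C, symmetric]) auto
    also have "\<dots> = (\<integral>\<^sup>+\<omega>. indicator (B \<inter> D) \<omega> \<partial>P x)"
      by (auto simp: B indicator_def intro!: nn_integral_cong)
    also have "\<dots> = emeasure m2 B" unfolding m2[OF subsetD[OF Ev BE]] using subsetD[OF Ev BE] D by simp
    finally show ?thesis .
  qed
  have spE: "space M \<in> E"
  proof -
    have "space M = (U -` UNIV \<inter> space M) \<inter> space M" "UNIV \<in> sets (borel :: real measure)" by simp_all
    then show ?thesis unfolding E_def using spN[of "ennreal s"] by blast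
  qed
  have EM: "E \<subseteq> Pow (space M)"
    using Ev sets.space_closed[of "P x"] unfolding space_P[OF x] by (rule order_trans)
  have sm: "sigma_sets (space M) E \<subseteq> events"
    using sets.sigma_sets_subset[of E "P x"] Ev by (simp add: space_P[OF x])
  have fin: "emeasure m2 (space M) \<noteq> \<infinity>"
    using m2[of "space M"] sets.top[of "P x"] by (simp add: space_P[OF x])
  have "emeasure m1 A = emeasure m2 A"
    using istable EM subsetD[OF sub A]
  proof (induction rule: sigma_sets_induct_disjoint)
    case (basic B) then show ?case by (rule base)
  next
    case empty then show ?case by simp
  next
    case (compl B)
    have B: "B \<in> events" "B \<subseteq> space M" "space M \<in> events"
      using compl(1) sm sets.sets_into_space[of B "P x"] sets.top[of "P x"] by (auto simp: space_P[OF x])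
    \<comment> \<open>Needed for subtraction; \<open>m2\<close> is dominated by a probability and
      \<open>m1\<close> agrees with it on B by induction.\<close>
    have "emeasure m1 B \<noteq> \<infinity>" "emeasure m2 B \<noteq> \<infinity>"
      using compl(2) fin emeasure_mono[of B "space M" m2] B by (auto simp: m2_def top_unique)
    then show ?case using compl(2) base[OF spE] B
      by (subst (1 2) emeasure_Diff) (auto simp: m1_def m2_def)
  next
    case (union B)
    have "range B \<subseteq> events" using union(2) sm by auto
    then have "emeasure m1 (\<Union>i. B i) = (\<Sum>i. emeasure m1 (B i))" "emeasure m2 (\<Union>i. B i) = (\<Sum>i. emeasure m2 (B i))"
      using union(1) by (auto intro!: suminf_emeasure[symmetric] simp: m1_def m2_def)
    then show ?case using union(3) by simp
  qed
  moreover have "A \<in> events" using A sub sm by auto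
  ultimately show ?thesis using m1 m2 by (simp add: D_def)
qed

section \<open>The left end is not reached, the right end is approached\<close>

text \<open>Choosing points by the size of their gap controls both their position, since the gap
  decreases, and the probability \<open>gap x / gap (a n)\<close> of reaching them.\<close>

lemma left_sequence:
  assumes x: "x \<in> I"
  obtains a :: "nat \<Rightarrow> real" where "\<And>n. a n \<in> I" "\<And>n. a n < x" "\<And>n. real n < gap (a n)"
    "\<And>z. z \<in> I \<Longrightarrow> eventually (\<lambda>n. a n < z) sequentially"
proof -
  have "\<forall>n. \<exists>a\<in>I. max (real n) (gap x) < gap a" using gap_unbounded by blast
  then obtain a where a: "\<And>n. a n \<in> I" "\<And>n. max (real n) (gap x) < gap (a n)" by metis
  have less: "y < z" if "y \<in> I" "z \<in> I" "gap z < gap y" for y z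
    using gap_le[OF that(2,1)] that(3) by (cases "y < z") auto
  show thesis
  proof (rule that[of a])
    show "a n \<in> I" for n by (rule a(1))
    show "a n < x" for n using less[OF a(1) x] a(2)[of n] by simp
    show "real n < gap (a n)" for n using a(2)[of n] by simp
    show "eventually (\<lambda>n. a n < z) sequentially" if z: "z \<in> I" for z
    proof -
      obtain N :: nat where "gap z \<le> real N" using real_arch_simple by blast
      then have "a n < z" if "N \<le> n" for n using less[OF a(1) z] a(2)[of n] that by simp
      then show ?thesis by (auto simp: eventually_sequentially)
    qed
  qed
qed

text \<open>Falling to all \<open>a n\<close> has probability at most \<open>gap x / n\<close> for
  every positive n. So almost surely some \<open>a n\<close> is never reached, and the dichotomy
  leaves only convergence of the limit superior to \<beta>.\<close>

lemma AE_right_end: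
  assumes x: "x \<in> I"
  shows "AE \<omega> in P x. Limsup at_top (\<lambda>t. X t \<omega>) = ereal \<beta> \<and> (\<forall>t\<ge>0. \<alpha> < X t \<omega>)"
proof -
  interpret prob_space "P x" by (rule prob_space_P[OF x])
  obtain a where a: "\<And>n. a n \<in> I" "\<And>n. a n < x" "\<And>n. real n < gap (a n)"
    using left_sequence[OF x] by metis
  define N where "N = (\<Inter>n. fall (a n) 0)"
  have fe: "fall (a n) 0 \<in> events" for n using fall_in_M by (simp add: sets_P[OF x])
  have N: "N \<in> events" unfolding N_def using fe by auto
  have "prob N \<le> gap x / real (Suc n)" for n
  proof -
    have "prob N \<le> prob (fall (a (Suc n)) 0)" using fe by (intro finite_measure_mono) (auto simp: N_def)
    also have "\<dots> = gap x / gap (a (Suc n))" by (rule prob_fall[OF a(1) x a(2)])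
    also have "\<dots> \<le> gap x / real (Suc n)"
      using a(3)[of "Suc n"] gap_pos[OF x] gap_pos[OF a(1)] by (intro divide_left_mono) auto
    finally show ?thesis .
  qed
  moreover have "(\<lambda>n. gap x / real (Suc n)) \<longlonglongrightarrow> 0"
    using LIMSEQ_ignore_initial_segment[OF lim_const_over_n, of "gap x" 1] by simp
  ultimately have "prob N \<le> 0" by (intro LIMSEQ_le_const) auto
  then have "prob N = 0" using measure_nonneg[of "P x" N] by linarith
  then have "AE \<omega> in P x. \<omega> \<notin> N" using N by (intro AE_not_in) (simp add: null_sets_def emeasure_eq_measure)
  moreover have "AE \<omega> in P x. \<forall>n. \<omega> \<notin> fall (a n) 0 \<longrightarrow> Limsup at_top (\<lambda>t. X t \<omega>) = ereal \<beta>"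
    unfolding AE_all_countable
  proof
    fix n show "AE \<omega> in P x. \<omega> \<notin> fall (a n) 0 \<longrightarrow> Limsup at_top (\<lambda>t. X t \<omega>) = ereal \<beta>"
      using AE_fall_dichotomy[OF a(1)[of n] x a(2)] by eventually_elim auto
  qed
  ultimately show ?thesis using AE_start[OF x]
  proof eventually_elim
    case (elim \<omega>)
    then obtain n where n: "\<omega> \<notin> fall (a n) 0" by (auto simp: N_def)
    have "\<alpha> < X t \<omega>" if "0 \<le> t" for t
    proof -
      have "\<not> X t \<omega> \<le> ereal (a n)" using n elim that unfolding fall_def by blast
      then have "ereal (a n) < X t \<omega>" by simp
      then show ?thesis using I_greater[OF a(1)] by (rule less_trans[rotated])
    qed
    then show ?case using elim n by blast
  qed
qed

lemma stopping_times_iff: "\<tau> \<in> stopping_times M U X \<longleftrightarrow> stopping_time (randomized_filt (space M) U X) \<tau>"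
  by (simp add: stopping_times_def)

lemma stopping_times_measurable: "\<tau> \<in> stopping_times M U X \<Longrightarrow> \<tau> \<in> borel_measurable M"
  unfolding stopping_times_iff by (rule measurable_stopping_time[OF _ sets_randomized_le space_randomized_filt])

lemma stopped_measurable: "\<tau> \<in> stopping_times M U X \<Longrightarrow> stopped_at X \<tau> \<in> borel_measurable M"
  by (rule measurable_stopped_at[OF X_measurable X_continuous stopping_times_measurable])

lemma AE_stopped_range:
  assumes x: "x \<in> I"
  shows "AE \<omega> in P x. \<alpha> < stopped_at X \<tau> \<omega> \<and> stopped_at X \<tau> \<omega> \<le> ereal \<beta> \<and>
    (\<tau> \<omega> = \<infinity> \<longrightarrow> stopped_at X \<tau> \<omega> = ereal \<beta>)"
  using AE_right_end[OF x] AE_start[OF x]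
proof eventually_elim
  case (elim \<omega>)
  then show ?case using X_range[of "enn2real (\<tau> \<omega>)" \<omega>] endpoints by (auto simp: stopped_at_def)
qed

text \<open>Round \<tau> up to a grid. On the event of index k, known at its grid time, the Markov
  property replaces the integrand by a fall after that time. The events are disjoint, and a fall
  after any time is a fall after 0, of probability \<open>reach a x\<close>. Fatou handles
  refinement of the grid.\<close>

lemma integral_reach_stopped_le:
  assumes x: "x \<in> I" and a: "a \<in> I" and \<tau>: "\<tau> \<in> stopping_times M U X"
  shows "(\<integral>\<^sup>+\<omega>. reach_ext a (stopped_at X \<tau> \<omega>) \<partial>P x) \<le> ennreal (reach a x)"
proof -
  interpret prob_space "P x" by (rule prob_space_P[OF x])
  interpret F: filtration "space M" "randomized_filt (space M) U X" by (rule filtration_randomized_filt)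
  have \<tau>': "stopping_time (randomized_filt (space M) U X) \<tau>" using \<tau> by (simp add: stopping_times_iff)
  \<comment> \<open>Without \<open>\<tau> \<omega> < \<infinity>\<close> the default index of
    \<infinity> would put paths that never stop into \<open>A n 0\<close>.\<close>
  define A where "A n k = {\<omega> \<in> space M. \<tau> \<omega> < \<infinity> \<and> grid_index n (\<tau> \<omega>) = k}" for n k
  define s where "s n k = real k / real (Suc n)" for n k :: nat
  have s0: "0 \<le> s n k" for n k by (simp add: s_def)
  have le: "{\<omega> \<in> space M. \<tau> \<omega> \<le> ennreal (s n k)} \<in> sets (randomized_filt (space M) U X (ennreal (s n l)))"
    if "k \<le> l" for n k l
  proof -
    have "s n k \<le> s n l" unfolding s_def using that by (intro divide_right_mono) auto
    then show ?thesis
      using F.stopping_time_le_const[OF \<tau>', of "ennreal (s n k)" "ennreal (s n l)"]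
      by (simp add: pred_def space_randomized_filt ennreal_leI)
  qed
  have *: "\<tau> \<omega> \<le> ennreal (s n j) \<longleftrightarrow> \<tau> \<omega> < \<infinity> \<and> grid_index n (\<tau> \<omega>) \<le> j" for \<omega> n j
  proof -
    have "\<tau> \<omega> < \<infinity>" if "\<tau> \<omega> \<le> ennreal (s n j)" using le_less_trans[OF that ennreal_less_top] by simp
    then show ?thesis using grid_index_le_iff[of "\<tau> \<omega>" n j] unfolding s_def by blast
  qed
  have A: "A n k \<in> sets (randomized_filt (space M) U X (ennreal (s n k)))" for n k
  proof (cases k)
    case 0
    have "A n k = {\<omega> \<in> space M. \<tau> \<omega> \<le> ennreal (s n k)}"
      unfolding A_def * using 0 by simp
    then show ?thesis using le[of k k n] by simp
  next
    case (Suc l)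
    have "A n k = {\<omega> \<in> space M. \<tau> \<omega> \<le> ennreal (s n k)} - {\<omega> \<in> space M. \<tau> \<omega> \<le> ennreal (s n l)}"
      unfolding A_def * using Suc by auto
    then show ?thesis using le[of k k n] le[of l k n] Suc by auto
  qed
  have AP: "A n k \<in> events" for n k using A sets_randomized_le by (auto simp: sets_P[OF x])
  have disj: "disjoint_family (A n)" for n by (auto simp: disjoint_family_on_def A_def)
  have XP: "X t \<in> borel_measurable (P x)" if "0 \<le> t" for t
    using X_measurable[OF that] unfolding measurable_cong_sets[OF sets_P[OF x] refl] .
  define f where "f n \<omega> = (\<Sum>k. reach_ext a (X (s n k) \<omega>) * indicator (A n k) \<omega>)" for n \<omega>
  have fm: "(\<lambda>\<omega>. reach_ext a (X (s n k) \<omega>) * indicator (A n k) \<omega>) \<in> borel_measurable (P x)" for n k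
    using measurable_compose[OF XP[OF s0] reach_ext_measurable[OF a]] AP by auto
  have f_int: "(\<integral>\<^sup>+\<omega>. f n \<omega> \<partial>P x) \<le> ennreal (reach a x)" for n
  proof -
    have "(\<integral>\<^sup>+\<omega>. f n \<omega> \<partial>P x) = (\<Sum>k. \<integral>\<^sup>+\<omega>. reach_ext a (X (s n k) \<omega>) * indicator (A n k) \<omega> \<partial>P x)"
      unfolding f_def using fm by (intro nn_integral_suminf)
    also have "\<dots> \<le> (\<Sum>k. emeasure (P x) (A n k \<inter> fall a 0))"
    proof (intro suminf_le summableI)
      fix k
      show "(\<integral>\<^sup>+\<omega>. reach_ext a (X (s n k) \<omega>) * indicator (A n k) \<omega> \<partial>P x) \<le> emeasure (P x) (A n k \<inter> fall a 0)"
        unfolding randomized_Markov_fall[OF x a s0 A]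
        using fall_antimono[OF s0[of n k]] AP fall_in_M
        by (intro emeasure_mono) (auto simp: sets_P[OF x])
    qed
    also have "\<dots> = emeasure (P x) (\<Union>k. A n k \<inter> fall a 0)"
      using disj[of n] AP fall_in_M
      by (intro suminf_emeasure) (auto simp: sets_P[OF x] disjoint_family_on_def)
    also have "\<dots> \<le> emeasure (P x) (fall a 0)"
      using fall_in_M by (intro emeasure_mono) (auto simp: sets_P[OF x])
    finally show ?thesis by (simp add: emeasure_fall[OF a x])
  qed
  have f_eq: "f n \<omega> = reach_ext a (X (s n (grid_index n (\<tau> \<omega>))) \<omega>)" if "\<tau> \<omega> < \<infinity>" "\<omega> \<in> space M" for n \<omega>
    unfolding f_def by (rule suminf_cmult_indicator[OF disj]) (use that in \<open>simp_all add: A_def\<close>)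
  have "(\<integral>\<^sup>+\<omega>. reach_ext a (stopped_at X \<tau> \<omega>) \<partial>P x) \<le> (\<integral>\<^sup>+\<omega>. liminf (\<lambda>n. f n \<omega>) \<partial>P x)"
  proof (rule nn_integral_mono_AE)
    show "AE \<omega> in P x. reach_ext a (stopped_at X \<tau> \<omega>) \<le> liminf (\<lambda>n. f n \<omega>)"
      using AE_stopped_range[OF x, of \<tau>] AE_start[OF x]
    proof eventually_elim
      case (elim \<omega>)
      show ?case
      proof (cases "\<tau> \<omega> < \<infinity> \<and> stopped_at X \<tau> \<omega> \<in> {\<alpha><..<ereal \<beta>}")
        case True
        have st: "stopped_at X \<tau> \<omega> = X (enn2real (\<tau> \<omega>)) \<omega>" using True by (auto simp: stopped_at_def)
        have "(\<lambda>n. reach_ext a (X (s n (grid_index n (\<tau> \<omega>))) \<omega>)) \<longlonglongrightarrow> reach_ext a (X (enn2real (\<tau> \<omega>)) \<omega>)"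
          using True unfolding st s_def
          by (intro reach_ext_tendsto[OF a] path_grid_tendsto X_continuous) (use elim in auto)
        then have "(\<lambda>n. f n \<omega>) \<longlonglongrightarrow> reach_ext a (stopped_at X \<tau> \<omega>)"
          using True elim by (simp add: f_eq st)
        then show ?thesis by (simp add: lim_imp_Liminf)
      next
        case False
        \<comment> \<open>An infinite time gives the value \<beta> almost surely, and there
          \<open>reach_ext\<close> vanishes.\<close>
        then have "stopped_at X \<tau> \<omega> \<notin> {\<alpha><..<ereal \<beta>}" using elim by (auto simp: less_top)
        then show ?thesis by (simp only: reach_ext_def if_False zero_le)
      qed
    qed
  qed
  also have "\<dots> \<le> liminf (\<lambda>n. \<integral>\<^sup>+\<omega>. f n \<omega> \<partial>P x)"
    unfolding f_def using fm by (intro nn_integral_liminf borel_measurable_suminf_order)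
  also have "\<dots> \<le> ennreal (reach a x)"
    using f_int by (intro order_trans[OF Liminf_le_Limsup] Limsup_bounded) auto
  finally show ?thesis .
qed

definition gap_ext :: "ereal \<Rightarrow> ennreal" where
  "gap_ext z = (if z \<in> {\<alpha><..<ereal \<beta>} then ennreal (gap (real_of_ereal z)) else 0)"

text \<open>Once \<open>a n\<close> is below an interior z, the truncation in \<open>reach\<close>
  is inactive and the product equals the gap.\<close>

lemma gap_ext_liminf:
  assumes "\<And>n. a n \<in> I" "\<And>z. z \<in> I \<Longrightarrow> eventually (\<lambda>n. a n < z) sequentially"
  shows "gap_ext z \<le> liminf (\<lambda>n. ennreal (gap (a n)) * reach_ext (a n) z)"
proof (cases "z \<in> {\<alpha><..<ereal \<beta>}")
  case True
  have zI: "real_of_ereal z \<in> I" using real_in_I[OF True] by simp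
  have "eventually (\<lambda>n. ennreal (gap (a n)) * reach_ext (a n) z = gap_ext z) sequentially"
    using assms(2)[OF zI]
  proof eventually_elim
    case (elim n)
    have "gap (real_of_ereal z) \<le> gap (a n)" using gap_le[OF assms(1) zI] elim by simp
    then have "reach (a n) (real_of_ereal z) = gap (real_of_ereal z) / gap (a n)"
      using gap_pos[OF assms(1), of n] by (simp add: reach_def min_def)
    then show ?case using True gap_pos[OF assms(1), of n] gap_pos[OF zI]
      by (simp add: reach_ext_def gap_ext_def flip: ennreal_mult)
  qed
  then have "(\<lambda>n. ennreal (gap (a n)) * reach_ext (a n) z) \<longlonglongrightarrow> gap_ext z"
    by (rule tendsto_eventually)
  then show ?thesis by (simp add: lim_imp_Liminf)
next
  case False
  then show ?thesis by (simp only: gap_ext_def if_False zero_le)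
qed

text \<open>Multiplying the bound for \<open>reach\<close> by \<open>gap (a n)\<close> cancels its
  denominator; Fatou then lets the points tend to \<alpha>.\<close>

lemma integral_gap_stopped_le:
  assumes x: "x \<in> I" and \<tau>: "\<tau> \<in> stopping_times M U X"
  shows "(\<integral>\<^sup>+\<omega>. gap_ext (stopped_at X \<tau> \<omega>) \<partial>P x) \<le> ennreal (gap x)"
proof -
  obtain a where a: "\<And>n. a n \<in> I" "\<And>n. a n < x"
    "\<And>z. z \<in> I \<Longrightarrow> eventually (\<lambda>n. a n < z) sequentially" using left_sequence[OF x] by metis
  have m: "(\<lambda>\<omega>. reach_ext (a n) (stopped_at X \<tau> \<omega>)) \<in> borel_measurable (P x)" for n
    unfolding measurable_cong_sets[OF sets_P[OF x] refl]
    by (rule measurable_compose[OF stopped_measurable[OF \<tau>] reach_ext_measurable[OF a(1)]])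
  have "(\<integral>\<^sup>+\<omega>. gap_ext (stopped_at X \<tau> \<omega>) \<partial>P x) \<le>
      (\<integral>\<^sup>+\<omega>. liminf (\<lambda>n. ennreal (gap (a n)) * reach_ext (a n) (stopped_at X \<tau> \<omega>)) \<partial>P x)"
    by (intro nn_integral_mono gap_ext_liminf a)
  also have "\<dots> \<le> liminf (\<lambda>n. \<integral>\<^sup>+\<omega>. ennreal (gap (a n)) * reach_ext (a n) (stopped_at X \<tau> \<omega>) \<partial>P x)"
    using m by (intro nn_integral_liminf) auto
  also have "\<dots> \<le> ennreal (gap x)"
  proof (intro order_trans[OF Liminf_le_Limsup] Limsup_bounded always_eventually allI)
    fix n
    have "(\<integral>\<^sup>+\<omega>. ennreal (gap (a n)) * reach_ext (a n) (stopped_at X \<tau> \<omega>) \<partial>P x) =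
        ennreal (gap (a n)) * (\<integral>\<^sup>+\<omega>. reach_ext (a n) (stopped_at X \<tau> \<omega>) \<partial>P x)"
      using m by (rule nn_integral_cmult)
    also have "\<dots> \<le> ennreal (gap (a n)) * ennreal (reach (a n) x)"
      by (intro mult_left_mono integral_reach_stopped_le[OF x a(1) \<tau>]) simp
    also have "\<dots> = ennreal (gap (a n) * reach (a n) x)"
      using gap_pos[OF a(1), of n] by (intro ennreal_mult'[symmetric]) auto
    also have "\<dots> \<le> ennreal (gap x)"
    proof (rule ennreal_leI)
      have "gap (a n) * reach (a n) x \<le> gap (a n) * (gap x / gap (a n))"
        unfolding reach_def using gap_pos[OF a(1), of n] by (intro mult_left_mono) auto
      then show "gap (a n) * reach (a n) x \<le> gap x" using gap_pos[OF a(1), of n] by simp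
    qed
    finally show "(\<integral>\<^sup>+\<omega>. ennreal (gap (a n)) * reach_ext (a n) (stopped_at X \<tau> \<omega>) \<partial>P x) \<le> ennreal (gap x)" .
  qed simp
  finally show ?thesis .
qed

end

section \<open>Variance of stopped values\<close>

text \<open>The difference of the two sides is \<open>(E Z - c)^2\<close>. The finiteness assumption
  makes Z integrable, so its Bochner integral is a true mean and not the default 0.\<close>

lemma (in prob_space) variance_le_second_moment:
  fixes Z :: "'a \<Rightarrow> real"
  assumes Z[measurable]: "Z \<in> borel_measurable M"
    and fin: "(\<integral>\<^sup>+\<omega>. ennreal ((Z \<omega> - c)\<^sup>2) \<partial>M) < \<infinity>"
  shows "(\<integral>\<^sup>+\<omega>. ennreal ((Z \<omega> - (\<integral>\<omega>. Z \<omega> \<partial>M))\<^sup>2) \<partial>M) \<le> (\<integral>\<^sup>+\<omega>. ennreal ((Z \<omega> - c)\<^sup>2) \<partial>M)"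
proof -
  have sq: "integrable M (\<lambda>\<omega>. (Z \<omega> - c)\<^sup>2)" using fin by (intro integrableI_nonneg) auto
  have lin: "integrable M (\<lambda>\<omega>. Z \<omega> - c)"
  proof (rule Bochner_Integration.integrable_bound[of M "\<lambda>\<omega>. 1 + (Z \<omega> - c)\<^sup>2"])
    have "\<bar>u\<bar> \<le> 1 + u\<^sup>2" for u :: real
      using zero_le_power2[of "\<bar>u\<bar> - 1"] by (simp add: power2_diff)
    then show "AE \<omega> in M. norm (Z \<omega> - c) \<le> norm (1 + (Z \<omega> - c)\<^sup>2)" by auto
  qed (use sq in auto)
  have "integrable M (\<lambda>\<omega>. (Z \<omega> - c) + c)" using lin by (intro Bochner_Integration.integrable_add) auto
  then have Zi: "integrable M Z" by simp
  define \<mu> where "\<mu> = (\<integral>\<omega>. Z \<omega> \<partial>M)"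
  have lin_int: "(\<integral>\<omega>. (Z \<omega> - c) \<partial>M) = \<mu> - c"
    using Zi by (simp add: \<mu>_def prob_space)
  have eq: "(Z \<omega> - \<mu>)\<^sup>2 = (Z \<omega> - c)\<^sup>2 - 2 * (\<mu> - c) * (Z \<omega> - c) + (\<mu> - c)\<^sup>2" for \<omega>
    by (simp add: power2_eq_square algebra_simps)
  have int: "integrable M (\<lambda>\<omega>. (Z \<omega> - \<mu>)\<^sup>2)" unfolding eq using sq lin by auto
  have "(\<integral>\<omega>. (Z \<omega> - \<mu>)\<^sup>2 \<partial>M) = (\<integral>\<omega>. (Z \<omega> - c)\<^sup>2 \<partial>M) - (\<mu> - c)\<^sup>2"
  proof -
    have "(\<integral>\<omega>. (Z \<omega> - \<mu>)\<^sup>2 \<partial>M) = (\<integral>\<omega>. (Z \<omega> - c)\<^sup>2 \<partial>M) - 2 * (\<mu> - c) * (\<integral>\<omega>. (Z \<omega> - c) \<partial>M) + (\<mu> - c)\<^sup>2"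
      unfolding eq using sq lin by (simp add: prob_space del: Bochner_Integration.integral_diff[of M Z])
    then show ?thesis unfolding lin_int by (simp add: power2_eq_square)
  qed
  then have "(\<integral>\<omega>. (Z \<omega> - \<mu>)\<^sup>2 \<partial>M) \<le> (\<integral>\<omega>. (Z \<omega> - c)\<^sup>2 \<partial>M)" by simp
  then show ?thesis
    using nn_integral_eq_integral[OF int] nn_integral_eq_integral[OF sq]
    by (simp add: \<mu>_def ennreal_leI)
qed

context attractive_right_end begin

lemma variance_at_eq:
  assumes x: "x \<in> I"
  shows "variance_at (P x) X \<tau> = (\<integral>\<^sup>+\<omega>. ennreal ((real_of_ereal (stopped_at X \<tau> \<omega>) - mean_at (P x) X \<tau>)\<^sup>2) \<partial>P x)"
  unfolding variance_at_def
proof (rule nn_integral_cong_AE)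
  show "AE \<omega> in P x. e2ennreal ((stopped_at X \<tau> \<omega> - ereal (mean_at (P x) X \<tau>))\<^sup>2) =
      ennreal ((real_of_ereal (stopped_at X \<tau> \<omega>) - mean_at (P x) X \<tau>)\<^sup>2)"
    using AE_stopped_range[OF x, of \<tau>]
  proof eventually_elim
    case (elim \<omega>)
    then obtain r where "stopped_at X \<tau> \<omega> = ereal r" by (cases "stopped_at X \<tau> \<omega>") auto
    then show ?case by (simp add: power2_eq_square flip: e2ennreal_ereal)
  qed
qed

text \<open>The mean gap is bounded from above only, hence the sign condition on B. At \<beta> the
  bound on the square holds with equality, so it is assumed in the interior only.\<close>

lemma variance_at_le:
  assumes x: "x \<in> I" and \<tau>: "\<tau> \<in> stopping_times M U X" and B: "0 \<le> B"
    and bound: "\<And>z. z \<in> I \<Longrightarrow> (z - c)\<^sup>2 \<le> (\<beta> - c)\<^sup>2 + B * gap z"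
  shows "variance_at (P x) X \<tau> \<le> ennreal ((\<beta> - c)\<^sup>2 + B * gap x)"
proof -
  interpret prob_space "P x" by (rule prob_space_P[OF x])
  define Z where "Z \<omega> = real_of_ereal (stopped_at X \<tau> \<omega>)" for \<omega>
  have st: "stopped_at X \<tau> \<in> borel_measurable (P x)"
    unfolding measurable_cong_sets[OF sets_P[OF x] refl] by (rule stopped_measurable[OF \<tau>])
  then have Z: "Z \<in> borel_measurable (P x)" unfolding Z_def by measurable
  have "gap_ext \<in> borel_measurable borel"
    unfolding gap_ext_def[abs_def] by (rule interior_measurable[OF gap_continuous])
  then have gm: "(\<lambda>\<omega>. gap_ext (stopped_at X \<tau> \<omega>)) \<in> borel_measurable (P x)"
    by (rule measurable_compose[OF st])
  have "(\<integral>\<^sup>+\<omega>. ennreal ((Z \<omega> - c)\<^sup>2) \<partial>P x) \<le> (\<integral>\<^sup>+\<omega>. ennreal ((\<beta> - c)\<^sup>2) + ennreal B * gap_ext (stopped_at X \<tau> \<omega>) \<partial>P x)"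
  proof (rule nn_integral_mono_AE)
    show "AE \<omega> in P x. ennreal ((Z \<omega> - c)\<^sup>2) \<le> ennreal ((\<beta> - c)\<^sup>2) + ennreal B * gap_ext (stopped_at X \<tau> \<omega>)"
      using AE_stopped_range[OF x, of \<tau>]
    proof eventually_elim
      case (elim \<omega>)
      show ?case
      proof (cases "stopped_at X \<tau> \<omega> = ereal \<beta>")
        case True
        then show ?thesis by (simp add: Z_def)
      next
        case False
        then have r: "stopped_at X \<tau> \<omega> \<in> {\<alpha><..<ereal \<beta>}" using elim by auto
        then have "Z \<omega> \<in> I" using real_in_I unfolding Z_def by blast
        then have "(Z \<omega> - c)\<^sup>2 \<le> (\<beta> - c)\<^sup>2 + B * gap (Z \<omega>)" "0 < gap (Z \<omega>)" using bound gap_pos by auto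
        then have "ennreal ((Z \<omega> - c)\<^sup>2) \<le> ennreal ((\<beta> - c)\<^sup>2 + B * gap (Z \<omega>))"
          by (intro ennreal_leI)
        also have "\<dots> = ennreal ((\<beta> - c)\<^sup>2) + ennreal (B * gap (Z \<omega>))"
          using B \<open>0 < gap (Z \<omega>)\<close> by (intro ennreal_plus) auto
        also have "ennreal (B * gap (Z \<omega>)) = ennreal B * gap_ext (stopped_at X \<tau> \<omega>)"
          using r B by (simp add: gap_ext_def Z_def ennreal_mult')
        finally show ?thesis .
      qed
    qed
  qed
  also have "\<dots> = ennreal ((\<beta> - c)\<^sup>2) + ennreal B * (\<integral>\<^sup>+\<omega>. gap_ext (stopped_at X \<tau> \<omega>) \<partial>P x)"
    using gm by (subst nn_integral_add) (auto simp: nn_integral_cmult emeasure_space_1)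
  also have "\<dots> \<le> ennreal ((\<beta> - c)\<^sup>2) + ennreal B * ennreal (gap x)"
    by (intro add_left_mono mult_left_mono integral_gap_stopped_le[OF x \<tau>]) simp
  also have "\<dots> = ennreal ((\<beta> - c)\<^sup>2 + B * gap x)"
    using B gap_pos[OF x] by (simp add: ennreal_mult'[symmetric] ennreal_plus[symmetric] del: ennreal_plus)
  finally have le: "(\<integral>\<^sup>+\<omega>. ennreal ((Z \<omega> - c)\<^sup>2) \<partial>P x) \<le> ennreal ((\<beta> - c)\<^sup>2 + B * gap x)" .
  then have "(\<integral>\<^sup>+\<omega>. ennreal ((Z \<omega> - c)\<^sup>2) \<partial>P x) < \<infinity>" by (rule le_less_trans) simp
  then have "(\<integral>\<^sup>+\<omega>. ennreal ((Z \<omega> - (\<integral>\<omega>. Z \<omega> \<partial>P x))\<^sup>2) \<partial>P x) \<le> (\<integral>\<^sup>+\<omega>. ennreal ((Z \<omega> - c)\<^sup>2) \<partial>P x)"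
    by (rule variance_le_second_moment[OF Z])
  then show ?thesis using le unfolding variance_at_eq[OF x] mean_at_def Z_def by (rule order_trans)
qed

section \<open>Laws of exit times and of their mixtures\<close>

lemma exit_time_eq:
  assumes "\<omega> \<in> space M" "b \<le> \<beta>"
  shows "exit_time X (ereal \<beta>) a (ereal b) \<omega> = interior_exit_time X a (ereal b) \<omega>"
proof (cases "b = \<beta>")
  case True
  then show ?thesis using exit_time_right_end[of X \<omega> \<beta> a, OF X_continuous[OF assms(1)]] by simp
next
  case False
  then show ?thesis using assms(2) by (simp add: exit_time_def)
qed

lemma exit_time_natural:
  assumes "b \<le> \<beta>"
  shows "stopping_time (natural_filt (space M) X) (exit_time X (ereal \<beta>) a (ereal b))"
  using stopping_time_interior[of a "ereal b"] exit_time_eq[OF _ assms]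
  by (subst stopping_time_cong[where S = "interior_exit_time X a (ereal b)"]) (auto simp: space_natural_filt)

text \<open>Measurability for the natural filtration, not merely for M, is what makes exit values
  independent of U.\<close>

lemma exit_time_stopped_natural:
  assumes "b \<le> \<beta>"
  shows "stopped_at X (exit_time X (ereal \<beta>) a (ereal b)) \<in> borel_measurable (natural_filt (space M) X \<infinity>)"
proof (rule measurable_stopped_at)
  show "exit_time X (ereal \<beta>) a (ereal b) \<in> borel_measurable (natural_filt (space M) X \<infinity>)"
    by (rule measurable_stopping_time[OF exit_time_natural[OF assms]
          filtration.sets_F_mono[OF filtration_natural_filt]]) (simp_all add: space_natural_filt)
qed (auto intro!: measurable_natural_filt X_continuous simp: space_natural_filt)

lemma mix_times_stopping:
  assumes "b1 \<le> \<beta>" "b2 \<le> \<beta>"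
  shows "mix_times U p (exit_time X (ereal \<beta>) a1 (ereal b1)) (exit_time X (ereal \<beta>) a2 (ereal b2)) \<in> stopping_times M U X"
  unfolding stopping_times_iff
proof
  fix t
  let ?F = "randomized_filt (space M) U X t"
  have *: "Measurable.pred ?F (\<lambda>\<omega>. exit_time X (ereal \<beta>) a (ereal b) \<omega> \<le> t)" if "b \<le> \<beta>" for a b
    using stopping_timeD[OF exit_time_natural[OF that, of a], of t] sets_natural_le_randomized[of "space M" X t U]
    by (auto simp: pred_def space_natural_filt space_randomized_filt)
  have U: "U \<in> borel_measurable ?F"
    unfolding measurable_def space_randomized_filt sets_randomized_filt
    by (auto intro!: sigma_sets.Basic)
  have "Measurable.pred ?F (\<lambda>\<omega>. if U \<omega> < p then exit_time X (ereal \<beta>) a1 (ereal b1) \<omega> \<le> t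
      else exit_time X (ereal \<beta>) a2 (ereal b2) \<omega> \<le> t)"
    using *[OF assms(1), of a1] *[OF assms(2), of a2] U by measurable
  then show "Measurable.pred ?F (\<lambda>\<omega>. mix_times U p (exit_time X (ereal \<beta>) a1 (ereal b1)) (exit_time X (ereal \<beta>) a2 (ereal b2)) \<omega> \<le> t)"
    by (simp add: mix_times_def if_distrib[of "\<lambda>u. u \<le> t"] cong: if_cong)
qed

text \<open>The gap continued by its limit at \<open>\<beta>\<close>, where \<open>S\<close> itself is unspecified.\<close>

definition right_weight :: "real \<Rightarrow> real" where
  "right_weight b = (if b = \<beta> then 0 else gap b)"

text \<open>For b below \<beta> this is \<open>(S b - S x) / (S b - S a)\<close>, the probability of
  leaving at a; written with gaps it extends to b = \<beta>.\<close>

definition left_prob :: "real \<Rightarrow> real \<Rightarrow> real \<Rightarrow> real" where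
  "left_prob x a b = (gap x - right_weight b) / (gap a - right_weight b)"

text \<open>Three sources: for \<open>a = x\<close> the path exits at once, for
  \<open>b = \<beta>\<close> the event E is a fall to a, and otherwise \<open>scale_hitting\<close>
  applies.\<close>

lemma exit_law:
  assumes a: "a \<in> I" and x: "x \<in> I" and ax: "a \<le> x" and xb: "x < b" "b \<le> \<beta>"
  defines "E \<equiv> {\<omega> \<in> space M. stopped_at X (exit_time X (ereal \<beta>) a (ereal b)) \<omega> = ereal a}"
  shows "AE \<omega> in P x. stopped_at X (exit_time X (ereal \<beta>) a (ereal b)) \<omega> = ereal (if \<omega> \<in> E then a else b)"
    and "measure (P x) E = left_prob x a b"
    and "E \<in> sets (natural_filt (space M) X \<infinity>)"
proof -
  let ?\<tau> = "exit_time X (ereal \<beta>) a (ereal b)"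
  interpret prob_space "P x" by (rule prob_space_P[OF x])
  show EN: "E \<in> sets (natural_filt (space M) X \<infinity>)"
    using measurable_sets[OF exit_time_stopped_natural[OF xb(2), of a], of "{ereal a}"]
    by (simp add: E_def vimage_def Collect_conj_eq Int_commute space_natural_filt)
  then have E: "E \<in> events" using sets_natural_le by (auto simp: sets_P[OF x])
  have st: "stopped_at X ?\<tau> \<omega> = stopped_at X (interior_exit_time X a (ereal b)) \<omega>" if "\<omega> \<in> space M" for \<omega>
    using exit_time_eq[OF that xb(2)] by (simp add: stopped_at_def)
  have "(AE \<omega> in P x. stopped_at X ?\<tau> \<omega> = ereal (if \<omega> \<in> E then a else b)) \<and> measure (P x) E = left_prob x a b"
  proof (cases "a = x")
    case True
    have ae: "AE \<omega> in P x. stopped_at X ?\<tau> \<omega> = ereal a" using AE_start[OF x]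
    proof eventually_elim
      case (elim \<omega>)
      then have "interior_exit_time X a (ereal b) \<omega> \<le> ennreal 0"
        unfolding interior_exit_time_eq using True
        by (subst entry_time_le_iff[OF X_continuous closed_Compl_greaterThanLessThan]) auto
      then show ?case using elim True st[of \<omega>] by (simp add: stopped_at_def)
    qed
    then have "AE \<omega> in P x. \<omega> \<in> E" using AE_start[OF x] by eventually_elim (simp add: E_def)
    then have "measure (P x) E = 1" by (simp add: prob_eq_1[OF E])
    moreover have "right_weight b < gap x" using gap_pos[OF x] gap_less[OF x _ xb(1)] between_in_I[OF x, of b] xb
      by (auto simp: right_weight_def)
    ultimately show ?thesis using True ae \<open>AE \<omega> in P x. \<omega> \<in> E\<close> by (auto simp: left_prob_def)
  next
    case False
    then have ax: "a < x" using ax by simp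
    show ?thesis
    proof (cases "b = \<beta>")
      case True
      have d: "AE \<omega> in P x. \<omega> \<in> space M \<and> (\<omega> \<in> E \<longleftrightarrow> \<omega> \<in> fall a 0) \<and> stopped_at X ?\<tau> \<omega> = ereal (if \<omega> \<in> E then a else b)"
        using AE_fall_dichotomy[OF a x ax] AE_start[OF x]
        by eventually_elim (use st True I_less[OF a] in \<open>auto simp: E_def split: if_splits\<close>)
      then have "measure (P x) E = measure (P x) (fall a 0)"
        using E fall_in_M by (intro measure_eq_AE) (auto simp: sets_P[OF x])
      then show ?thesis using d prob_fall[OF a x ax] True by (auto simp: left_prob_def right_weight_def)
    next
      case False
      then have b: "b < \<beta>" "b \<in> I" using xb between_in_I[OF x, of b] by auto
      define H where "H = {\<omega> \<in> space M. hit_time X b \<omega> < hit_time X a \<omega>}"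
      have H: "H \<in> events" using hit_less_measurable[OF I_greater[OF a] ax xb(1) b(1)] by (simp add: H_def sets_P[OF x])
      have d: "AE \<omega> in P x. (\<omega> \<in> E \<longleftrightarrow> \<omega> \<in> space (P x) - H) \<and> stopped_at X ?\<tau> \<omega> = ereal (if \<omega> \<in> E then a else b)"
        using AE_exit_value[OF I_greater[OF a] ax xb(1) b(1)] AE_start[OF x]
        by eventually_elim (use st ax xb in \<open>auto simp: E_def H_def space_P[OF x]\<close>)
      then have "measure (P x) E = measure (P x) (space (P x) - H)"
        using E H by (intro measure_eq_AE) auto
      also have "\<dots> = 1 - (S x - S a) / (S b - S a)"
        using prob_compl[OF H] scale_hitting[OF I_greater[OF a] ax xb(1)] b by (simp add: H_def)
      also have "\<dots> = left_prob x a b"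
        using scale_less[OF a b(2)] ax xb False by (simp add: left_prob_def right_weight_def gap_def field_simps)
      finally show ?thesis using d by auto
    qed
  qed
  then show "AE \<omega> in P x. stopped_at X ?\<tau> \<omega> = ereal (if \<omega> \<in> E then a else b)"
    and "measure (P x) E = left_prob x a b" by auto
qed

end

definition two_point :: "real \<Rightarrow> real \<Rightarrow> real \<Rightarrow> (real \<Rightarrow> real) \<Rightarrow> real" where
  "two_point q a b F = q * F a + (1 - q) * F b"

lemma two_point_affine:
  "F a = k + B * G a \<Longrightarrow> F b = k + B * G b \<Longrightarrow> two_point q a b F = k + B * two_point q a b G"
  by (simp add: two_point_def algebra_simps)

lemma two_point_id: "two_point q a b (\<lambda>z. z) = b - (b - a) * q"
  by (simp add: two_point_def algebra_simps)

context attractive_right_end begin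

lemma prob_U_less:
  assumes x: "x \<in> I" and p: "0 \<le> p" "p \<le> 1"
  shows "measure (P x) (U -` {..<p} \<inter> space M) = p"
proof -
  have Um: "U \<in> borel_measurable (P x)"
    unfolding measurable_cong_sets[OF sets_P[OF x] refl] by (rule U_measurable)
  have "measure (P x) (U -` {..<p} \<inter> space M) = measure (distr (P x) borel U) {..<p}"
    using Um by (simp add: measure_distr space_P[OF x])
  also have "\<dots> = measure (uniform_measure lborel {0..1}) {..<p}" by (simp add: U_uniform[OF x])
  also have "\<dots> = measure lborel ({0..1} \<inter> {..<p}) / measure lborel {0..1::real}"
    by (rule measure_uniform_measure) auto
  also have "{0..1} \<inter> {..<p} = {0..<p}" using p by auto
  finally show ?thesis using p by simp
qed

text \<open>The choice of the time belongs to U and the exit events to X, so independence gives a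
  law with at most four atoms; R is the matching simple function.\<close>

lemma mix_law:
  fixes F :: "real \<Rightarrow> real"
  assumes x: "x \<in> I" and p: "0 \<le> p" "p \<le> 1" and F: "F \<in> borel_measurable borel"
    and 1: "a1 \<in> I" "a1 \<le> x" "x < b1" "b1 \<le> \<beta>" and 2: "a2 \<in> I" "a2 \<le> x" "x < b2" "b2 \<le> \<beta>"
  defines "\<tau> \<equiv> mix_times U p (exit_time X (ereal \<beta>) a1 (ereal b1)) (exit_time X (ereal \<beta>) a2 (ereal b2))"
  shows "integrable (P x) (\<lambda>\<omega>. F (real_of_ereal (stopped_at X \<tau> \<omega>)))" (is ?int)
    and "(\<integral>\<omega>. F (real_of_ereal (stopped_at X \<tau> \<omega>)) \<partial>P x) =
      p * two_point (left_prob x a1 b1) a1 b1 F + (1 - p) * two_point (left_prob x a2 b2) a2 b2 F" (is ?eq)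
proof -
  interpret prob_space "P x" by (rule prob_space_P[OF x])
  define E1 where "E1 = {\<omega> \<in> space M. stopped_at X (exit_time X (ereal \<beta>) a1 (ereal b1)) \<omega> = ereal a1}"
  define E2 where "E2 = {\<omega> \<in> space M. stopped_at X (exit_time X (ereal \<beta>) a2 (ereal b2)) \<omega> = ereal a2}"
  note l1 = exit_law[OF 1(1) x 1(2-4), folded E1_def] and l2 = exit_law[OF 2(1) x 2(2-4), folded E2_def]
  define V where "V = U -` {..<p} \<inter> space M"
  have V: "V \<in> events" unfolding V_def sets_P[OF x] by (rule measurable_sets[OF U_measurable]) simp
  have E: "E1 \<in> events" "E2 \<in> events"     unfolding sets_P[OF x] using subsetD[OF sets_natural_le l1(3)] subsetD[OF sets_natural_le l2(3)] .
  have pV: "prob V = p" using prob_U_less[OF x p] by (simp add: V_def)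
  have ind: "prob (V \<inter> B) = p * prob B" if "B \<in> sets (natural_filt (space M) X \<infinity>)" for B
  proof -
    have "V \<in> {U -` A \<inter> space M |A. A \<in> sets borel}"
      unfolding V_def by (intro CollectI exI[of _ "{..<p}"]) simp
    then have "prob (V \<inter> B) = prob V * prob B" using that by (rule indep_setD[OF U_indep[OF x]])
    then show ?thesis by (simp add: pV)
  qed
  define R where "R \<omega> = F a1 * indicator (V \<inter> E1) \<omega> + F b1 * indicator (V - E1) \<omega> +
    F a2 * indicator (E2 - V) \<omega> + F b2 * indicator (space (P x) - (V \<union> E2)) \<omega>" for \<omega>
  have probs: "prob (V \<inter> E1) = p * left_prob x a1 b1" "prob (V - E1) = p * (1 - left_prob x a1 b1)"
    "prob (E2 - V) = (1 - p) * left_prob x a2 b2"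
    "prob (space (P x) - (V \<union> E2)) = (1 - p) * (1 - left_prob x a2 b2)"
  proof -
    show 1: "prob (V \<inter> E1) = p * left_prob x a1 b1" using ind[OF l1(3)] l1(2) by simp
    show "prob (V - E1) = p * (1 - left_prob x a1 b1)"
      using finite_measure_Diff'[OF V E(1)] 1 by (simp add: pV algebra_simps)
    show 3: "prob (E2 - V) = (1 - p) * left_prob x a2 b2"
      using finite_measure_Diff'[OF E(2) V] ind[OF l2(3)] l2(2) by (simp add: Int_commute algebra_simps)
    have "prob (V \<union> E2) = p + (1 - p) * left_prob x a2 b2"
      using finite_measure_Union'[OF V E(2)] 3 by (simp add: pV)
    then show "prob (space (P x) - (V \<union> E2)) = (1 - p) * (1 - left_prob x a2 b2)"
      using prob_compl[of "V \<union> E2"] V E by (simp add: algebra_simps)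
  qed
  have Rint: "integrable (P x) R" unfolding R_def using V E
    by (intro Bochner_Integration.integrable_add integrable_mult_right integrable_real_indicator)
      (auto simp: less_top[symmetric])
  have "\<tau> \<in> stopping_times M U X" unfolding \<tau>_def by (rule mix_times_stopping[OF 1(4) 2(4)])
  then have st: "stopped_at X \<tau> \<in> borel_measurable (P x)"
    unfolding measurable_cong_sets[OF sets_P[OF x] refl] by (rule stopped_measurable)
  have ae: "AE \<omega> in P x. real_of_ereal (stopped_at X \<tau> \<omega>) =
      (if \<omega> \<in> V then if \<omega> \<in> E1 then a1 else b1 else if \<omega> \<in> E2 then a2 else b2)"
    using l1(1) l2(1) AE_start[OF x]
  proof eventually_elim
    case (elim \<omega>)
    then show ?case by (auto simp: \<tau>_def stopped_at_def mix_times_def V_def)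
  qed
  have ae': "AE \<omega> in P x. F (real_of_ereal (stopped_at X \<tau> \<omega>)) = R \<omega>"
    using ae AE_space[of "P x"]
    by eventually_elim (auto simp: R_def indicator_def)
  have Fm: "(\<lambda>\<omega>. F (real_of_ereal (stopped_at X \<tau> \<omega>))) \<in> borel_measurable (P x)"
    using F st by measurable
  have Rm: "R \<in> borel_measurable (P x)" using Rint by (rule borel_measurable_integrable)
  show ?int using integrable_cong_AE[OF Fm Rm ae'] Rint by simp
  have ii: "integrable (P x) (\<lambda>\<omega>. c * indicator A \<omega>)" "(\<integral>\<omega>. c * indicator A \<omega> \<partial>P x) = c * prob A"
    if "A \<in> events" for A and c :: real
    using that sets.sets_into_space[OF that] by (auto simp: Int_absorb2 less_top[symmetric])
  have ev: "V \<inter> E1 \<in> events" "V - E1 \<in> events" "E2 - V \<in> events" "space (P x) - (V \<union> E2) \<in> events"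
    using V E by auto
  have "(\<integral>\<omega>. F (real_of_ereal (stopped_at X \<tau> \<omega>)) \<partial>P x) = (\<integral>\<omega>. R \<omega> \<partial>P x)"
    by (rule integral_cong_AE[OF Fm Rm ae'])
  also have "\<dots> = F a1 * prob (V \<inter> E1) + F b1 * prob (V - E1) + F a2 * prob (E2 - V) +
      F b2 * prob (space (P x) - (V \<union> E2))"
    unfolding R_def
    by (simp only: Bochner_Integration.integral_add Bochner_Integration.integrable_add ii[OF ev(1)] ii[OF ev(2)]
        ii[OF ev(3)] ii[OF ev(4)])
  finally show ?eq unfolding probs two_point_def by (simp add: algebra_simps)
qed

text \<open>Exit times turn the gap inequality into an equality: \<open>left_prob\<close> is
  precisely the mass at a that gives mean weight \<open>gap x\<close>.\<close>

lemma two_point_right_weight: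
  assumes "a \<in> I" "x \<in> I" "a \<le> x" "x < b" "b \<le> \<beta>"
  shows "two_point (left_prob x a b) a b right_weight = gap x"
proof -
  have "right_weight b < gap x"
    using gap_pos[OF assms(2)] gap_less[OF assms(2) _ assms(4)] between_in_I[OF assms(2), of b] assms
    by (auto simp: right_weight_def)
  moreover have "gap x \<le> gap a" by (rule gap_le[OF assms(1-3)])
  moreover have "right_weight a = gap a" using I_less[OF assms(1)] by (simp add: right_weight_def)
  moreover have "two_point q a b right_weight = right_weight b + q * (right_weight a - right_weight b)" for q
    by (simp add: two_point_def algebra_simps)
  ultimately show ?thesis unfolding left_prob_def by simp
qed

text \<open>No slack remains in \<open>variance_at_le\<close>: the pointwise bound is an equality on
  the four atoms, the mean gap equals \<open>gap x\<close>, and c is the mean.\<close>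

lemma optimal_mix:
  assumes x: "x \<in> I" and p: "0 \<le> p" "p \<le> 1" and B: "0 \<le> B"
    and bound: "\<And>z. z \<in> I \<Longrightarrow> (z - c)\<^sup>2 \<le> (\<beta> - c)\<^sup>2 + B * gap z"
    and 1: "a1 \<in> I" "a1 \<le> x" "x < b1" "b1 \<le> \<beta>" and 2: "a2 \<in> I" "a2 \<le> x" "x < b2" "b2 \<le> \<beta>"
    and touch: "\<And>z. z \<in> {a1, b1, a2, b2} \<Longrightarrow> (z - c)\<^sup>2 = (\<beta> - c)\<^sup>2 + B * right_weight z"
    and mean: "p * two_point (left_prob x a1 b1) a1 b1 (\<lambda>z. z) +
      (1 - p) * two_point (left_prob x a2 b2) a2 b2 (\<lambda>z. z) = c"
  defines "\<tau> \<equiv> mix_times U p (exit_time X (ereal \<beta>) a1 (ereal b1)) (exit_time X (ereal \<beta>) a2 (ereal b2))"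
  shows "optimal_time M P X U x \<tau>" and "variance_value M P X U x = ennreal ((\<beta> - c)\<^sup>2 + B * gap x)"
proof -
  have \<tau>: "\<tau> \<in> stopping_times M U X" unfolding \<tau>_def by (rule mix_times_stopping[OF 1(4) 2(4)])
  note law = mix_law[OF x p _ 1 2, folded \<tau>_def]
  have "mean_at (P x) X \<tau> = c" unfolding mean_at_def using law(2)[of "\<lambda>z. z"] mean by simp
  then have "variance_at (P x) X \<tau> = (\<integral>\<^sup>+\<omega>. ennreal ((real_of_ereal (stopped_at X \<tau> \<omega>) - c)\<^sup>2) \<partial>P x)"
    by (simp add: variance_at_eq[OF x])
  also have "\<dots> = ennreal (\<integral>\<omega>. (real_of_ereal (stopped_at X \<tau> \<omega>) - c)\<^sup>2 \<partial>P x)"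
    using law(1)[of "\<lambda>z. (z - c)\<^sup>2"] by (intro nn_integral_eq_integral) auto
  also have "(\<integral>\<omega>. (real_of_ereal (stopped_at X \<tau> \<omega>) - c)\<^sup>2 \<partial>P x) =
      p * two_point (left_prob x a1 b1) a1 b1 (\<lambda>z. (z - c)\<^sup>2) + (1 - p) * two_point (left_prob x a2 b2) a2 b2 (\<lambda>z. (z - c)\<^sup>2)"
    using law(2)[of "\<lambda>z. (z - c)\<^sup>2"] by simp
  also have "two_point (left_prob x a1 b1) a1 b1 (\<lambda>z. (z - c)\<^sup>2) = (\<beta> - c)\<^sup>2 + B * gap x"
    using two_point_affine[OF touch[of a1] touch[of b1]] two_point_right_weight[OF 1(1) x 1(2-4)] by simp
  also have "two_point (left_prob x a2 b2) a2 b2 (\<lambda>z. (z - c)\<^sup>2) = (\<beta> - c)\<^sup>2 + B * gap x"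
    using two_point_affine[OF touch[of a2] touch[of b2]] two_point_right_weight[OF 2(1) x 2(2-4)] by simp
  finally have v: "variance_at (P x) X \<tau> = ennreal ((\<beta> - c)\<^sup>2 + B * gap x)" by (simp add: algebra_simps)
  show val: "variance_value M P X U x = ennreal ((\<beta> - c)\<^sup>2 + B * gap x)"
    unfolding variance_value_def
  proof (rule antisym)
    show "(SUP \<tau>\<in>stopping_times M U X. variance_at (P x) X \<tau>) \<le> ennreal ((\<beta> - c)\<^sup>2 + B * gap x)"
      by (rule SUP_least) (rule variance_at_le[OF x _ B bound])
    show "ennreal ((\<beta> - c)\<^sup>2 + B * gap x) \<le> (SUP \<tau>\<in>stopping_times M U X. variance_at (P x) X \<tau>)"
      using \<tau> by (rule SUP_upper2) (simp add: v)
  qed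
  show "optimal_time M P X U x \<tau>" unfolding optimal_time_def using \<tau> val v by simp
qed

lemma mix_times_same: "mix_times U p \<tau> \<tau> = \<tau>"
  by (auto simp: mix_times_def)

lemma left_prob_right_end: "left_prob x a \<beta> = gap x / gap a"
  by (simp add: left_prob_def right_weight_def)

lemma mean_exit_right_end:
  assumes "a \<in> I" "x \<in> I" "a \<le> x"
  shows "mean_at (P x) X (exit_time X (ereal \<beta>) a (ereal \<beta>)) = \<beta> - (\<beta> - a) * (gap x / gap a)"
proof -
  note ax = assms(1,3) I_less[OF assms(2)] order_refl
  \<comment> \<open>A single exit time is the mixture of two copies of itself.\<close>
  have "mean_at (P x) X (exit_time X (ereal \<beta>) a (ereal \<beta>)) = two_point (gap x / gap a) a \<beta> (\<lambda>z. z)"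
    using mix_law(2)[OF assms(2) _ _ _ ax ax, of 1 "\<lambda>z. z"]
    by (simp add: mean_at_def mix_times_same left_prob_right_end)
  then show ?thesis by (simp add: two_point_id)
qed

text \<open>From a start above a, falling to a means hitting a, by the intermediate value theorem.
  Intersecting with R makes this an identity of sets for all paths, which also settles
  measurability.\<close>

lemma prob_hit:
  assumes a: "a \<in> I" and x: "x \<in> I" and ax: "a < x"
  shows "measure (P x) {\<omega> \<in> space M. hit_time X a \<omega> < \<infinity>} = gap x / gap a"
proof -
  define R where "R = {\<omega> \<in> space M. \<exists>K::nat. \<not> (\<forall>t\<in>{0..real K}. X t \<omega> < ereal a)}"
  have "Measurable.pred M (\<lambda>\<omega>. \<exists>K::nat. \<not> (\<forall>t\<in>{0..real K}. X t \<omega> < ereal a))"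
    by (intro pred_intros_countable pred_intros_logic pred_path_below X_measurable X_continuous) auto
  then have R: "R \<in> sets M" by (simp add: R_def pred_def)
  have "{\<omega> \<in> space M. hit_time X a \<omega> < \<infinity>} = fall a 0 \<inter> R"
  proof (intro set_eqI iffI)
    fix \<omega> assume "\<omega> \<in> {\<omega> \<in> space M. hit_time X a \<omega> < \<infinity>}"
    then have w: "\<omega> \<in> space M" and "hit_time X a \<omega> < \<infinity>" by auto
    then obtain t where t: "0 \<le> t" "X t \<omega> = ereal a"
      unfolding hit_time_eq entry_time_finite_iff[OF X_continuous[OF w] closed_singleton] by auto
    obtain K :: nat where "t \<le> real K" using real_arch_simple by blast
    then have "\<not> (\<forall>t\<in>{0..real K}. X t \<omega> < ereal a)" using t by (intro notI) (drule bspec[of _ _ t]; simp)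
    then show "\<omega> \<in> fall a 0 \<inter> R" using w t by (auto simp: fall_def R_def)
  next
    fix \<omega> assume "\<omega> \<in> fall a 0 \<inter> R"
    then obtain s t where w: "\<omega> \<in> space M" and st: "0 \<le> s" "X s \<omega> \<le> ereal a" "0 \<le> t" "ereal a \<le> X t \<omega>"
      by (auto simp: fall_def R_def not_less)
    note cont = X_continuous[OF w]
    have "\<exists>r\<in>{min s t..max s t}. X r \<omega> = ereal a"
    proof (cases "s \<le> t")
      case True
      then show ?thesis using path_between_attained[OF cont st(1) True, of "ereal a"] st
        by (simp add: min_le_iff_disj le_max_iff_disj)
    next
      case False
      then have "t \<le> s" by simp
      then show ?thesis using path_between_attained[OF cont st(3), of s "ereal a"] st
        by (simp add: min_le_iff_disj le_max_iff_disj)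
    qed
    then obtain r where "min s t \<le> r" "X r \<omega> = ereal a" by auto
    moreover from this have "0 \<le> r" using st by auto
    ultimately have "\<exists>r\<ge>0. X r \<omega> = ereal a" by blast
    then show "\<omega> \<in> {\<omega> \<in> space M. hit_time X a \<omega> < \<infinity>}"
      using w entry_time_finite_iff[OF cont closed_singleton, of "ereal a"] by (simp add: hit_time_eq)
  qed
  moreover have "measure (P x) (fall a 0 \<inter> R) = measure (P x) (fall a 0)"
  proof (rule measure_eq_AE)
    show "AE \<omega> in P x. \<omega> \<in> fall a 0 \<inter> R \<longleftrightarrow> \<omega> \<in> fall a 0" using AE_start[OF x]
      by eventually_elim (use ax in \<open>auto simp: R_def not_less intro!: bexI[of _ 0]\<close>)
  qed (use R fall_in_M in \<open>auto simp: sets_P[OF x]\<close>)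
  ultimately show ?thesis using prob_fall[OF a x ax] by simp
qed

end

section \<open>Optimality\<close>

context attractive_right_end begin

text \<open>By \<open>prob_hit\<close> the decay hypothesis says that \<open>y^2 / gap y\<close>
  tends to 0. Half of e absorbs \<open>y^2\<close>; the other half absorbs 1, because the gap is
  unbounded.\<close>

lemma decaying_gap:
  assumes x: "x \<in> I"
    and hit_decay:
      "((\<lambda>a. measure (P x) {\<omega> \<in> space M. hit_time X (real_of_ereal a) \<omega> < \<infinity>} * (real_of_ereal a)\<^sup>2)
          \<longlongrightarrow> 0) (at_right \<alpha>)"
  shows "decaying_scale \<alpha> \<beta> gap"
proof
  show "0 < gap y" if "y \<in> I" for y by (rule gap_pos[OF that])
  show "continuous_on I gap" by (rule gap_continuous)
  fix e :: real assume e: "0 < e"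
  have "0 < gap x * (e / 2)" using gap_pos[OF x] e by simp
  from order_tendstoD(2)[OF hit_decay this]
  obtain b where b: "\<alpha> < b" "\<And>y. \<alpha> < y \<Longrightarrow> y < b \<Longrightarrow>
      measure (P x) {\<omega> \<in> space M. hit_time X (real_of_ereal y) \<omega> < \<infinity>} * (real_of_ereal y)\<^sup>2 < gap x * (e / 2)"
    using eventually_at_right[OF endpoints] by auto
  obtain z where z: "\<alpha> < ereal z" "ereal z < min b (ereal x)"
    using ereal_dense2[of \<alpha> "min b (ereal x)"] b(1) I_greater[OF x] by auto
  then have "z < \<beta>" using I_less[OF x] by simp
  then have zI: "z \<in> I" using z by (simp add: einterval_iff)
  obtain a where a: "a \<in> I" "max (gap z) (2 / e) < gap a" using gap_unbounded by blast
  have az: "a < z" using gap_le[OF zI a(1)] a(2) by (cases "a < z") auto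
  show "\<exists>a\<in>I. \<forall>y\<in>I. y \<le> a \<longrightarrow> 1 + y\<^sup>2 \<le> e * gap y"
  proof (intro bexI[OF _ a(1)] ballI impI)
    fix y assume y: "y \<in> I" "y \<le> a"
    have "y < z" using y(2) az by simp
    moreover have "ereal z < b" "z < x" using z by simp_all
    ultimately have yx: "y < x" and yb: "ereal y < b"
      using less_trans[of "ereal y" "ereal z" b] by simp_all
    have "gap x / gap y * y\<^sup>2 < gap x * (e / 2)"
      using b(2)[OF I_greater[OF y(1)] yb] prob_hit[OF y(1) x yx] by simp
    then have "gap x * (y\<^sup>2 / gap y) < gap x * (e / 2)" by simp
    then have "y\<^sup>2 / gap y < e / 2" using gap_pos[OF x] by (simp only: mult_less_cancel_left_pos)
    then have "y\<^sup>2 < e / 2 * gap y" using gap_pos[OF y(1)] by (simp add: divide_less_eq)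
    moreover have "2 / e < gap y" using gap_le[OF y(1) a(1) y(2)] a(2) by simp
    then have "1 < e / 2 * gap y" using e by (simp add: field_simps)
    ultimately show "1 + y\<^sup>2 \<le> e * gap y" by (simp add: field_simps)
  qed
qed

lemma maximizers_eq:
  assumes "decaying_scale \<alpha> \<beta> gap" "y1 \<in> I"
    "\<And>z. z \<in> I \<Longrightarrow> decaying_scale.ratio \<beta> gap c z \<le> decaying_scale.ratio \<beta> gap c y1"
  shows "maximizers \<alpha> \<beta> S S\<beta> c = {y \<in> I. decaying_scale.ratio \<beta> gap c y = decaying_scale.ratio \<beta> gap c y1}"
proof -
  interpret decaying_scale \<alpha> \<beta> gap by fact
  have "(y\<^sup>2 - \<beta>\<^sup>2 - 2 * c * (y - \<beta>)) / (S\<beta> - S y) = ratio c y" for y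
    by (simp add: ratio_def gap_def)
  then have "maximizers \<alpha> \<beta> S S\<beta> c = {y. is_arg_max (ratio c) (\<lambda>y. y \<in> I) y}"
    by (simp add: maximizers_def)
  also have "\<dots> = {y \<in> I. ratio c y = ratio c y1}"
  proof (intro set_eqI iffI)
    fix y assume "y \<in> {y. is_arg_max (ratio c) (\<lambda>y. y \<in> I) y}"
    then have y: "y \<in> I" "\<not> ratio c y < ratio c y1" using assms(2) by (auto simp: is_arg_max_def)
    then show "y \<in> {y \<in> I. ratio c y = ratio c y1}" using assms(3)[of y] by simp
  next
    fix y assume y: "y \<in> {y \<in> I. ratio c y = ratio c y1}"
    then have "\<not> ratio c y < ratio c z" if "z \<in> I" for z using assms(3)[OF that] by simp
    then show "y \<in> {y. is_arg_max (ratio c) (\<lambda>y. y \<in> I) y}" using y by (auto simp: is_arg_max_def)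
  qed
  finally show ?thesis .
qed

text \<open>The first-order condition at an interior maximum, solved for the expression assumed
  non-increasing in (C). For \<open>c < \<beta>\<close> the right side strictly increases in y below
  \<open>2 * c - \<beta>\<close>.\<close>

lemma maximizer_critical:
  assumes dec: "decaying_scale \<alpha> \<beta> gap" and y: "y \<in> I" and pos: "y < 2 * c - \<beta>"
    and diff: "S differentiable (at y)"
    and max: "\<And>z. z \<in> I \<Longrightarrow> decaying_scale.ratio \<beta> gap c z \<le> decaying_scale.ratio \<beta> gap c y"
  shows "deriv S y / (S\<beta> - S y) * (\<beta> - y) = 2 + 2 * (\<beta> - c) / (2 * c - \<beta> - y)"
proof -
  interpret decaying_scale \<alpha> \<beta> gap by fact
  have S': "(S has_real_derivative deriv S y) (at y)"
    using diff by (simp add: DERIV_deriv_iff_real_differentiable)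
  have g: "0 < gap y" by (rule gap_pos[OF y])
  define N where "N = (\<beta> - y) * (2 * c - \<beta> - y)"
  define N' where "N' = - (2 * c - \<beta> - y) - (\<beta> - y)"
  have "((\<lambda>z. (\<beta> - z) * (2 * c - \<beta> - z) / gap z) has_real_derivative
      (N' * gap y - N * (- deriv S y)) / (gap y * gap y)) (at y)"
    unfolding gap_def N_def N'_def using g unfolding gap_def
    by (auto intro!: derivative_eq_intros S' simp: algebra_simps)
  then have D: "(ratio c has_real_derivative (N' * gap y + N * deriv S y) / (gap y * gap y)) (at y)"
    by (simp add: ratio_factored[abs_def])
  obtain d where d: "0 < d" "\<And>z. \<bar>y - z\<bar> < d \<Longrightarrow> z \<in> I"
    using open_einterval[of \<alpha> "ereal \<beta>"] y unfolding open_dist dist_real_def by (metis abs_minus_commute)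
  have "(N' * gap y + N * deriv S y) / (gap y * gap y) = 0"
    by (rule DERIV_local_max[OF D d(1)]) (use d(2) max in blast)
  then have eq: "N * deriv S y = - N' * gap y" using g by (simp add: field_simps)
  define w where "w = 2 * c - \<beta> - y"
  have w: "0 < w" using pos by (simp add: w_def)
  have "w * (deriv S y / gap y * (\<beta> - y)) = (N * deriv S y) / gap y" by (simp add: N_def w_def)
  also have "\<dots> = 2 * w + 2 * (\<beta> - c)" unfolding eq using g by (simp add: N'_def w_def)
  finally have "deriv S y / gap y * (\<beta> - y) = (2 * w + 2 * (\<beta> - c)) / w"
    using w by (simp add: field_simps)
  also have "\<dots> = 2 + 2 * (\<beta> - c) / w" using w by (simp add: add_divide_distrib)
  finally show ?thesis unfolding w_def gap_def .
qed

text \<open>Were the expression nonpositive at y, it would stay so to the right of y by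
  monotonicity, and S could not increase strictly there.\<close>

lemma log_gap_derivative_pos:
  assumes y: "y \<in> I" and diff: "\<And>y. y \<in> I \<Longrightarrow> S differentiable (at y)"
    and anti: "antimono_on I (\<lambda>y. deriv S y / (S\<beta> - S y) * (\<beta> - y))"
  shows "0 < deriv S y / (S\<beta> - S y) * (\<beta> - y)"
proof (rule ccontr)
  assume neg: "\<not> ?thesis"
  define z where "z = (y + \<beta>) / 2"
  have yz: "y < z" "z \<in> I" using I_less[OF y] by (auto simp: z_def intro!: between_in_I[OF y])
  have "S z \<le> S y"
  proof (rule DERIV_nonpos_imp_nonincreasing[OF less_imp_le[OF yz(1)]])
    fix u assume u: "y \<le> u" "u \<le> z"
    then have uI: "u \<in> I" using I_less[OF yz(2)] by (intro between_in_I[OF y]) auto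
    have "deriv S u / gap u * (\<beta> - u) \<le> 0"
      using monotone_onD[OF anti y uI u(1)] neg by (simp add: gap_def)
    then have "deriv S u \<le> 0"
      using gap_pos[OF uI] I_less[OF uI] by (simp add: mult_le_0_iff divide_le_0_iff)
    moreover have "(S has_real_derivative deriv S u) (at u)"
      using diff[OF uI] by (simp add: DERIV_deriv_iff_real_differentiable)
    ultimately show "\<exists>D. (S has_real_derivative D) (at u) \<and> D \<le> 0" by blast
  qed
  then show False using scale_less[OF y yz(2,1)] by simp
qed

end

lemma mixing_parameter:
  fixes c :: real
  assumes "m1 \<le> c" "c \<le> m2"
  obtains p where "0 \<le> p" "p \<le> 1" "p * m2 + (1 - p) * m1 = c"
proof (cases "m1 = m2")
  case True
  then show ?thesis using that[of 0] assms by simp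
next
  case False
  then have "m1 < m2" using assms by simp
  define r where "r = (c - m1) / (m2 - m1)"
  have "r * m2 + (1 - r) * m1 = m1 + r * (m2 - m1)" by (simp add: algebra_simps)
  also have "\<dots> = c" using \<open>m1 < m2\<close> by (simp add: r_def)
  finally show ?thesis using \<open>m1 < m2\<close> assms by (intro that[of r]) (auto simp: r_def divide_le_eq_1)
qed

theorem theorem3p3:
  fixes M :: "'a measure"
    and P :: "real \<Rightarrow> 'a measure"
    and X :: "real \<Rightarrow> 'a \<Rightarrow> ereal"
    and \<alpha> :: ereal
    and \<beta> S\<beta> x :: real
    and S :: "real \<Rightarrow> real"
    and m :: "real measure"
    and U :: "'a \<Rightarrow> real"
  assumes diffusion: "randomized_diffusion M P X \<alpha> (ereal \<beta>) S m U"
    and x: "x \<in> einterval \<alpha> (ereal \<beta>)"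
    and beta_attractive: "scale_right (ereal \<beta>) S = ereal S\<beta>"
    and alpha_not_attractive: "scale_left \<alpha> S = -\<infinity>"
    and hit_decay:
      "((\<lambda>a. measure (P x) {\<omega> \<in> space M. hit_time X (real_of_ereal a) \<omega> < \<infinity>} * (real_of_ereal a)\<^sup>2)
          \<longlongrightarrow> 0) (at_right \<alpha>)"
  shows "variance_value M P X U x < \<infinity> \<and>
    (\<exists>a\<in>einterval \<alpha> (ereal \<beta>) \<inter> {..x}. \<exists>y\<in>einterval \<alpha> (ereal \<beta>) \<inter> {..x}. \<exists>b\<in>{x..\<beta>}. \<exists>p\<in>{0..1}.
      optimal_time M P X U x
        (mix_times U p (exit_time X (ereal \<beta>) y (ereal \<beta>)) (exit_time X (ereal \<beta>) a (ereal b)))) \<and>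
    ((\<forall>c\<in>einterval \<alpha> (ereal \<beta>).
        (\<exists>y\<in>maximizers \<alpha> \<beta> S S\<beta> c. \<exists>y'\<in>maximizers \<alpha> \<beta> S S\<beta> c. y \<noteq> y') \<longrightarrow>
        mean_at (P (Sup (maximizers \<alpha> \<beta> S S\<beta> c))) X
          (exit_time X (ereal \<beta>) (Inf (maximizers \<alpha> \<beta> S S\<beta> c)) (ereal \<beta>)) < c) \<longrightarrow>
      (\<exists>y1\<in>einterval \<alpha> (ereal \<beta>) \<inter> {..x}. \<exists>y2\<in>einterval \<alpha> (ereal \<beta>) \<inter> {..x}. \<exists>p\<in>{0..1}.
        optimal_time M P X U x
          (mix_times U p (exit_time X (ereal \<beta>) y1 (ereal \<beta>)) (exit_time X (ereal \<beta>) y2 (ereal \<beta>))))) \<and>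
    ((\<forall>y\<in>einterval \<alpha> (ereal \<beta>). S differentiable (at y)) \<and>
      antimono_on (einterval \<alpha> (ereal \<beta>)) (\<lambda>y. deriv S y / (S\<beta> - S y) * (\<beta> - y)) \<longrightarrow>
      (\<exists>ys\<in>einterval \<alpha> (ereal x).
        (\<forall>y\<in>einterval \<alpha> (ereal x).
          (S x - S y) / (S x - 1/2 * S y - 1/2 * S\<beta>) = deriv S y / (S\<beta> - S y) * (\<beta> - y)
            \<longleftrightarrow> y = ys) \<and>
        optimal_time M P X U x (exit_time X (ereal \<beta>) ys (ereal \<beta>)) \<and>
        variance_value M P X U x =
          ennreal ((\<beta> - ys)\<^sup>2 * ((S\<beta> - S x) / (S\<beta> - S ys)) * ((S x - S ys) / (S\<beta> - S ys)))))"
proof -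
  interpret attractive_right_end M P X \<alpha> \<beta> S m U S\<beta>
    using diffusion beta_attractive alpha_not_attractive
    by (simp add: attractive_right_end_def attractive_right_end_axioms_def)
  have dec: "decaying_scale \<alpha> \<beta> gap" by (rule decaying_gap[OF x hit_decay])
  interpret decaying_scale \<alpha> \<beta> gap by (rule dec)
  obtain c y1 y2 where c: "c < \<beta>" and y1: "y1 \<in> I" and y2: "y2 \<in> I" and B: "0 < ratio c y1"
    and max: "\<And>z. z \<in> I \<Longrightarrow> ratio c z \<le> ratio c y1" and r2: "ratio c y2 = ratio c y1"
    and s1: "(\<beta> - c) / gap x \<le> (\<beta> - y1) / gap y1" and s2: "(\<beta> - y2) / gap y2 \<le> (\<beta> - c) / gap x"
    using saddle_point[OF x] by metis
  define B where "B = ratio c y1"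
  have B0: "0 < B" using \<open>0 < ratio c y1\<close> by (simp add: B_def)
  have gx: "0 < gap x" and xb: "x < \<beta>" using gap_pos[OF x] I_less[OF x] by auto
  have quad: "(z - c)\<^sup>2 = (\<beta> - c)\<^sup>2 + ratio c z * gap z" if "z \<in> I" for z
  proof -
    have "ratio c z * gap z = z\<^sup>2 - \<beta>\<^sup>2 - 2 * c * (z - \<beta>)"
      using gap_pos[OF that] by (simp add: ratio_def)
    then show ?thesis by (simp add: power2_eq_square algebra_simps)
  qed
  have bound: "(z - c)\<^sup>2 \<le> (\<beta> - c)\<^sup>2 + B * gap z" if "z \<in> I" for z
    unfolding quad[OF that] using max[OF that] gap_pos[OF that] by (simp add: B_def mult_right_mono)
  have touch: "(z - c)\<^sup>2 = (\<beta> - c)\<^sup>2 + B * right_weight z" if "z = \<beta> \<or> z \<in> I \<and> ratio c z = B" for z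
    using that quad[of z] I_less[of z] by (auto simp: right_weight_def)
  have below: "y < 2 * c - \<beta>" if "y \<in> I" "ratio c y = B" for y
    using that B0 ratio_pos_iff[OF that(1), of c] by simp
  define mean where "mean y = \<beta> - (\<beta> - y) * (gap x / gap y)" for y
  have mean: "two_point (left_prob x y \<beta>) y \<beta> (\<lambda>z. z) = mean y" for y
    by (simp add: two_point_id left_prob_right_end mean_def)
  \<comment> \<open>The two saddle inequalities multiplied by \<open>gap x\<close>.\<close>
  have m1: "mean y1 \<le> c" and m2: "c \<le> mean y2"
    using s1 s2 gx by (auto simp: mean_def field_simps)
  \<comment> \<open>For \<open>x \<le> y2\<close> the second saddle inequality would give
    \<open>c \<le> y2\<close>; but a maximizer of positive ratio is below
    \<open>2 * c - \<beta>\<close>, which is less than c.\<close>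
  have y2x: "y2 < x"
  proof (rule ccontr)
    assume "\<not> y2 < x"
    then have "gap y2 \<le> gap x" using gap_le[OF x y2] by simp
    then have "(\<beta> - y2) / gap x \<le> (\<beta> - y2) / gap y2"
      using gap_pos[OF y2] I_less[OF y2] by (intro divide_left_mono) auto
    also note s2
    finally have "\<beta> - y2 \<le> \<beta> - c" using gx by (simp add: divide_le_cancel)
    then show False using below[OF y2] r2 c by (simp add: B_def)
  qed
  \<comment> \<open>Waiting for y2 or \<beta> always supplies the mean at least c; the partner of
    mean at most c is left open because (A) and (B) choose it differently.\<close>
  have optimal: "\<exists>p\<in>{0..1}. optimal_time M P X U x
      (mix_times U p (exit_time X (ereal \<beta>) y2 (ereal \<beta>)) (exit_time X (ereal \<beta>) a (ereal b))) \<and>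
      variance_value M P X U x = ennreal ((\<beta> - c)\<^sup>2 + B * gap x)"
    if ab: "a \<in> I" "a \<le> x" "x < b" "b \<le> \<beta>" "ratio c a = B" "b = \<beta> \<or> b \<in> I \<and> ratio c b = B"
      "two_point (left_prob x a b) a b (\<lambda>z. z) \<le> c" for a b
  proof -
    obtain p where p: "0 \<le> p" "p \<le> 1" "p * mean y2 + (1 - p) * two_point (left_prob x a b) a b (\<lambda>z. z) = c"
      using mixing_parameter[OF ab(7) m2] by blast
    have t: "(z - c)\<^sup>2 = (\<beta> - c)\<^sup>2 + B * right_weight z" if "z \<in> {y2, \<beta>, a, b}" for z
      using that y2 r2 ab(1,5,6) by (intro touch) (auto simp: B_def)
    show ?thesis
      using optimal_mix[OF x p(1,2) less_imp_le[OF B0] bound y2 less_imp_le[OF y2x] xb order_refl ab(1-4) t] p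
      by (intro bexI[of _ p]) (auto simp: mean)
  qed
  have A: "\<exists>a\<in>I \<inter> {..x}. \<exists>b\<in>{x..\<beta>}. \<exists>p\<in>{0..1}. optimal_time M P X U x
      (mix_times U p (exit_time X (ereal \<beta>) y2 (ereal \<beta>)) (exit_time X (ereal \<beta>) a (ereal b))) \<and>
      variance_value M P X U x = ennreal ((\<beta> - c)\<^sup>2 + B * gap x)"
  proof (cases "y1 \<le> x")
    case True
    then show ?thesis using optimal[of y1 \<beta>] y1 xb m1 by (force simp: B_def mean)
  next
    case False
    \<comment> \<open>A maximizer above x serves as upper exit level: both ends of
      \<open>(y2, y1)\<close> touch the bound, and the mean is at most
      \<open>y1 < c\<close>.\<close>
    have "0 \<le> left_prob x y2 y1"
      using gap_less[OF x y1] gap_less[OF y2 x y2x] False I_less[OF y1]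
      by (simp add: left_prob_def right_weight_def)
    then have "two_point (left_prob x y2 y1) y2 y1 (\<lambda>z. z) \<le> y1"
      using False y2x by (simp add: two_point_id)
    then have "two_point (left_prob x y2 y1) y2 y1 (\<lambda>z. z) \<le> c"
      using below[OF y1] c by (simp add: B_def)
    then have o: "\<exists>p\<in>{0..1}. optimal_time M P X U x
        (mix_times U p (exit_time X (ereal \<beta>) y2 (ereal \<beta>)) (exit_time X (ereal \<beta>) y2 (ereal y1))) \<and>
        variance_value M P X U x = ennreal ((\<beta> - c)\<^sup>2 + B * gap x)"
      using y1 y2 y2x r2 False I_less[OF y1] by (intro optimal) (auto simp: B_def)
    show ?thesis
      by (rule bexI[where x = y2], rule bexI[where x = y1], rule o)
        (use y2 y2x I_less[OF y1] False in auto)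
  qed
  then have val: "variance_value M P X U x = ennreal ((\<beta> - c)\<^sup>2 + B * gap x)" by blast
  define Y where "Y = maximizers \<alpha> \<beta> S S\<beta> c"
  have Y: "Y = {y \<in> I. ratio c y = ratio c y1}"
    unfolding Y_def by (rule maximizers_eq[OF dec y1 max])
  \<comment> \<open>The hypothesis of (B) ranges over the state space, so the saddle value must lie
    in it; here \<open>y1 < 2 * c - \<beta> < c < \<beta>\<close>.\<close>
  have cI: "c \<in> I" using y1 below[OF y1] c by (intro between_in_I[OF y1]) (auto simp: B_def)
  have partB: "\<exists>y1\<in>I \<inter> {..x}. \<exists>y2\<in>I \<inter> {..x}. \<exists>p\<in>{0..1}. optimal_time M P X U x
      (mix_times U p (exit_time X (ereal \<beta>) y1 (ereal \<beta>)) (exit_time X (ereal \<beta>) y2 (ereal \<beta>)))"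
    if hyp: "\<forall>c\<in>I. (\<exists>y\<in>maximizers \<alpha> \<beta> S S\<beta> c. \<exists>y'\<in>maximizers \<alpha> \<beta> S S\<beta> c. y \<noteq> y') \<longrightarrow>
        mean_at (P (Sup (maximizers \<alpha> \<beta> S S\<beta> c))) X
          (exit_time X (ereal \<beta>) (Inf (maximizers \<alpha> \<beta> S S\<beta> c)) (ereal \<beta>)) < c"
  proof -
    obtain y where y: "y \<in> Y" "y \<le> x" "mean y \<le> c"
    proof (cases "y1 \<le> x")
      case True
      then show ?thesis using that[of y1] y1 m1 by (simp add: Y)
    next
      case False
      \<comment> \<open>Here \<open>y2 < x < y1\<close>, so Y has two elements and the hypothesis of
        (B) applies at c. Starting at x instead of at the larger \<open>Sup Y\<close> makes a fall
        to \<open>Inf Y\<close> at least as likely, so the mean is no larger.\<close>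
      note ext = max_set_extrema[OF c y1 \<open>0 < ratio c y1\<close> max, folded Y]
      have YI: "Inf Y \<in> I" "Sup Y \<in> I" using ext(1,2) by (auto simp: Y)
      have in_Y: "y1 \<in> Y" "y2 \<in> Y" using y1 y2 r2 by (auto simp: Y)
      then have o: "Inf Y \<le> y2" "y1 \<le> Sup Y" using ext(3) by auto
      have "mean_at (P (Sup Y)) X (exit_time X (ereal \<beta>) (Inf Y) (ereal \<beta>)) < c"
        using hyp[rule_format, OF cI, folded Y_def] in_Y False y2x by force
      then have "\<beta> - (\<beta> - Inf Y) * (gap (Sup Y) / gap (Inf Y)) < c"
        using mean_exit_right_end[OF YI] o y2x False by simp
      moreover have "(\<beta> - Inf Y) * (gap (Sup Y) / gap (Inf Y)) \<le> (\<beta> - Inf Y) * (gap x / gap (Inf Y))"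
        using gap_le[OF x YI(2)] o False gap_pos[OF YI(1)] I_less[OF YI(1)]
        by (intro mult_left_mono divide_right_mono) auto
      ultimately show ?thesis using that[of "Inf Y"] ext(1) o y2x by (simp add: mean_def)
    qed
    then have o: "\<exists>p\<in>{0..1}. optimal_time M P X U x
        (mix_times U p (exit_time X (ereal \<beta>) y2 (ereal \<beta>)) (exit_time X (ereal \<beta>) y (ereal \<beta>)))"
      using optimal[of y \<beta>] xb by (auto simp: Y B_def mean)
    show ?thesis
      by (rule bexI[where x = y2], rule bexI[where x = y], rule o)
        (use y y2 y2x in \<open>auto simp: Y\<close>)
  qed
  have partC: "\<exists>ys\<in>einterval \<alpha> (ereal x).
        (\<forall>y\<in>einterval \<alpha> (ereal x).
          (S x - S y) / (S x - 1/2 * S y - 1/2 * S\<beta>) = deriv S y / (S\<beta> - S y) * (\<beta> - y)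
            \<longleftrightarrow> y = ys) \<and>
        optimal_time M P X U x (exit_time X (ereal \<beta>) ys (ereal \<beta>)) \<and>
        variance_value M P X U x =
          ennreal ((\<beta> - ys)\<^sup>2 * ((S\<beta> - S x) / (S\<beta> - S ys)) * ((S x - S ys) / (S\<beta> - S ys)))"
    if diff: "\<And>y. y \<in> I \<Longrightarrow> S differentiable (at y)"
      and anti: "antimono_on I (\<lambda>y. deriv S y / (S\<beta> - S y) * (\<beta> - y))"
  proof -
    define g where "g y = deriv S y / (S\<beta> - S y) * (\<beta> - y)" for y
    have crit: "g y = 2 + 2 * (\<beta> - c) / (2 * c - \<beta> - y)" if "y \<in> I" "ratio c y = B" for y
      unfolding g_def using that max below[OF that]
      by (intro maximizer_critical[OF dec that(1) _ diff]) (auto simp: B_def)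
    have g_anti: "g z \<le> g y" if "y \<in> I" "z \<in> I" "y \<le> z" for y z
      using monotone_onD[OF anti that] by (simp add: g_def)
    \<comment> \<open>The right side of \<open>crit\<close> strictly increases while g does not, so
      the maximizer is unique.\<close>
    have not_less: "\<not> y < z" if "y \<in> I" "z \<in> I" "ratio c y = B" "ratio c z = B" for y z
    proof
      assume "y < z"
      have den: "0 < 2 * c - \<beta> - y" "0 < 2 * c - \<beta> - z"
        using below[OF that(1,3)] below[OF that(2,4)] by simp_all
      have "2 * (\<beta> - c) / (2 * c - \<beta> - y) < 2 * (\<beta> - c) / (2 * c - \<beta> - z)"
        by (rule divide_strict_left_mono[OF _ _ mult_pos_pos[OF den]]) (use \<open>y < z\<close> c in simp_all)
      then have "g y < g z" unfolding crit[OF that(1,3)] crit[OF that(2,4)] by simp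
      then show False using g_anti[OF that(1,2) less_imp_le[OF \<open>y < z\<close>]] by simp
    qed
    have y12: "y1 = y2"
    proof (rule linorder_cases[of y1 y2])
      show "y1 < y2 \<Longrightarrow> y1 = y2" using not_less[OF y1 y2 B_def[symmetric] r2[folded B_def]] by simp
      show "y2 < y1 \<Longrightarrow> y1 = y2" using not_less[OF y2 y1 r2[folded B_def] B_def[symmetric]] by simp
    qed
    define ys where "ys = y2"
    define G where "G = gap ys"
    \<comment> \<open>The probability of stopping at \<open>ys\<close>. The mean condition becomes
      \<open>\<beta> - c = (\<beta> - ys) * q\<close>, and \<open>ys < 2 * c - \<beta>\<close>
      becomes \<open>q < 1 / 2\<close>.\<close>
    define q where "q = gap x / G"
    have ysI: "ys \<in> I" and ysx: "ys < x" and rys: "ratio c ys = B"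
      unfolding ys_def using y2 y2x r2[folded B_def] .
    have G: "0 < G" "gap x < G" using gap_pos[OF ysI] gap_less[OF ysI x ysx] by (auto simp: G_def)
    have meanc: "mean ys = c" using m1 m2 y12 by (simp add: ys_def)
    then have bc: "\<beta> - c = (\<beta> - ys) * q" by (simp add: mean_def q_def G_def)
    have b2: "2 * c - \<beta> - ys = (\<beta> - ys) * (1 - 2 * q)"
    proof -
      have "2 * c - \<beta> - ys = (\<beta> - ys) - 2 * (\<beta> - c)" by simp
      then show ?thesis unfolding bc by (simp add: algebra_simps)
    qed
    have ysb: "ys < \<beta>" by (rule I_less[OF ysI])
    have q: "0 < q" "0 < 1 - 2 * q"
    proof -
      show "0 < q" using gx G by (simp add: q_def)
      have "0 < (\<beta> - ys) * (1 - 2 * q)" using below[OF ysI rys] by (simp flip: b2)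
      then show "0 < 1 - 2 * q" using ysb by (simp add: zero_less_mult_iff)
    qed
    have lhs: "(S x - S y) / (S x - 1/2 * S y - 1/2 * S\<beta>) = (gap y - gap x) / (gap y / 2 - gap x)" for y
    proof -
      have "S x - 1/2 * S y - 1/2 * S\<beta> = gap y / 2 - gap x" "S x - S y = gap y - gap x"
        by (simp_all add: gap_def field_simps)
      then show ?thesis by simp
    qed
    \<comment> \<open>Inserting the mean condition eliminates c from the critical point equation and
      leaves the equation of (C).\<close>
    have sol: "(gap ys - gap x) / (gap ys / 2 - gap x) = g ys"
    proof -
      have "g ys = 2 + 2 * ((\<beta> - ys) * q) / ((\<beta> - ys) * (1 - 2 * q))"
        using crit[OF ysI rys] unfolding bc b2 .
      also have "\<dots> = 2 + 2 * q / (1 - 2 * q)" using ysb by simp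
      also have "\<dots> = (1 - q) / (1 / 2 - q)" using q by (simp add: field_simps)
      also have "\<dots> = (G * (1 - q)) / (G * (1 / 2 - q))" using G by simp
      also have "\<dots> = (gap ys - gap x) / (gap ys / 2 - gap x)" using G by (simp add: q_def G_def[symmetric] algebra_simps)
      finally show ?thesis by simp
    qed
    \<comment> \<open>At a solution g is positive, so the denominator is positive; this also rules
      out a quotient that is 0 by division by zero. With positive denominators the left side
      strictly increases in y, against \<open>g_anti\<close>.\<close>
    have no_two: False if "y \<in> I" "z \<in> I" "y < z" "z < x"
      "(gap y - gap x) / (gap y / 2 - gap x) = g y" "(gap z - gap x) / (gap z / 2 - gap x) = g z" for y z
    proof -
      have gg: "gap x < gap z" "gap z < gap y"
        using gap_less[OF that(2) x that(4)] gap_less[OF that(1,2,3)] .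
      have "0 < g u" if "u \<in> I" for u
        unfolding g_def by (rule log_gap_derivative_pos[OF that _ anti]) (rule diff)
      from this[OF that(2)] this[OF that(1)] have gpos: "0 < g z" "0 < g y" .
      have den: "0 < gap z / 2 - gap x" "0 < gap y / 2 - gap x"
        using gpos[folded that(5,6)] gg unfolding zero_less_divide_iff by linarith+
      have "gap x * gap z < gap x * gap y" using gg gx by simp
      then have "(gap y - gap x) * (gap z / 2 - gap x) < (gap z - gap x) * (gap y / 2 - gap x)"
        by (simp add: algebra_simps)
      then have "g y < g z" unfolding that(5,6)[symmetric] using den
        by (simp add: divide_less_eq less_divide_eq mult.commute)
      then show False using g_anti[OF that(1,2)] that(3) by simp
    qed
    have inI: "y \<in> I \<and> y < x" if "y \<in> einterval \<alpha> (ereal x)" for y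
      using that xb by (auto simp: einterval_iff intro: less_trans)
    have opt: "optimal_time M P X U x (exit_time X (ereal \<beta>) ys (ereal \<beta>))"
      using optimal[of ys \<beta>] ysI ysx xb rys meanc by (auto simp: ys_def[symmetric] mean mix_times_same)
    \<comment> \<open>With c eliminated, the dual value becomes
      \<open>(\<beta> - ys)^2 * q * (1 - q)\<close>, the variance of the law with mass q at
      \<open>ys\<close> and the rest at \<beta>.\<close>
    have "(\<beta> - c)\<^sup>2 + B * gap x = (\<beta> - ys)\<^sup>2 * (gap x / gap ys) * ((gap ys - gap x) / gap ys)"
    proof -
      have BG: "B * G = (ys - c)\<^sup>2 - (\<beta> - c)\<^sup>2" using quad[OF ysI] rys by (simp add: G_def)
      then have "B * gap x = q * ((ys - c)\<^sup>2 - (\<beta> - c)\<^sup>2)" using G by (simp add: q_def flip: BG)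
      moreover have "ys - c = - ((\<beta> - ys) * (1 - q))" using bc by (simp add: algebra_simps)
      ultimately have "(\<beta> - c)\<^sup>2 + B * gap x = (\<beta> - ys)\<^sup>2 * q * (1 - q)"
        unfolding bc by (simp add: power2_eq_square algebra_simps)
      moreover have "1 - q = (gap ys - gap x) / gap ys" using G by (simp add: q_def G_def diff_divide_distrib)
      ultimately show ?thesis by (simp add: q_def G_def)
    qed
    then have v: "variance_value M P X U x =
        ennreal ((\<beta> - ys)\<^sup>2 * ((S\<beta> - S x) / (S\<beta> - S ys)) * ((S x - S ys) / (S\<beta> - S ys)))"
      unfolding val by (simp add: gap_def)
    show ?thesis unfolding lhs
    proof (intro bexI[of _ ys] conjI ballI)
      show "ys \<in> einterval \<alpha> (ereal x)" using I_greater[OF ysI] ysx by (simp add: einterval_iff)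
      fix y assume "y \<in> einterval \<alpha> (ereal x)"
      then show "((gap y - gap x) / (gap y / 2 - gap x) = deriv S y / (S\<beta> - S y) * (\<beta> - y)) \<longleftrightarrow> y = ys"
        using no_two[of y ys] no_two[of ys y] sol inI[of y] ysI ysx unfolding g_def[symmetric]
        by (metis linorder_neqE_linordered_idom)
    qed (fact opt v)+
  qed
  show ?thesis
  proof (intro conjI impI)
    show "variance_value M P X U x < \<infinity>" by (simp add: val)
    show "\<exists>a\<in>I \<inter> {..x}. \<exists>y\<in>I \<inter> {..x}. \<exists>b\<in>{x..\<beta>}. \<exists>p\<in>{0..1}. optimal_time M P X U x
        (mix_times U p (exit_time X (ereal \<beta>) y (ereal \<beta>)) (exit_time X (ereal \<beta>) a (ereal b)))"
      using A y2 y2x by fastforce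
  qed (use partB partC in auto)
qed

end
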